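(* Let $m\ge2$ and $n\ge2$ be integers with $m$ odd and $2m=n$, and let $0<\lambda<1$. Let $g:B_2(0)\setminus\{0\}\to[0,\infty)$ be continuous with $g(x)=o\left(|x|^{-\frac{n-2}{1-\lambda}}\right)$ as $x\to0$. Let $u$ be a $C^{2m}$ nonnegative solution of $$0\le-\Delta^m u\le e^{u^\lambda+g^\lambda}\quad\text{in }B_2(0)\setminus\{0\}\subset\mathbb{R}^n.$$ Then $u(x)=o\left(|x|^{-\frac{n-2}{1-\lambda}}\right)$ as $x\to0$.
   Context: $\Delta^m$ is the $m$-fold iterated Laplacian; $B_r(0)$ is the open ball of radius $r$ about the origin. *)

theory Defs
  imports "HOL-Analysis.Analysis" "HOL-Library.Landau_Symbols"
begin

definition partial_deriv :: "'n::finite \<Rightarrow> (real^'n \<Rightarrow> real) \<Rightarrow> real^'n \<Rightarrow> real" where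
  "partial_deriv i f x = deriv (\<lambda>t. f (x + t *\<^sub>R axis i 1)) 0"

definition laplacian :: "(real^'n::finite \<Rightarrow> real) \<Rightarrow> real^'n \<Rightarrow> real" where
  "laplacian f x = (\<Sum>i\<in>UNIV. partial_deriv i (partial_deriv i f) x)"

definition iter_laplacian :: "nat \<Rightarrow> (real^'n::finite \<Rightarrow> real) \<Rightarrow> real^'n \<Rightarrow> real" where
  "iter_laplacian m f = (laplacian ^^ m) f"

fun C_k_on :: "nat \<Rightarrow> (real^'n::finite) set \<Rightarrow> (real^'n \<Rightarrow> real) \<Rightarrow> bool" where
  "C_k_on 0 S f = continuous_on S f"
| "C_k_on (Suc k) S f = (continuous_on S f \<and> (\<forall>x\<in>S. f differentiable (at x))
      \<and> (\<forall>i. C_k_on k S (partial_deriv i f)))"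

end

theory Submission
  imports Defs
begin

text \<open>
  Write \<open>f = - \<Delta>\<^sup>m u \<ge> 0\<close>. Testing the equation against \<open>|x|\<^bsup>2m-2\<^esup> (1 - \<epsilon>/|x|)\<^sub>+\<^bsup>2m+1\<^esup>\<close>, whose
  \<open>m\<close>-th Laplacian turns out to be nonnegative, and letting \<open>\<epsilon> \<rightarrow> 0\<close> shows that \<open>|x|\<^bsup>n-2\<^esup> f\<close> is integrable near
  the origin and that the mean of \<open>u\<close> over the annulus \<open>|x| \<sim> \<epsilon>\<close> is \<open>O(\<epsilon>\<^bsup>2-n\<^esup>)\<close>. Since \<open>n = 2m\<close>, the
  fundamental solution of \<open>\<Delta>\<^sup>m\<close> is a logarithm, and Green's formula on a ball of radius \<open>d\<close> gives
  \<open>u(x) \<le> C (mean of u + log (sup f) \<cdot> \<integral> f + 1)\<close>. Here \<open>log f \<le> u\<^sup>\<lambda> + g\<^sup>\<lambda>\<close> and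
  \<open>\<integral> f = o(|x|\<^bsup>2-n\<^esup>)\<close>. Evaluating this at a maximum point of \<open>u(y) (r - |y - x|)\<^sup>n\<close> on the ball of
  radius \<open>r = |x|/2\<close> makes \<open>sup u\<close> on the smaller ball comparable to \<open>u\<close> at its centre, and the
  resulting inequality \<open>U \<le> C |x|\<^bsup>2-n\<^esup> + o(|x|\<^bsup>2-n\<^esup>) (U\<^sup>\<lambda> + g\<^sup>\<lambda>)\<close> yields the claim.
\<close>

section \<open>Functions of class C^k on the real line\<close>

text \<open>The bound on \<open>f\<close> involves \<open>u\<close> itself, so the logarithmic
  representation has to be used at a point where \<open>u\<close> nearly dominates its
  neighbourhood; the weight \<open>(r - |y - x|)^n\<close> supplies one. The exponent is then
  forced: with \<open>K = |x|^(2-n)\<close>, an inequality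
  \<open>U <= C K + o(K) U^\<lambda>\<close> gives \<open>U = o(K^(1/(1-\<lambda>)))\<close>, and
  the term in \<open>g\<close> has the same order because \<open>W = K^(1/(1-\<lambda>))\<close>
  satisfies \<open>K W^\<lambda> = W\<close>. The sign of the tested Laplacian comes from algebra:
  in the variable \<open>t = \<epsilon>/|x|\<close> the radial Laplacian is a product of commuting
  operators \<open>c - t d/dt\<close>, and these respect cones spanned by the polynomials
  \<open>t^k (1-t)^j\<close>. Singular integrals are avoided throughout. Test functions and
  logarithms are replaced by profiles of class \<open>C^(2m)\<close> that are constant near 0, so
  Green's identity concerns only continuous integrands of compact support. The logarithm is
  flattened below a scale \<open>\<sigma>\<close>; its \<open>m\<close>-th Laplacian is then an
  approximate point mass whose total does not depend on \<open>\<sigma>\<close>.\<close>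

fun Ck :: "nat \<Rightarrow> (real \<Rightarrow> real) \<Rightarrow> bool" where
  "Ck 0 f \<longleftrightarrow> continuous_on UNIV f"
| "Ck (Suc k) f \<longleftrightarrow> (\<forall>x. (f has_real_derivative deriv f x) (at x)) \<and> Ck k (deriv f)"

lemma Ck_SucI:
  assumes "\<And>x. (f has_real_derivative f' x) (at x)" "Ck k f'"
  shows "Ck (Suc k) f"
proof -
  have "deriv f = f'" using assms(1) by (auto intro: DERIV_imp_deriv)
  then show ?thesis using assms by simp
qed

lemma Ck_continuous: "Ck k f \<Longrightarrow> continuous_on UNIV f"
proof (cases k)
  case (Suc j)
  assume "Ck k f"
  then have "isCont f x" for x using DERIV_isCont Suc by auto
  then show ?thesis by (simp add: continuous_on_eq_continuous_at)
qed simp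

lemma Ck_Suc_D: "Ck (Suc k) f \<Longrightarrow> Ck k f"
proof (induction k arbitrary: f)
  case 0
  then show ?case using Ck_continuous[of "Suc 0" f] by (metis Ck.simps(1))
next
  case (Suc k)
  then show ?case by (metis Ck.simps(2))
qed

lemma Ck_mono: "j \<le> k \<Longrightarrow> Ck k f \<Longrightarrow> Ck j f"
  by (induction k rule: dec_induct) (use Ck_Suc_D in auto)

lemma Ck_const [simp]: "Ck k (\<lambda>x. c)"
proof (induction k arbitrary: c)
  case (Suc k)
  show ?case
  proof (rule Ck_SucI)
    show "((\<lambda>x. c) has_real_derivative 0) (at x)" for x by simp
  qed (rule Suc.IH)
qed simp

lemma Ck_ident [simp]: "Ck k (\<lambda>x. x)"
proof (cases k)
  case (Suc j)
  show ?thesis unfolding Suc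
  proof (rule Ck_SucI)
    show "((\<lambda>x. x) has_real_derivative 1) (at x)" for x by simp
  qed simp
qed simp

lemma Ck_add: "Ck k f \<Longrightarrow> Ck k g \<Longrightarrow> Ck k (\<lambda>x. f x + g x)"
proof (induction k arbitrary: f g)
  case 0
  then show ?case by (simp add: continuous_on_add)
next
  case (Suc k)
  show ?case
  proof (rule Ck_SucI)
    show "((\<lambda>x. f x + g x) has_real_derivative deriv f x + deriv g x) (at x)" for x
      by (rule DERIV_add) (use Suc.prems in simp_all)
    show "Ck k (\<lambda>x. deriv f x + deriv g x)"
      by (rule Suc.IH) (use Suc.prems in simp_all)
  qed
qed

lemma Ck_mult: "Ck k f \<Longrightarrow> Ck k g \<Longrightarrow> Ck k (\<lambda>x. f x * g x)"
proof (induction k arbitrary: f g)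
  case 0
  then show ?case by (simp add: continuous_on_mult)
next
  case (Suc k)
  have k: "Ck k f" "Ck k g" using Suc.prems Ck_Suc_D by blast+
  show ?case
  proof (rule Ck_SucI)
    show "((\<lambda>x. f x * g x) has_real_derivative deriv f x * g x + deriv g x * f x) (at x)" for x
      by (rule DERIV_mult) (use Suc.prems in simp_all)
    show "Ck k (\<lambda>x. deriv f x * g x + deriv g x * f x)"
      by (intro Ck_add Suc.IH) (use Suc.prems k in simp_all)
  qed
qed

lemma Ck_cmult: "Ck k f \<Longrightarrow> Ck k (\<lambda>x. c * f x)"
  by (rule Ck_mult) auto

lemma Ck_diff: "Ck k f \<Longrightarrow> Ck k g \<Longrightarrow> Ck k (\<lambda>x. f x - g x)"
  using Ck_add[OF _ Ck_cmult[of k g "-1"], of f] by simp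

lemma Ck_power: "Ck k f \<Longrightarrow> Ck k (\<lambda>x. f x ^ j)"
  by (induction j) (simp_all add: Ck_mult)

lemma Ck_affine: "Ck k f \<Longrightarrow> Ck k (\<lambda>x. f (c * x + b))"
proof (induction k arbitrary: f)
  case 0
  then have "continuous_on UNIV f" by simp
  then have "continuous_on UNIV (\<lambda>x. f (c * x + b))"
    by (rule continuous_on_compose2) (auto intro!: continuous_intros)
  then show ?case by simp
next
  case (Suc k)
  show ?case
  proof (rule Ck_SucI)
    show "((\<lambda>x. f (c * x + b)) has_real_derivative deriv f (c * x + b) * c) (at x)" for x
    proof (rule DERIV_chain2[where f = f and g = "\<lambda>x. c * x + b"])
      show "(f has_real_derivative deriv f (c * x + b)) (at (c * x + b))" using Suc.prems by simp
      show "((\<lambda>x. c * x + b) has_real_derivative c) (at x)"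
        by (auto intro!: derivative_eq_intros)
    qed
    show "Ck k (\<lambda>x. deriv f (c * x + b) * c)"
      by (rule Ck_mult[OF Suc.IH Ck_const]) (use Suc.prems in simp)
  qed
qed

text \<open>Equality near \<open>x\<close> passes to the derivatives near \<open>x\<close>, not
  merely at \<open>x\<close>, so the rule can be iterated up to the \<open>m\<close>-th radial
  Laplacian.\<close>

lemma eventually_deriv_eq:
  fixes f g :: "real \<Rightarrow> real"
  assumes "eventually (\<lambda>y. f y = g y) (nhds x)"
  shows "eventually (\<lambda>y. deriv f y = deriv g y) (nhds x)"
proof -
  have "eventually (\<lambda>z. eventually (\<lambda>y. f y = g y) (nhds z)) (nhds x)"
    using assms by (simp add: eventually_eventually)
  then show ?thesis
    by (rule eventually_mono) (rule deriv_cong_ev, auto)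
qed

lemma has_real_derivative_eventually_eq:
  assumes "eventually (\<lambda>y. f y = g y) (nhds x)" "(g has_real_derivative D) (at x)"
  shows "(f has_real_derivative D) (at x)"
  using DERIV_cong_ev[OF refl assms(1) refl] assms(2) by blast

lemma deriv_zero_left:
  fixes f :: "real \<Rightarrow> real"
  assumes "\<And>r. r < a \<Longrightarrow> f r = c" "x < a"
  shows "deriv f x = 0"
proof -
  have "eventually (\<lambda>y. f y = c) (nhds x)"
    using assms by (auto simp: eventually_nhds intro: exI[of _ "{..<a}"])
  then have "deriv f x = deriv (\<lambda>y. c) x" by (rule deriv_cong_ev) simp
  then show ?thesis by simp
qed

text \<open>On \<open>r < a\<close> the quotient is 0, also at \<open>r = 0\<close>, where division
  yields 0. Its derivative \<open>f'/r - (f/r)/r\<close> consists of quotients of the same type, so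
  the induction hypothesis applies to \<open>f\<close>, to \<open>f/r\<close> and to
  \<open>f'\<close>.\<close>

lemma Ck_divide_ident:
  assumes "Ck k f" "\<And>r. r < a \<Longrightarrow> f r = 0" "a > 0"
  shows "Ck k (\<lambda>r. f r / r)"
  using assms(1,2)
proof (induction k arbitrary: f)
  case 0
  have "isCont (\<lambda>r. f r / r) x" for x
  proof (cases "x < a")
    case True
    have "eventually (\<lambda>y. f y / y = 0) (nhds x)"
      using 0 True by (auto simp: eventually_nhds intro: exI[of _ "{..<a}"])
    from isCont_cong[OF this] show ?thesis by simp
  next
    case False
    then show ?thesis using 0 \<open>a > 0\<close>
      by (intro isCont_divide) (simp_all add: continuous_on_eq_continuous_at)
  qed
  then show ?case by (simp add: continuous_on_eq_continuous_at)
next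
  case (Suc k)
  let ?g = "\<lambda>r. deriv f r / r - (f r / r) / r"
  have d0: "deriv f r = 0" if "r < a" for r using deriv_zero_left[OF Suc.prems(2) that] .
  have "((\<lambda>r. f r / r) has_real_derivative ?g x) (at x)" for x
  proof (cases "x < a")
    case True
    have "eventually (\<lambda>y. f y / y = 0) (nhds x)"
      using Suc.prems True by (auto simp: eventually_nhds intro: exI[of _ "{..<a}"])
    then have "((\<lambda>r. f r / r) has_real_derivative 0) (at x)"
      by (rule has_real_derivative_eventually_eq) simp
    then show ?thesis using d0[OF True] Suc.prems(2)[OF True] by simp
  next
    case False
    then have "x \<noteq> 0" using \<open>a > 0\<close> by simp
    have "((\<lambda>r. f r / r) has_real_derivative (deriv f x * x - f x * 1) / (x * x)) (at x)"
      by (rule DERIV_divide) (use Suc.prems(1) \<open>x \<noteq> 0\<close> in simp_all)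
    then show ?thesis using \<open>x \<noteq> 0\<close> by (simp add: field_simps)
  qed
  moreover have "Ck k ?g"
  proof -
    have f: "Ck k f" using Suc.prems Ck_Suc_D by blast
    have "Ck k (\<lambda>r. f r / r)" by (rule Suc.IH[OF f Suc.prems(2)])
    then have q: "Ck k (\<lambda>r. (f r / r) / r)" by (rule Suc.IH) (use Suc.prems(2) in auto)
    have "Ck k (\<lambda>r. deriv f r / r)" by (rule Suc.IH) (use Suc.prems d0 in simp_all)
    then show ?thesis using q by (rule Ck_diff)
  qed
  ultimately show ?case by (rule Ck_SucI)
qed

lemma Ck_divide_power:
  assumes "Ck k f" "\<And>r. r < a \<Longrightarrow> f r = 0" "a > 0"
  shows "Ck k (\<lambda>r. f r / r ^ j)"
proof (induction j)
  case (Suc j)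
  have "Ck k (\<lambda>r. (f r / r ^ j) / r)"
    by (rule Ck_divide_ident[OF Suc]) (use assms in auto)
  then show ?case by (simp add: divide_divide_eq_left mult.commute)
qed (use assms in simp)

text \<open>Away from 0 differentiation lowers the power by one; at 0 the difference quotient is at
  most a positive power of \<open>|h|\<close>.\<close>

lemma Ck_pos_part_power: "Ck k (\<lambda>x. max 0 x ^ Suc k)"
proof (induction k)
  case (Suc k)
  have "((\<lambda>x. max 0 x ^ Suc (Suc k)) has_real_derivative real (Suc (Suc k)) * max 0 x ^ Suc k) (at x)"
    for x :: real
  proof (cases x "0::real" rule: linorder_cases)
    case less
    have "eventually (\<lambda>y::real. max 0 y ^ Suc (Suc k) = 0) (nhds x)"
      using less by (auto simp: eventually_nhds intro!: exI[of _ "{..<0}"])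
    then have "((\<lambda>y::real. max 0 y ^ Suc (Suc k)) has_real_derivative 0) (at x)"
      by (rule has_real_derivative_eventually_eq) simp
    then show ?thesis using less by simp
  next
    case greater
    have "eventually (\<lambda>y::real. max 0 y ^ Suc (Suc k) = y ^ Suc (Suc k)) (nhds x)"
      using greater by (auto simp: eventually_nhds intro!: exI[of _ "{0<..}"])
    moreover have "((\<lambda>y::real. y ^ Suc (Suc k)) has_real_derivative real (Suc (Suc k)) * x ^ Suc k) (at x)"
      using DERIV_pow[of "Suc (Suc k)" x] by simp
    ultimately have "((\<lambda>y::real. max 0 y ^ Suc (Suc k)) has_real_derivative real (Suc (Suc k)) * x ^ Suc k) (at x)"
      by (rule has_real_derivative_eventually_eq)
    then show ?thesis using greater by simp
  next
    case equal
    have "((\<lambda>h::real. (max 0 (0 + h) ^ Suc (Suc k) - max 0 0 ^ Suc (Suc k)) / h) \<longlongrightarrow> 0) (at 0)"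
    proof (rule Lim_null_comparison)
      show "eventually (\<lambda>h::real. norm ((max 0 (0 + h) ^ Suc (Suc k) - max 0 0 ^ Suc (Suc k)) / h) \<le> \<bar>h\<bar> ^ Suc k) (at 0)"
      proof (rule always_eventually, rule allI)
        fix h :: real
        show "norm ((max 0 (0 + h) ^ Suc (Suc k) - max 0 0 ^ Suc (Suc k)) / h) \<le> \<bar>h\<bar> ^ Suc k"
          using zero_le_power[OF abs_ge_zero, of h "Suc k"] by (cases "h > 0") (simp_all del: power_Suc add: power_Suc2)
      qed
      show "((\<lambda>h::real. \<bar>h\<bar> ^ Suc k) \<longlongrightarrow> 0) (at 0)"
        by (auto intro!: tendsto_eq_intros)
    qed
    then show ?thesis using equal by (simp add: DERIV_def)
  qed
  then show ?case by (rule Ck_SucI) (rule Ck_cmult[OF Suc])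
qed (auto intro!: continuous_intros)

lemma Ck_antiderivative:
  assumes "Ck k f"
  obtains F where "Ck (Suc k) F" "\<And>x. (F has_real_derivative f x) (at x)"
proof -
  have "\<exists>F. \<forall>x. -\<infinity> < ereal x \<longrightarrow> ereal x < \<infinity> \<longrightarrow> (F has_vector_derivative f x) (at x)"
    by (rule einterval_antiderivative)
       (use Ck_continuous[OF assms] in \<open>auto simp: continuous_on_eq_continuous_at\<close>)
  then obtain F where F: "\<And>x. (F has_real_derivative f x) (at x)"
    by (auto simp: has_real_derivative_iff_has_vector_derivative)
  then show ?thesis using that[of F] Ck_SucI[OF F assms] by blast
qed

text \<open>An antiderivative of a bump supported in \<open>[3/5, 1]\<close>, reflected and
  normalised. The plateau ends at \<open>3/5\<close> instead of \<open>1/2\<close> so that the open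
  regions \<open>r < 3/5\<close> and \<open>r > 1/2\<close>, on which separate formulas will be
  used, overlap. The strict sign at \<open>4/5\<close> makes the mass in
  \<open>comparison_profile_exists\<close> positive.\<close>

lemma cutoff_exists:
  obtains \<zeta> :: "real \<Rightarrow> real" where "Ck (Suc k) \<zeta>" "\<And>r. r \<le> 3/5 \<Longrightarrow> \<zeta> r = 1" "\<And>r. r \<ge> 1 \<Longrightarrow> \<zeta> r = 0"
    "\<And>r. 0 \<le> \<zeta> r" "\<And>r. \<zeta> r \<le> 1" "\<And>r. deriv \<zeta> r \<le> 0" "deriv \<zeta> (4/5) < 0"
proof -
  define b :: "real \<Rightarrow> real" where "b r = max 0 (r - 3/5) ^ Suc k * max 0 (1 - r) ^ Suc k" for r
  have b: "Ck k b"
    unfolding b_def using Ck_affine[OF Ck_pos_part_power, of k 1 "-3/5"] Ck_affine[OF Ck_pos_part_power, of k "-1" 1]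
    by (intro Ck_mult) auto
  have b0: "b r \<ge> 0" for r by (simp add: b_def)
  have b1: "b r = 0" if "r \<le> 3/5 \<or> r \<ge> 1" for r using that by (auto simp: b_def)
  have b2: "b (4/5) > 0" by (simp add: b_def)
  obtain B where B: "Ck (Suc k) B" "\<And>x. (B has_real_derivative b x) (at x)"
    using Ck_antiderivative[OF b] by blast
  have mono: "B x \<le> B y" if "x \<le> y" for x y
    by (rule DERIV_nonneg_imp_nondecreasing[OF that]) (use B b0 in auto)
  have const: "B y = B x" if "x \<le> y" "\<And>z. x < z \<Longrightarrow> z < y \<Longrightarrow> b z = 0" for x y
  proof (cases "x = y")
    case False
    have "continuous_on {x..y} B"
      using Ck_continuous[OF B(1)] by (rule continuous_on_subset) simp
    then show ?thesis
    proof (rule DERIV_isconst_end[rotated])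
      show "(B has_real_derivative 0) (at z)" if "x < z" "z < y" for z
        using B(2)[of z] \<open>\<And>z. x < z \<Longrightarrow> z < y \<Longrightarrow> b z = 0\<close>[OF that] by simp
    qed (use that False in simp)
  qed simp
  have l: "B r = B (3/5)" if "r \<le> 3/5" for r
    using const[of r "3/5"] that b1 by simp
  have u: "B r = B 1" if "r \<ge> 1" for r
    using const[of 1 r] that b1 by simp
  have lt: "B (3/5) < B 1"
  proof (rule ccontr)
    assume "\<not> B (3/5) < B 1"
    then have c: "B y = B 1" if "3/5 < y" "y < 1" for y using mono[of "3/5" y] mono[of y 1] that by simp
    have "eventually (\<lambda>y. B y = B 1) (nhds (4/5))"
      using c by (auto simp: eventually_nhds intro!: exI[of _ "{3/5<..<1}"])
    then have "(B has_real_derivative 0) (at (4/5))"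
      by (rule has_real_derivative_eventually_eq) simp
    then show False using B(2)[of "4/5"] b2 DERIV_unique by force
  qed
  define \<zeta> where "\<zeta> r = (B 1 - B r) * inverse (B 1 - B (3/5))" for r
  have d: "(\<zeta> has_real_derivative - b r * inverse (B 1 - B (3/5))) (at r)" for r
    unfolding \<zeta>_def by (auto intro!: derivative_eq_intros B)
  have d': "deriv \<zeta> r = - b r * inverse (B 1 - B (3/5))" for r using d DERIV_imp_deriv by blast
  show ?thesis
  proof (rule that[of \<zeta>])
    show "Ck (Suc k) \<zeta>" unfolding \<zeta>_def using B by (intro Ck_mult Ck_diff) auto
    show "\<zeta> r = 1" if "r \<le> 3/5" for r using l[OF that] lt by (simp add: \<zeta>_def)
    show "\<zeta> r = 0" if "r \<ge> 1" for r using u[OF that] by (simp add: \<zeta>_def)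
    show "0 \<le> \<zeta> r" for r using mono[of r 1] u[of r] lt by (cases "r \<le> 1") (auto simp: \<zeta>_def)
    show "\<zeta> r \<le> 1" for r using mono[of "3/5" r] l[of r] lt
      by (cases "r \<ge> 3/5") (auto simp: \<zeta>_def field_simps)
    show "deriv \<zeta> r \<le> 0" for r using b0[of r] lt by (simp add: d' field_simps)
    show "deriv \<zeta> (4/5) < 0" using b2 lt by (simp add: d' field_simps)
  qed
qed

lemma Ck_bounded:
  assumes "Ck k f" "\<And>r. r < 0 \<Longrightarrow> f r = 0" "\<And>r. r > R \<Longrightarrow> f r = 0"
  obtains C where "C > 0" "\<And>r. \<bar>f r\<bar> \<le> C"
proof -
  have "compact (f ` {0..R})"
    using Ck_continuous[OF assms(1)] by (intro compact_continuous_image) (auto intro: continuous_on_subset)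
  then obtain C where C: "C > 0" "\<And>r. r \<in> {0..R} \<Longrightarrow> \<bar>f r\<bar> \<le> C"
    by (metis (no_types, lifting) bounded_pos compact_imp_bounded imageI real_norm_def)
  have "\<bar>f r\<bar> \<le> C" for r
    using C assms(2,3)[of r] by (cases "r \<in> {0..R}") auto
  with C(1) that show ?thesis by blast
qed

section \<open>The radial Laplacian\<close>

definition rlap :: "nat \<Rightarrow> (real \<Rightarrow> real) \<Rightarrow> real \<Rightarrow> real" where
  "rlap n H r = deriv (deriv H) r + (real n - 1) / r * deriv H r"

lemma rlap_eventually_eq:
  assumes "eventually (\<lambda>y. F y = G y) (nhds x)"
  shows "eventually (\<lambda>y. rlap n F y = rlap n G y) (nhds x)"
  using eventually_deriv_eq[OF assms] eventually_deriv_eq[OF eventually_deriv_eq[OF assms]]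
  by eventually_elim (simp add: rlap_def)

lemma rlap_funpow_eventually_eq:
  assumes "eventually (\<lambda>y. F y = G y) (nhds x)"
  shows "eventually (\<lambda>y. (rlap n ^^ k) F y = (rlap n ^^ k) G y) (nhds x)"
  by (induction k) (simp_all add: assms rlap_eventually_eq)

lemma rlap_funpow_cong:
  assumes "open A" "\<And>y. y \<in> A \<Longrightarrow> F y = G y" "x \<in> A"
  shows "(rlap n ^^ k) F x = (rlap n ^^ k) G x"
proof -
  have "eventually (\<lambda>y. F y = G y) (nhds x)" using assms by (auto simp: eventually_nhds)
  from eventually_nhds_x_imp_x[OF rlap_funpow_eventually_eq[OF this]] show ?thesis .
qed

text \<open>The constant start makes \<open>H (norm (y - x))\<close> as regular at
  \<open>y = x\<close> as elsewhere and neutralises the factor \<open>1/r\<close> in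
  \<open>rlap\<close>. Profiles live on the whole line, so no one-sided derivatives at 0
  occur.\<close>

definition rad :: "nat \<Rightarrow> (real \<Rightarrow> real) \<Rightarrow> bool" where
  "rad k H \<longleftrightarrow> Ck k H \<and> (\<exists>a c. a > 0 \<and> (\<forall>r<a. H r = c))"

lemma radI: "Ck k H \<Longrightarrow> a > 0 \<Longrightarrow> (\<And>r. r < a \<Longrightarrow> H r = c) \<Longrightarrow> rad k H"
  unfolding rad_def by blast

lemma rad_mono: "j \<le> k \<Longrightarrow> rad k H \<Longrightarrow> rad j H"
  unfolding rad_def using Ck_mono by blast

lemma rlap_zero_left:
  assumes "\<And>r. r < a \<Longrightarrow> H r = c" "r < a"
  shows "rlap n H r = 0"
proof -
  have d: "deriv H s = 0" if "s < a" for s using deriv_zero_left[OF assms(1) that] by simp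
  show ?thesis using d[OF assms(2)] deriv_zero_left[OF d assms(2)] by (simp add: rlap_def)
qed

text \<open>\<open>deriv H\<close> vanishes for \<open>r < a\<close>, so \<open>deriv H / r\<close>
  is as regular as \<open>deriv H\<close>.\<close>

lemma rad_rlap:
  assumes "rad (Suc (Suc k)) H"
  shows "rad k (rlap n H)"
proof -
  from assms obtain a c where H: "Ck (Suc (Suc k)) H" "a > 0" "\<And>r. r < a \<Longrightarrow> H r = c"
    unfolding rad_def by blast
  have d: "deriv H s = 0" if "s < a" for s using deriv_zero_left[OF H(3) that] by simp
  have "Ck k (deriv H)" "Ck k (deriv (deriv H))" using H(1) Ck_Suc_D by auto
  then have "Ck k (\<lambda>r. deriv (deriv H) r + (real n - 1) * (deriv H r / r))"
    by (intro Ck_add Ck_cmult Ck_divide_ident[of k "deriv H" a] d H(2))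
  moreover have "(\<lambda>r. deriv (deriv H) r + (real n - 1) * (deriv H r / r)) = rlap n H"
    by (simp add: rlap_def fun_eq_iff)
  ultimately show ?thesis using rlap_zero_left[OF H(3)] H(2) by (intro radI) auto
qed

lemma rad_rlap_funpow: "rad (2 * j + k) H \<Longrightarrow> rad k ((rlap n ^^ j) H)"
proof (induction j arbitrary: k)
  case (Suc j)
  have "rad (Suc (Suc k)) ((rlap n ^^ j) H)"
    by (rule Suc.IH) (use Suc.prems in simp)
  then show ?case using rad_rlap by simp
qed simp

lemma rad_add: "rad k F \<Longrightarrow> rad k G \<Longrightarrow> rad k (\<lambda>r. F r + G r)"
proof -
  assume "rad k F" "rad k G"
  then obtain a b c d where *: "Ck k F" "Ck k G" "a > 0" "b > 0"
    "\<forall>r<a. F r = c" "\<forall>r<b. G r = d" unfolding rad_def by blast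
  show ?thesis by (rule radI[of _ _ "min a b" "c + d"]) (use * Ck_add in auto)
qed

lemma rad_cmult: "rad k F \<Longrightarrow> rad k (\<lambda>r. c * F r)"
  unfolding rad_def using Ck_cmult by metis

lemma rad_diff: "rad k F \<Longrightarrow> rad k G \<Longrightarrow> rad k (\<lambda>r. F r - G r)"
  using rad_add[OF _ rad_cmult[of k G "-1"], of F] by simp

lemma rad_const: "rad k (\<lambda>r. c)"
  by (rule radI[of _ _ 1 c]) auto

lemma rad_scale:
  assumes "rad k F" "d > 0"
  shows "rad k (\<lambda>r. F (r / d))"
proof -
  obtain a c where *: "Ck k F" "a > 0" "\<And>r. r < a \<Longrightarrow> F r = c"
    using assms unfolding rad_def by blast
  have "Ck k (\<lambda>r. F (1 / d * r + 0))" by (rule Ck_affine[OF *(1)])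
  then show ?thesis
    by (intro radI[of _ _ "a * d" c]) (use * assms(2) in \<open>auto simp: field_simps\<close>)
qed

lemma rlap_add:
  assumes "Ck 2 F" "Ck 2 G"
  shows "rlap n (\<lambda>r. F r + G r) = (\<lambda>r. rlap n F r + rlap n G r)"
proof -
  have F: "(F has_real_derivative deriv F x) (at x)" "(deriv F has_real_derivative deriv (deriv F) x) (at x)"
   and G: "(G has_real_derivative deriv G x) (at x)" "(deriv G has_real_derivative deriv (deriv G) x) (at x)" for x
    using assms by (simp_all add: numeral_2_eq_2)
  have 1: "deriv (\<lambda>r. F r + G r) = (\<lambda>r. deriv F r + deriv G r)"
    using DERIV_add[OF F(1) G(1)] DERIV_imp_deriv by blast
  have 2: "deriv (\<lambda>r. deriv F r + deriv G r) = (\<lambda>r. deriv (deriv F) r + deriv (deriv G) r)"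
    using DERIV_add[OF F(2) G(2)] DERIV_imp_deriv by blast
  show ?thesis by (simp add: fun_eq_iff rlap_def 1 2 algebra_simps)
qed

lemma rlap_cmult:
  assumes "Ck 2 F"
  shows "rlap n (\<lambda>r. c * F r) = (\<lambda>r. c * rlap n F r)"
proof -
  have F: "(F has_real_derivative deriv F x) (at x)" "(deriv F has_real_derivative deriv (deriv F) x) (at x)"  for x
    using assms by (simp_all add: numeral_2_eq_2)
  have 1: "deriv (\<lambda>r. c * F r) = (\<lambda>r. c * deriv F r)"
    using DERIV_cmult[OF F(1)] DERIV_imp_deriv by blast
  have 2: "deriv (\<lambda>r. c * deriv F r) = (\<lambda>r. c * deriv (deriv F) r)"
    using DERIV_cmult[OF F(2)] DERIV_imp_deriv by blast
  show ?thesis by (simp add: fun_eq_iff rlap_def 1 2 algebra_simps)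
qed

lemma rlap_scale:
  assumes "Ck 2 F" "d \<noteq> 0"
  shows "rlap n (\<lambda>r. F (r / d)) = (\<lambda>r. inverse (d\<^sup>2) * rlap n F (r / d))"
proof -
  have ch: "((\<lambda>r. F (r / d)) has_real_derivative deriv F (x / d) * (1 / d)) (at x)"
    if "\<And>x. (F has_real_derivative deriv F x) (at x)" for F x
    by (rule DERIV_chain2[where f = F and g = "\<lambda>r. r / d"])
       (use that assms(2) in \<open>auto intro!: derivative_eq_intros\<close>)
  have F: "(F has_real_derivative deriv F x) (at x)" "(deriv F has_real_derivative deriv (deriv F) x) (at x)"  for x
    using assms(1) by (simp_all add: numeral_2_eq_2)
  have 1: "deriv (\<lambda>r. F (r / d)) = (\<lambda>r. deriv F (r / d) * (1 / d))"
    using ch[OF F(1)] DERIV_imp_deriv by blast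
  have "((\<lambda>r. deriv F (r / d) * (1 / d)) has_real_derivative deriv (deriv F) (x / d) * (1 / d) * (1 / d)) (at x)" for x
    by (rule DERIV_cmult_right[OF ch[OF F(2)]])
  then have 2: "deriv (\<lambda>r. deriv F (r / d) * (1 / d)) = (\<lambda>r. deriv (deriv F) (r / d) * (1 / d) * (1 / d))"
    using DERIV_imp_deriv by blast
  show ?thesis unfolding rlap_def 1 2
  proof (rule ext)
    fix x
    show "deriv (deriv F) (x / d) * (1 / d) * (1 / d) + (real n - 1) / x * (deriv F (x / d) * (1 / d)) =
      inverse (d\<^sup>2) * (deriv (deriv F) (x / d) + (real n - 1) / (x / d) * deriv F (x / d))"
      using assms(2) by (cases "x = 0") (auto simp: power2_eq_square field_simps)
  qed
qed

lemma rad_Ck: "rad k F \<Longrightarrow> j \<le> k \<Longrightarrow> Ck j F"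
  unfolding rad_def using Ck_mono by blast

lemma rlap_funpow_add:
  assumes "rad (2 * k) F" "rad (2 * k) G"
  shows "(rlap n ^^ k) (\<lambda>r. F r + G r) = (\<lambda>r. (rlap n ^^ k) F r + (rlap n ^^ k) G r)"
  using assms
proof (induction k)
  case (Suc k)
  have "Ck 2 ((rlap n ^^ k) H)" if "rad (2 * Suc k) H" for H
    using rad_rlap_funpow[of k 2 H n] that rad_Ck[of 2 _ 2] by (simp add: add.commute)
  with Suc show ?case using rlap_add rad_mono[of "2 * k" "2 * Suc k"] by simp
qed simp

lemma rlap_funpow_cmult:
  assumes "rad (2 * k) F"
  shows "(rlap n ^^ k) (\<lambda>r. c * F r) = (\<lambda>r. c * (rlap n ^^ k) F r)"
  using assms
proof (induction k)
  case (Suc k)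
  have "Ck 2 ((rlap n ^^ k) H)" if "rad (2 * Suc k) H" for H
    using rad_rlap_funpow[of k 2 H n] that rad_Ck[of 2 _ 2] by (simp add: add.commute)
  with Suc show ?case using rlap_cmult rad_mono[of "2 * k" "2 * Suc k"] by simp
qed simp

lemma rlap_funpow_diff:
  assumes "rad (2 * k) F" "rad (2 * k) G"
  shows "(rlap n ^^ k) (\<lambda>r. F r - G r) = (\<lambda>r. (rlap n ^^ k) F r - (rlap n ^^ k) G r)"
  using rlap_funpow_add[OF assms(1) rad_cmult[OF assms(2), of "-1"], of n] rlap_funpow_cmult[OF assms(2), of n "-1"]
  by simp

lemma rlap_funpow_sum:
  assumes "finite I" "\<And>i. i \<in> I \<Longrightarrow> rad (2 * k) (F i)"
  shows "rad (2 * k) (\<lambda>r. \<Sum>i\<in>I. F i r) \<and>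
    (rlap n ^^ k) (\<lambda>r. \<Sum>i\<in>I. F i r) = (\<lambda>r. \<Sum>i\<in>I. (rlap n ^^ k) (F i) r)"
  using assms
proof (induction I rule: finite_induct)
  case empty
  have "(rlap n ^^ k) (\<lambda>r. 0 * 0) = (\<lambda>r. 0 * (rlap n ^^ k) (\<lambda>r. 0) r)"
    by (rule rlap_funpow_cmult[OF rad_const])
  then show ?case using rad_const by simp
next
  case (insert x I)
  then show ?case using rlap_funpow_add[of k "F x" "\<lambda>r. \<Sum>i\<in>I. F i r" n] rad_add by simp
qed

lemma rlap_funpow_scale:
  assumes "rad (2 * k) F" "d \<noteq> 0"
  shows "(rlap n ^^ k) (\<lambda>r. F (r / d)) = (\<lambda>r. inverse (d ^ (2 * k)) * (rlap n ^^ k) F (r / d))"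
  using assms(1)
proof (induction k)
  case (Suc k)
  have c: "Ck 2 ((rlap n ^^ k) F)"
    using rad_rlap_funpow[of k 2 F n] Suc.prems rad_Ck[of 2 _ 2] by (simp add: add.commute)
  have c': "Ck 2 (\<lambda>r. (rlap n ^^ k) F (r / d))"
    using Ck_affine[OF c, of "1 / d" 0] by simp
  have "(rlap n ^^ k) (\<lambda>r. F (r / d)) = (\<lambda>r. inverse (d ^ (2 * k)) * (rlap n ^^ k) F (r / d))"
    using Suc rad_mono[of "2 * k" "2 * Suc k"] by simp
  then show ?case
    by (simp add: rlap_cmult[OF c'] rlap_scale[OF c assms(2)] power2_eq_square mult.assoc mult.left_commute)
qed simp

section \<open>Euler operators: the radial Laplacian on functions \<open>r^b W(e/r)\<close>\<close>

definition euler :: "real \<Rightarrow> real poly \<Rightarrow> real poly" where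
  "euler c p = smult c p - pCons 0 (pderiv p)"

lemma euler_commute: "euler c (euler d p) = euler d (euler c p)"
  by (simp add: euler_def pderiv_diff pderiv_smult smult_diff_right pderiv_pCons algebra_simps smult_add_right)

lemma poly_euler: "poly (euler c p) t = c * poly p t - t * poly (pderiv p) t"
  by (simp add: euler_def)

text \<open>In the variable \<open>t = e/r\<close>, applying \<open>r d/dr\<close> to
  \<open>r^b W(t)\<close> amounts to applying \<open>b - t d/dt\<close> to \<open>W\<close>; this is
  \<open>euler b\<close>. All these operators are polynomials in \<open>t d/dt\<close> and therefore
  commute.\<close>

lemma deriv_powi_poly:
  assumes "r > 0"
  shows "((\<lambda>r. r powi b * poly W (e / r)) has_real_derivative
     r powi (b - 1) * poly (euler (real_of_int b) W) (e / r)) (at r)"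
proof -
  have "((\<lambda>r. poly W (e / r)) has_real_derivative poly (pderiv W) (e / r) * (- e / r\<^sup>2)) (at r)"
    by (rule DERIV_chain2[OF poly_DERIV]) (use assms in \<open>auto intro!: derivative_eq_intros simp: power2_eq_square\<close>)
  moreover have "((\<lambda>r. r powi b) has_real_derivative real_of_int b * r powi (b - 1)) (at r)"
    by (rule has_derivative_imp_has_field_derivative[OF has_derivative_power_int']) (use assms in simp_all)
  ultimately have "((\<lambda>r. r powi b * poly W (e / r)) has_real_derivative
     real_of_int b * r powi (b - 1) * poly W (e / r) + poly (pderiv W) (e / r) * (- e / r\<^sup>2) * r powi b) (at r)"
    by (rule DERIV_mult[rotated])
  moreover have "r powi b = r powi (b - 1) * r"
    using assms by (simp add: power_int_diff)
  ultimately show ?thesis using assms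
    by (simp add: poly_euler field_simps power2_eq_square)
qed

lemma rlap_powi_poly:
  assumes "open A" "A \<subseteq> {0<..}" "\<And>r. r \<in> A \<Longrightarrow> H r = r powi b * poly W (e / r)" "r \<in> A"
  shows "rlap n H r = r powi (b - 2) * poly (euler (real_of_int b) (euler (real_of_int b + real n - 2) W)) (e / r)"
proof -
  have ev: "eventually (\<lambda>s. s \<in> A) (nhds r)" if "r \<in> A" for r
    using assms(1) that by (auto simp: eventually_nhds)
  have d: "deriv H r = r powi (b - 1) * poly (euler (real_of_int b) W) (e / r)" if "r \<in> A" for r
  proof (rule DERIV_imp_deriv)
    have "eventually (\<lambda>s. H s = s powi b * poly W (e / s)) (nhds r)"
      using ev[OF that] by eventually_elim (rule assms(3))
    moreover have "r > 0" using that assms(2) by auto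
    ultimately show "(H has_real_derivative r powi (b - 1) * poly (euler (real_of_int b) W) (e / r)) (at r)"
      by (intro has_real_derivative_eventually_eq[OF _ deriv_powi_poly])
  qed
  let ?W = "euler (real_of_int b) W"
  have "(deriv H has_real_derivative r powi (b - 1 - 1) * poly (euler (real_of_int (b - 1)) ?W) (e / r)) (at r)"
  proof -
    have "eventually (\<lambda>s. deriv H s = s powi (b - 1) * poly ?W (e / s)) (nhds r)"
      using ev[OF assms(4)] by eventually_elim (rule d)
    moreover have "r > 0" using assms by auto
    ultimately show ?thesis
      by (intro has_real_derivative_eventually_eq[OF _ deriv_powi_poly])
  qed
  then have dd: "deriv (deriv H) r = r powi (b - 2) * poly (euler (real_of_int b - 1) ?W) (e / r)"
    by (intro DERIV_imp_deriv) simp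
  have "r > 0" using assms by auto
  then have "r powi (b - 1) = r powi (b - 2) * r"
    by (simp add: power_int_diff power2_eq_square)
  then have "rlap n H r = r powi (b - 2) * (poly (euler (real_of_int b - 1) ?W) (e / r) + (real n - 1) * poly ?W (e / r))"
    using \<open>r > 0\<close> by (simp add: rlap_def dd d[OF assms(4)] distrib_left)
  \<comment> \<open>\<open>euler (b - 1) + (n - 1) = euler (b + n - 2)\<close>: the second order
    operator factors into two Euler operators.\<close>
  also have "poly (euler (real_of_int b - 1) ?W) t + (real n - 1) * poly ?W t = poly (euler (real_of_int b + real n - 2) ?W) t" for t
    by (simp add: poly_euler algebra_simps)
  finally show ?thesis by (simp add: euler_commute)
qed

text \<open>For \<open>n = 2m\<close>, starting from the exponent \<open>2k - 2\<close>, the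
  \<open>k\<close> radial Laplacians contribute factors with \<open>c = 0, 2, ..., 2k-2\<close>,
  collected here, and with \<open>c = 2m-2, 2m, ..., 2m+2k-4\<close>, collected in
  \<open>eulerB\<close>. Commutativity allows \<open>c = 0\<close> to act first.\<close>

fun eulerA :: "nat \<Rightarrow> real poly \<Rightarrow> real poly" where
  "eulerA 0 p = p"
| "eulerA (Suc k) p = euler (2 * real k) (eulerA k p)"

fun eulerB :: "nat \<Rightarrow> nat \<Rightarrow> real poly \<Rightarrow> real poly" where
  "eulerB m 0 p = p"
| "eulerB m (Suc k) p = euler (2 * real m - 2 + 2 * real k) (eulerB m k p)"

lemma eulerA_commute: "eulerA k (euler c p) = euler c (eulerA k p)"
  by (induction k) (simp_all add: euler_commute)

lemma eulerB_commute: "eulerB m k (euler c p) = euler c (eulerB m k p)"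
  by (induction k) (simp_all add: euler_commute)

lemma rlap_funpow_powi_poly:
  assumes "open A" "A \<subseteq> {0<..}" "\<And>r. r \<in> A \<Longrightarrow> H r = r powi (2 * int k - 2) * poly W (e / r)" "r \<in> A"
  shows "(rlap (2 * m) ^^ k) H r = r powi (-2) * poly (eulerB m k (eulerA k W)) (e / r)"
  using assms(3,4)
proof (induction k arbitrary: H W r)
  case (Suc k)
  let ?W = "euler (2 * real k) (euler (2 * real m - 2 + 2 * real k) W)"
  have "rlap (2 * m) H r = r powi (2 * int k - 2) * poly ?W (e / r)" if "r \<in> A" for r
    using rlap_powi_poly[OF assms(1,2) Suc.prems(1) that, of "2 * m"] by (simp add: algebra_simps)
  from Suc.IH[OF this Suc.prems(2)] show ?case
    by (simp add: funpow_Suc_right eulerA_commute eulerB_commute euler_commute del: funpow.simps)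
qed simp

section \<open>A one-sided test function\<close>

definition bern :: "nat \<Rightarrow> nat \<Rightarrow> real poly" where
  "bern k j = monom 1 k * [:1, -1:] ^ j"

lemma poly_bern: "poly (bern k j) t = t ^ k * (1 - t) ^ j"
  by (simp add: bern_def poly_monom poly_power)

text \<open>\<open>t d/dt\<close> sends \<open>t^k (1-t)^(j+1)\<close> to \<open>k\<close> times
  itself minus \<open>(j+1) t^(k+1) (1-t)^j\<close>. The minus sign in \<open>euler\<close> makes
  the second coefficient positive, and the first is nonnegative exactly when
  \<open>k <= c\<close>.\<close>

lemma euler_bern:
  "euler c (bern k (Suc j)) = smult (c - real k) (bern k (Suc j)) + smult (real (Suc j)) (bern (Suc k) j)"
proof -
  have P: "poly (pderiv (bern k (Suc j))) t = real k * t ^ (k - 1) * (1 - t) ^ Suc j - real (Suc j) * t ^ k * (1 - t) ^ j" for t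
    by (simp add: bern_def pderiv_mult pderiv_monom pderiv_power_Suc pderiv_pCons poly_monom poly_power algebra_simps del: power_Suc)
  have "poly (euler c (bern k (Suc j))) t =
    poly (smult (c - real k) (bern k (Suc j)) + smult (real (Suc j)) (bern (Suc k) j)) t" for t
    unfolding poly_euler P by (cases k) (simp_all add: poly_bern algebra_simps)
  then show ?thesis by (simp add: poly_eq_poly_eq_iff[symmetric] fun_eq_iff)
qed

lemma euler_add: "euler c (p + q) = euler c p + euler c q"
  by (simp add: euler_def pderiv_add smult_add_right algebra_simps)

lemma euler_smult: "euler c (smult a p) = smult a (euler c p)"
  by (simp add: euler_def pderiv_smult smult_diff_right mult.commute)

text \<open>\<open>K\<close> bounds the powers of \<open>t\<close>, so that Euler operators with
  \<open>c >= K\<close> keep all coefficients nonnegative; \<open>M\<close> counts the factors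
  \<open>1 - t\<close> still available, of which each operator may use one.\<close>

inductive bern_cone :: "nat \<Rightarrow> nat \<Rightarrow> real poly \<Rightarrow> bool" for K M where
  bern_cone_0: "bern_cone K M 0"
| bern_cone_bern: "k \<le> K \<Longrightarrow> M \<le> j \<Longrightarrow> 0 \<le> c \<Longrightarrow> bern_cone K M p \<Longrightarrow> bern_cone K M (p + smult c (bern k j))"

lemma bern_cone_single: "k \<le> K \<Longrightarrow> M \<le> j \<Longrightarrow> 0 \<le> c \<Longrightarrow> bern_cone K M (smult c (bern k j))"
  using bern_cone_bern[OF _ _ _ bern_cone_0, of k K M j c] by simp

lemma bern_cone_add: "bern_cone K M p \<Longrightarrow> bern_cone K M q \<Longrightarrow> bern_cone K M (q + p)"
  by (induction rule: bern_cone.induct) (auto simp: add.assoc[symmetric] intro: bern_cone_bern)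

lemma bern_cone_nonneg: "bern_cone K M p \<Longrightarrow> 0 \<le> t \<Longrightarrow> t \<le> 1 \<Longrightarrow> poly p t \<ge> 0"
  by (induction rule: bern_cone.induct) (auto simp: poly_bern)

lemma bern_cone_euler:
  assumes "bern_cone K (Suc M) p" "real K \<le> c"
  shows "bern_cone (Suc K) M (euler c p)"
  using assms
proof (induction rule: bern_cone.induct)
  case bern_cone_0
  then show ?case using bern_cone.bern_cone_0 by (simp add: euler_def)
next
  case (bern_cone_bern k j d p)
  then obtain i where j: "j = Suc i" "M \<le> i" by (cases j) auto
  have "bern_cone (Suc K) M (smult (d * (c - real k)) (bern k (Suc i)) + smult (d * real (Suc i)) (bern (Suc k) i))"
    using bern_cone_bern j by (intro bern_cone_add bern_cone_single) auto
  then have "bern_cone (Suc K) M (euler c (smult d (bern k j)))"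
    by (simp add: euler_smult euler_bern j smult_add_right)
  then show ?case using bern_cone_bern by (simp add: euler_add bern_cone_add)
qed

text \<open>Membership in the cone gives only nonnegativity. The separate term
  \<open>a t (1-t)^(N-1)\<close> survives every Euler operator with \<open>c > 1\<close>, being
  multiplied by \<open>c - 1\<close>, and yields a strict lower bound. \<open>i\<close> is the
  number of operators applied so far.\<close>

definition lead_cone :: "nat \<Rightarrow> nat \<Rightarrow> real poly \<Rightarrow> bool" where
  "lead_cone N i q \<longleftrightarrow> (\<exists>a p. a > 0 \<and> q = smult a (bern 1 (N - 1)) + p \<and> bern_cone i (N - i) p)"

lemma lead_cone_euler:
  assumes "lead_cone N i q" "real i \<le> c" "1 < c" "1 \<le> i" "i < N"
  shows "lead_cone N (Suc i) (euler c q)"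
proof -
  obtain a p where *: "a > 0" "q = smult a (bern 1 (N - 1)) + p" "bern_cone i (N - i) p"
    using assms(1) unfolding lead_cone_def by blast
  have N: "N - 1 = Suc (N - 2)" "N - i = Suc (N - Suc i)" using assms by auto
  have "euler c q = smult (a * (c - 1)) (bern 1 (N - 1)) + (smult (a * real (N - 1)) (bern 2 (N - 2)) + euler c p)"
    unfolding * N(1) by (simp add: euler_add euler_smult euler_bern smult_add_right numeral_2_eq_2)
  moreover have "bern_cone (Suc i) (N - Suc i) (smult (a * real (N - 1)) (bern 2 (N - 2)) + euler c p)"
    using * N assms by (intro bern_cone_add bern_cone_single bern_cone_euler) auto
  ultimately show ?thesis using * assms(3) unfolding lead_cone_def
    by (intro exI[of _ "a * (c - 1)"] exI) auto
qed

text \<open>The factor \<open>c = 0\<close> turns \<open>(1-t)^N\<close> into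
  \<open>N t (1-t)^(N-1)\<close>; every later factor \<open>c = 2i\<close>, \<open>i >= 1\<close>,
  satisfies both \<open>i <= c\<close> and \<open>c > 1\<close>.\<close>

lemma lead_cone_eulerA:
  assumes "N \<ge> Suc i"
  shows "lead_cone N (Suc i) (eulerA (Suc i) (bern 0 N))"
  using assms
proof (induction i)
  case 0
  then obtain M where N: "N = Suc M" by (cases N) auto
  have "eulerA (Suc 0) (bern 0 N) = smult (real N) (bern 1 (N - 1)) + 0"
    using euler_bern[of 0 0 M] by (simp add: N)
  then show ?case using N bern_cone_0 unfolding lead_cone_def
    by (intro exI[of _ "real N"] exI[of _ 0]) auto
next
  case (Suc i)
  then have "lead_cone N (Suc i) (eulerA (Suc i) (bern 0 N))" by simp
  then have "lead_cone N (Suc (Suc i)) (euler (2 * real (Suc i)) (eulerA (Suc i) (bern 0 N)))"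
    by (rule lead_cone_euler) (use Suc.prems in auto)
  then show ?case by simp
qed

text \<open>After \<open>m + k\<close> operators the next factor has \<open>c = 2m - 2 + 2k\<close>,
  and \<open>m + k <= c\<close> follows from \<open>m >= 2\<close>.\<close>

lemma lead_cone_eulerB:
  assumes "m \<ge> 2" "lead_cone N m q" "m + k \<le> N"
  shows "lead_cone N (m + k) (eulerB m k q)"
  using assms(3)
proof (induction k)
  case (Suc k)
  then have "lead_cone N (Suc (m + k)) (euler (2 * real m - 2 + 2 * real k) (eulerB m k q))"
    using assms(1) by (intro lead_cone_euler) auto
  then show ?case by simp
qed (use assms in simp)

text \<open>Here \<^term>\<open>t\<close> stands for \<^term>\<open>\<epsilon> / r\<close>, and the polynomial is \<^term>\<open>r\<^sup>2\<close> times the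
  \<^term>\<open>m\<close>-th radial Laplacian of \<^term>\<open>r ^ (2 * m - 2) * (1 - \<epsilon> / r) ^ N\<close>.\<close>

lemma euler_lower_bound:
  assumes "m \<ge> 2" "2 * m \<le> N"
  obtains a where "a > 0"
    "\<And>t. 0 \<le> t \<Longrightarrow> t \<le> 1 \<Longrightarrow> a * t * (1 - t) ^ (N - 1) \<le> poly (eulerB m m (eulerA m (bern 0 N))) t"
proof -
  have "lead_cone N m (eulerA m (bern 0 N))"
    using lead_cone_eulerA[of "m - 1" N] assms by simp
  then have "lead_cone N (m + m) (eulerB m m (eulerA m (bern 0 N)))"
    using assms by (intro lead_cone_eulerB) auto
  then obtain a p where *: "a > 0" "eulerB m m (eulerA m (bern 0 N)) = smult a (bern 1 (N - 1)) + p" "bern_cone (m + m) (N - (m + m)) p"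
    unfolding lead_cone_def by blast
  show ?thesis
    by (rule that[of a]) (use * bern_cone_nonneg[OF *(3)] in \<open>auto simp: poly_bern\<close>)
qed

text \<open>\<open>a\<close> and \<open>C\<close> are parameters because they must not depend on
  \<open>e\<close>. The lower bound on \<open>H\<close> weights \<open>f\<close> on
  \<open>2e <= r <= 1/2\<close>, the bound \<open>a / e^2\<close> weights \<open>u\<close> on
  \<open>2e <= r <= 8e\<close>, and \<open>- C\<close> matters only for \<open>r > 1/2\<close>,
  where the cutoff acts.\<close>

definition barrier :: "nat \<Rightarrow> real \<Rightarrow> real \<Rightarrow> real \<Rightarrow> (real \<Rightarrow> real) \<Rightarrow> bool" where
  "barrier m a C e H \<longleftrightarrow> rad (2 * m) H \<and> (\<forall>r\<le>e. H r = 0) \<and> (\<forall>r\<ge>1. H r = 0) \<and> (\<forall>r. 0 \<le> H r) \<and>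
       (\<forall>r\<le>1/2. 0 \<le> (rlap (2 * m) ^^ m) H r) \<and> (\<forall>r. - C \<le> (rlap (2 * m) ^^ m) H r) \<and>
       (\<forall>r. 2 * e \<le> r \<longrightarrow> r \<le> 8 * e \<longrightarrow> a / e\<^sup>2 \<le> (rlap (2 * m) ^^ m) H r) \<and>
       (\<forall>r. 2 * e \<le> r \<longrightarrow> r \<le> 1/2 \<longrightarrow> a * r ^ (2 * m - 2) \<le> H r)"

text \<open>With \<open>N = 2m + 1\<close> one has
  \<open>r^(2m-2) (1 - e/r)^N = (r - e)^N / r^3\<close>, which is of class \<open>C^(2m)\<close>
  once \<open>r - e\<close> is replaced by its positive part. Below \<open>3/5\<close> the sign
  comes from \<open>euler_lower_bound\<close>; above \<open>1/2\<close> only a bound uniform in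
  \<open>e\<close> is required.\<close>

lemma barrier_exists:
  assumes m: "m \<ge> 2"
  obtains a C :: real where "a > 0" "C > 0"
    "\<And>e. 0 < e \<Longrightarrow> e < 1/16 \<Longrightarrow> \<exists>H. barrier m a C e H"
proof -
  define N where "N = 2 * m + 1"
  let ?L = "rlap (2 * m) ^^ m"
  obtain \<zeta> :: "real \<Rightarrow> real" where \<zeta>: "Ck (Suc (2 * m)) \<zeta>" "\<And>r. r \<le> 3/5 \<Longrightarrow> \<zeta> r = 1" "\<And>r. r \<ge> 1 \<Longrightarrow> \<zeta> r = 0"
    "\<And>r. 0 \<le> \<zeta> r"
    using cutoff_exists[of "2 * m"] by metis
  have ck\<zeta>: "Ck (2 * m) \<zeta>" using \<zeta>(1) Ck_Suc_D by blast
  have ck\<zeta>2: "Ck (2 * m) (\<lambda>r. \<zeta> (2 * r))" using Ck_affine[OF ck\<zeta>, of 2 0] by simp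
  \<comment> \<open>\<open>1 - \<zeta> (2 * r)\<close> is 1 for \<open>r >= 1/2\<close> and 0 for
    \<open>r <= 3/10\<close>, so \<open>K k\<close> is a profile without singularity that agrees
    beyond \<open>1/2\<close> with a binomial term of the future \<open>H\<close>, up to its
    coefficient.\<close>
  define K where "K k r = \<zeta> r * (1 - \<zeta> (2 * r)) * r ^ k / r ^ 3" for k r
  have radK: "rad (2 * m) (K k)" for k
  proof (rule radI[of _ _ "3/10" 0])
    show z: "K k r = 0" if "r < 3/10" for r using that \<zeta>(2)[of "2 * r"] by (simp add: K_def)
    show "Ck (2 * m) (K k)"
      unfolding K_def
    proof (rule Ck_divide_power[where a = "3/10"])
      show "Ck (2 * m) (\<lambda>r. \<zeta> r * (1 - \<zeta> (2 * r)) * r ^ k)"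
        by (intro Ck_mult[OF Ck_mult] Ck_diff Ck_const Ck_power Ck_ident ck\<zeta> ck\<zeta>2)
      show "\<zeta> r * (1 - \<zeta> (2 * r)) * r ^ k = 0" if "r < 3/10" for r
        using that \<zeta>(2)[of "2 * r"] by simp
    qed simp
  qed simp
  have "\<exists>B>0. \<forall>r. \<bar>?L (K k) r\<bar> \<le> B" for k
  proof -
    have "Ck 0 (?L (K k))" using rad_Ck[OF rad_rlap_funpow[of m 0 "K k"]] radK by simp
    moreover have "?L (K k) r = 0" if "r < 0" for r
    proof -
      have "?L (K k) r = ?L (\<lambda>r. 0 * 0) r"
        by (rule rlap_funpow_cong[of "{..<0}"]) (use that \<zeta>(2) in \<open>auto simp: K_def\<close>)
      also have "\<dots> = 0" using rlap_funpow_cmult[OF rad_const, of m "2 * m" 0 0] by simp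
      finally show ?thesis .
    qed
    moreover have "?L (K k) r = 0" if "r > 1" for r
    proof -
      have "?L (K k) r = ?L (\<lambda>r. 0 * 0) r"
        by (rule rlap_funpow_cong[of "{1<..}"]) (use that \<zeta>(3) in \<open>auto simp: K_def\<close>)
      also have "\<dots> = 0" using rlap_funpow_cmult[OF rad_const, of m "2 * m" 0 0] by simp
      finally show ?thesis .
    qed
    ultimately show ?thesis using Ck_bounded[of 0 "?L (K k)" 1] by blast
  qed
  then obtain B where B: "\<And>k. B k > 0" "\<And>k r. \<bar>?L (K k) r\<bar> \<le> B k" by metis
  define C where "C = (\<Sum>k\<le>N. real (N choose k) * B k)"
  have "C > 0" unfolding C_def
    by (rule sum_pos) (use B in auto)
  obtain a0 where a0: "a0 > 0"
    "\<And>t. 0 \<le> t \<Longrightarrow> t \<le> 1 \<Longrightarrow> a0 * t * (1 - t) ^ (N - 1) \<le> poly (eulerB m m (eulerA m (bern 0 N))) t"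
    using euler_lower_bound[of m N] m by (auto simp: N_def)
  \<comment> \<open>For \<open>2e <= r <= 8e\<close>, \<open>t = e/r\<close> lies in
    \<open>[1/8, 1/2]\<close>, which bounds the polynomial below; 64 comes from
    \<open>r^(-2) >= (8e)^(-2)\<close>. The other entry bounds \<open>(1 - e/r)^N\<close> for
    \<open>r >= 2e\<close>.\<close>
  define a where "a = min (a0 * (1/8) * (1/2) ^ (N - 1) / 64) ((1/2) ^ N)"
  have "a > 0" using a0 by (simp add: a_def)
  show ?thesis
  proof (rule that[OF \<open>a > 0\<close> \<open>C > 0\<close>])
    fix e :: real assume e: "0 < e" "e < 1/16"
    define G where "G r = max 0 (r - e) ^ N / r ^ 3" for r
    define H where "H r = \<zeta> r * G r" for r
    have G0: "G r = 0" if "r \<le> e" for r using that by (simp add: G_def N_def)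
    have ckG: "Ck (2 * m) G"
      unfolding G_def
    proof (rule Ck_divide_power[where a = e])
      show "Ck (2 * m) (\<lambda>r. max 0 (r - e) ^ N)"
        using Ck_affine[OF Ck_pos_part_power[of "2 * m"], of 1 "- e"] by (simp add: N_def)
    qed (use e in \<open>auto simp: N_def\<close>)
    have radH: "rad (2 * m) H"
    proof (rule radI[of _ _ e 0])
      show "Ck (2 * m) H" unfolding H_def by (rule Ck_mult[OF ck\<zeta> ckG])
    qed (use e G0 in \<open>auto simp: H_def\<close>)
    have Hpos: "0 \<le> H r" for r
      using \<zeta>(4)[of r] e by (cases "r \<le> e") (auto simp: H_def G_def N_def)
    have Gform: "G r = r ^ (2 * m - 2) * (1 - e / r) ^ N" if "r > e" for r
    proof -
      have "r > 0" using that e by simp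
      then have "(r - e) ^ N = r ^ N * (1 - e / r) ^ N"
        by (simp add: power_mult_distrib[symmetric] right_diff_distrib)
      moreover have "r ^ N = r ^ (2 * m - 2) * r ^ 3"
        using m by (simp add: N_def power_add[symmetric])
      ultimately show ?thesis using that \<open>r > 0\<close> by (simp add: G_def max_def)
    qed
    have inner: "?L H r = r powi (-2) * poly (eulerB m m (eulerA m (bern 0 N))) (e / r)"
      if "e < r" "r < 3/5" for r
    proof (rule rlap_funpow_powi_poly[of "{e<..<3/5}"])
      show "H r = r powi (2 * int m - 2) * poly (bern 0 N) (e / r)" if "r \<in> {e<..<3/5}" for r
      proof -
        have "r powi (2 * int m - 2) = r ^ (2 * m - 2)"
          using m by (simp add: power_int_def nat_diff_distrib nat_mult_distrib)
        then show ?thesis using that \<zeta>(2)[of r] Gform[of r] by (simp add: H_def poly_bern)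
      qed
    qed (use e that in auto)
    have Hle: "?L H r = 0" if "r < e" for r
    proof -
      have "?L H r = ?L (\<lambda>r. 0 * 0) r"
        by (rule rlap_funpow_cong[of "{..<e}"]) (use that G0 in \<open>auto simp: H_def\<close>)
      also have "\<dots> = 0" using rlap_funpow_cmult[OF rad_const, of m "2 * m" 0 0] by simp
      finally show ?thesis .
    qed
    have nn: "?L H r \<ge> 0" if "r < 3/5" "r \<noteq> e" for r
    proof (cases "r < e")
      case False
      with that have r: "r > e" by simp
      then have "0 \<le> a0 * (e / r) * (1 - e / r) ^ (N - 1)" using e a0 by (auto simp: field_simps)
      also have "\<dots> \<le> poly (eulerB m m (eulerA m (bern 0 N))) (e / r)"
        by (rule a0) (use r e in auto)
      finally show ?thesis using inner[OF r that(1)] r e by simp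
    qed (use Hle in simp)
    \<comment> \<open>Neither formula is valid on a neighbourhood of \<open>r = e\<close>, so the
      sign there is obtained by continuity.\<close>
    have "isCont (?L H) e"
      using rad_Ck[OF rad_rlap_funpow[of m 0 H], of 0] radH by (simp add: continuous_on_eq_continuous_at)
    then have "(?L H \<longlongrightarrow> ?L H e) (at e)" by (simp add: isCont_def)
    then have nne: "?L H e \<ge> 0"
    proof (rule tendsto_lowerbound)
      have "eventually (\<lambda>r. r < 3/5) (at e)"
        using e by (intro order_tendstoD[OF tendsto_ident_at]) simp
      then show "eventually (\<lambda>r. 0 \<le> ?L H r) (at e)"
        using eventually_at_filter[of "\<lambda>r. r \<noteq> e" e UNIV] nn
        by (auto simp: eventually_at_filter elim: eventually_mono)
    qed simp
    have nn': "?L H r \<ge> 0" if "r < 3/5" for r using nn[OF that] nne by (cases "r = e") auto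
    have outer: "\<bar>?L H r\<bar> \<le> C" if "r > 1/2" for r
    proof -
      \<comment> \<open>Expanding \<open>(r - e)^N\<close> writes \<open>H\<close> as a combination
        of the fixed profiles \<open>K k\<close>. Since \<open>e < 1\<close>, the coefficients are
        at most the binomials, which makes \<open>C\<close> independent of \<open>e\<close>.\<close>
      define F where "F r = (\<Sum>k\<in>{..N}. (real (N choose k) * (- e) ^ (N - k)) * K k r)" for r
      have "?L H r = ?L F r"
      proof (rule rlap_funpow_cong[of "{1/2<..}"])
        show "H y = F y" if "y \<in> {1/2<..}" for y
        proof -
          have z: "\<zeta> (2 * y) = 0" "\<zeta> (y * 2) = 0" using that \<zeta>(3)[of "2 * y"] by (auto simp: mult.commute)
          have "(y - e) ^ N = (\<Sum>k\<le>N. real (N choose k) * y ^ k * (- e) ^ (N - k))"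
            using binomial_ring[of y "- e" N] by simp
          moreover have "max 0 (y - e) = y - e" using that e by simp
          ultimately show ?thesis
            by (simp add: H_def F_def G_def K_def z sum_distrib_left sum_divide_distrib mult_ac)
        qed
      qed (use that in auto)
      also have "\<dots> = (\<Sum>k\<in>{..N}. ?L (\<lambda>r. (real (N choose k) * (- e) ^ (N - k)) * K k r) r)"
        unfolding F_def using rlap_funpow_sum[of "{..N}" m "\<lambda>k r. (real (N choose k) * (- e) ^ (N - k)) * K k r" "2 * m"]
          rad_cmult[OF radK] by simp
      also have "\<dots> = (\<Sum>k\<in>{..N}. (real (N choose k) * (- e) ^ (N - k)) * ?L (K k) r)"
        by (simp only: rlap_funpow_cmult[OF radK])
      finally have "?L H r = (\<Sum>k\<in>{..N}. (real (N choose k) * (- e) ^ (N - k)) * ?L (K k) r)" .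
      also have "\<bar>\<dots>\<bar> \<le> C"
        unfolding C_def
      proof (rule order_trans[OF sum_abs], rule sum_mono)
        fix k
        have "\<bar>(- e) ^ (N - k)\<bar> \<le> 1" using e by (simp add: power_abs power_le_one)
        then have "\<bar>(- e) ^ (N - k)\<bar> * \<bar>?L (K k) r\<bar> \<le> 1 * B k"
          using B by (intro mult_mono) auto
        then show "\<bar>real (N choose k) * (- e) ^ (N - k) * ?L (K k) r\<bar> \<le> real (N choose k) * B k"
          by (simp add: abs_mult mult.assoc mult_left_mono)
      qed
      finally show ?thesis .
    qed
    show "\<exists>H. barrier m a C e H"
      unfolding barrier_def
    proof (intro exI[of _ H] conjI allI impI)
      show "rad (2 * m) H" "0 \<le> H r" for r by (fact radH Hpos)+
      show "H r = 0" if "r \<le> e" for r using G0[OF that] by (simp add: H_def)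
      show "H r = 0" if "r \<ge> 1" for r using \<zeta>(3)[OF that] by (simp add: H_def)
      show "0 \<le> ?L H r" if "r \<le> 1/2" for r using nn' that by simp
      show "- C \<le> ?L H r" for r
        using nn'[of r] outer[of r] \<open>C > 0\<close> by (cases "r > 1/2") auto
      show "a / e\<^sup>2 \<le> ?L H r" if "2 * e \<le> r" "r \<le> 8 * e" for r
      proof -
        have r: "e < r" "r < 3/5" using that e by auto
        have t: "1/8 \<le> e / r" "e / r \<le> 1/2" using that e by (auto simp: field_simps)
        have "a0 * (1/8) * (1/2) ^ (N - 1) \<le> a0 * (e / r) * (1 - e / r) ^ (N - 1)"
          using a0 t r e by (intro mult_mono power_mono) auto
        also have "\<dots> \<le> poly (eulerB m m (eulerA m (bern 0 N))) (e / r)"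
          by (rule a0) (use r e in auto)
        finally have p: "64 * a \<le> poly (eulerB m m (eulerA m (bern 0 N))) (e / r)"
          by (simp add: a_def min_def)
        have "r\<^sup>2 \<le> (8 * e)\<^sup>2" using that e by (intro power_mono) auto
        then have "inverse ((8 * e)\<^sup>2) \<le> inverse (r\<^sup>2)"
          using r e by (intro le_imp_inverse_le) auto
        then have "inverse ((8 * e)\<^sup>2) * (64 * a) \<le> inverse (r\<^sup>2) * poly (eulerB m m (eulerA m (bern 0 N))) (e / r)"
          using p \<open>a > 0\<close> by (intro mult_mono) auto
        moreover have "r powi (-2) = inverse (r\<^sup>2)" by (simp add: power_int_minus)
        moreover have "inverse ((8 * e)\<^sup>2) * (64 * a) = a / e\<^sup>2" using e by (simp add: field_simps power2_eq_square)
        ultimately show ?thesis using inner[OF r] by simp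
      qed
      show "a * r ^ (2 * m - 2) \<le> H r" if "2 * e \<le> r" "r \<le> 1/2" for r
      proof -
        have "1/2 \<le> 1 - e / r" using that e by (auto simp: field_simps)
        then have "(1/2) ^ N \<le> (1 - e / r) ^ N" by (intro power_mono) auto
        then have "a \<le> (1 - e / r) ^ N" by (simp add: a_def)
        then have "a * r ^ (2 * m - 2) \<le> (1 - e / r) ^ N * r ^ (2 * m - 2)"
          using that e by (intro mult_right_mono) auto
        then show ?thesis using that e Gform[of r] \<zeta>(2)[of r] by (simp add: H_def mult.commute)
      qed
    qed
  qed
qed

section \<open>Integration by parts\<close>

text \<open>\<open>S\<close> and the complement of \<open>K\<close> are open and cover the
  space.\<close>

lemma continuous_on_extend_zero:
  fixes f :: "'a::t2_space \<Rightarrow> real"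
  assumes "open S" "compact K" "K \<subseteq> S" "continuous_on S f" "\<And>x. x \<notin> K \<Longrightarrow> f x = 0"
  shows "continuous_on UNIV f"
proof -
  have "continuous_on (- K) f"
    by (rule continuous_on_eq[OF continuous_on_const[of _ 0]]) (use assms(5) in auto)
  then have "continuous_on (S \<union> - K) f"
    by (intro continuous_on_open_Un assms(1,4)) (use assms(2) compact_imp_closed in auto)
  moreover have "S \<union> - K = UNIV" using assms(3) by auto
  ultimately show ?thesis by simp
qed

lemma integrable_continuous_compact_support:
  fixes f :: "'a::euclidean_space \<Rightarrow> real"
  assumes "compact K" "K \<subseteq> S" "continuous_on S f" "\<And>x. x \<notin> K \<Longrightarrow> f x = 0"
  shows "integrable lborel f"
proof -
  have "integrable lborel (\<lambda>x. indicator K x *\<^sub>R f x)"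
    by (rule borel_integrable_compact) (use assms in \<open>auto intro: continuous_on_subset\<close>)
  also have "(\<lambda>x. indicator K x *\<^sub>R f x) = f"
    using assms(4) by (auto simp: fun_eq_iff indicator_def)
  finally show ?thesis .
qed

lemma integral_lborel_translate:
  fixes f :: "'a::euclidean_space \<Rightarrow> real"
  assumes "f \<in> borel_measurable borel"
  shows "(\<integral>x. f (c + x) \<partial>lborel) = (\<integral>x. f x \<partial>lborel)"
proof -
  have "(\<integral>x. f x \<partial>lborel) = (\<integral>x. f x \<partial>(distr lborel borel ((+) c)))"
    by (simp add: lborel_distr_plus)
  also have "\<dots> = (\<integral>x. f (c + x) \<partial>lborel)"
    by (subst integral_distr) (use assms in auto)
  finally show ?thesis by simp
qed

text \<open>By translation invariance every difference quotient of \<open>h\<close> along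
  \<open>v\<close> has integral 0; dominated convergence passes to the derivative.\<close>

lemma integral_directional_derivative_zero:
  fixes h h' :: "'a::euclidean_space \<Rightarrow> real"
  assumes K: "compact K" and h: "continuous_on UNIV h" "\<And>x. x \<notin> K \<Longrightarrow> h x = 0"
    and h': "continuous_on UNIV h'" "\<And>x. x \<notin> K \<Longrightarrow> h' x = 0"
    and deriv: "\<And>x. ((\<lambda>t. h (x + t *\<^sub>R v)) has_real_derivative h' x) (at 0)"
  shows "(\<integral>x. h' x \<partial>lborel) = 0"
proof -
  obtain M where M: "M > 0" "\<And>x. \<bar>h' x\<bar> \<le> M"
  proof -
    have "compact (h' ` K)" using h' K by (intro compact_continuous_image) (auto intro: continuous_on_subset)
    then obtain M where "M > 0" "\<forall>y\<in>h' ` K. \<bar>y\<bar> \<le> M"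
      using bounded_pos compact_imp_bounded by (metis real_norm_def)
    then show ?thesis using h'(2) by (intro that[of M]) (metis abs_zero imageI less_imp_le)+
  qed
  \<comment> \<open>The starting points from which moving along \<open>v\<close> for a time at most
    1 reaches \<open>K\<close>; all difference quotients with step at most 1 vanish outside.\<close>
  define K2 where "K2 = (\<lambda>(y, t). y - t *\<^sub>R v) ` (K \<times> {0..1::real})"
  have K2: "compact K2"
    unfolding K2_def by (intro compact_continuous_image compact_Times K compact_Icc)
      (auto intro!: continuous_intros simp: case_prod_unfold)
  have K2I: "x \<in> K2" if "x + t *\<^sub>R v \<in> K" "0 \<le> t" "t \<le> 1" for x t
    unfolding K2_def using that by (intro image_eqI[of _ _ "(x + t *\<^sub>R v, t)"]) auto
  have der: "((\<lambda>t. h (x + t *\<^sub>R v)) has_real_derivative h' (x + s *\<^sub>R v)) (at s)" for x s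
  proof -
    have "((\<lambda>t. h (x + s *\<^sub>R v + t *\<^sub>R v)) has_real_derivative h' (x + s *\<^sub>R v)) (at (s + - s))"
      using deriv[of "x + s *\<^sub>R v"] by simp
    then have "((\<lambda>t. h (x + s *\<^sub>R v + (t + - s) *\<^sub>R v)) has_real_derivative h' (x + s *\<^sub>R v)) (at s)"
      by (subst (asm) DERIV_shift)
    then show ?thesis by (simp add: algebra_simps)
  qed
  define D where "D k x = (h (x + inverse (real (Suc k)) *\<^sub>R v) - h x) * real (Suc k)" for k x
  have hm: "h \<in> borel_measurable borel" using h(1) by (rule borel_measurable_continuous_onI)
  have hm': "h' \<in> borel_measurable borel" using h'(1) by (rule borel_measurable_continuous_onI)
  have hint: "integrable lborel h"
    using integrable_continuous_compact_support[OF K _ h(1)] h(2) by auto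
  have Dm: "D k \<in> borel_measurable lborel" for k
    unfolding D_def using hm by measurable
  have Dint: "(\<integral>x. D k x \<partial>lborel) = 0" for k
  proof -
    let ?c = "inverse (real (Suc k)) *\<^sub>R v"
    have "integrable (distr lborel borel ((+) ?c)) h" using hint by (simp only: lborel_distr_plus)
    then have "integrable lborel (\<lambda>x. h (?c + x))"
      by (subst (asm) integrable_distr_eq) (use hm in auto)
    then have "(\<integral>x. h (?c + x) - h x \<partial>lborel) = 0"
      using integral_lborel_translate[OF hm, of ?c] hint by simp
    then have "(\<integral>x. (h (?c + x) - h x) * real (Suc k) \<partial>lborel) = 0" by simp
    then show ?thesis unfolding D_def by (simp add: add.commute)
  qed
  have "(\<lambda>k. \<integral>x. D k x \<partial>lborel) \<longlonglongrightarrow> (\<integral>x. h' x \<partial>lborel)"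
  proof (rule integral_dominated_convergence)
    show "h' \<in> borel_measurable lborel" using hm' by simp
    show "integrable lborel (\<lambda>x. M * indicator K2 x)"
      using K2 emeasure_compact_finite[OF K2] by (intro integrable_mult_right) (auto simp: borel_compact)
    show "AE x in lborel. (\<lambda>k. D k x) \<longlonglongrightarrow> h' x"
    proof (rule AE_I2)
      fix x
      have "((\<lambda>t. (h (x + (0 + t) *\<^sub>R v) - h (x + 0 *\<^sub>R v)) / t) \<longlongrightarrow> h' x) (at 0)"
        using deriv[of x] by (simp add: DERIV_def)
      moreover have "filterlim (\<lambda>k. inverse (real (Suc k))) (at 0) sequentially"
        by (rule filterlim_atI[OF LIMSEQ_inverse_real_of_nat]) simp
      ultimately have "(\<lambda>k. (h (x + (0 + inverse (real (Suc k))) *\<^sub>R v) - h (x + 0 *\<^sub>R v)) / inverse (real (Suc k))) \<longlonglongrightarrow> h' x"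
        by (rule filterlim_compose)
      then show "(\<lambda>k. D k x) \<longlonglongrightarrow> h' x"
        by (simp add: D_def divide_inverse del: of_nat_Suc)
    qed
    show "AE x in lborel. norm (D k x) \<le> M * indicator K2 x" for k
    proof (rule AE_I2)
      fix x
      let ?c = "inverse (real (Suc k))"
      have c: "0 < ?c" "?c \<le> 1" by (auto simp: field_simps)
      obtain s where s: "0 < s" "s < ?c" "h (x + ?c *\<^sub>R v) - h (x + 0 *\<^sub>R v) = (?c - 0) * h' (x + s *\<^sub>R v)"
        using MVT2[OF c(1), of "\<lambda>t. h (x + t *\<^sub>R v)" "\<lambda>s. h' (x + s *\<^sub>R v)"] der by blast
      have "D k x = h' (x + s *\<^sub>R v)"
        using s(3) c(1) by (simp add: D_def del: of_nat_Suc)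
      then show "norm (D k x) \<le> M * indicator K2 x"
        using M(2)[of "x + s *\<^sub>R v"] h'(2)[of "x + s *\<^sub>R v"] K2I[of x s] s c
        by (cases "x \<in> K2") (auto simp: indicator_def)
    qed
  qed (use Dm in auto)
  then have "(\<lambda>k. 0) \<longlonglongrightarrow> (\<integral>x. h' x \<partial>lborel)" by (simp add: Dint)
  then show ?thesis by (simp add: LIMSEQ_const_iff)
qed

section \<open>Calculus of \<open>C_k_on\<close> functions and their iterated Laplacians\<close>

lemma eventually_line_in_open:
  fixes y v :: "'a::real_normed_vector"
  assumes "open S" "y \<in> S"
  shows "eventually (\<lambda>t::real. y + t *\<^sub>R v \<in> S) (nhds 0)"
proof -
  have "open ((\<lambda>t::real. y + t *\<^sub>R v) -` S)"
    by (rule open_vimage[OF assms(1)]) (auto intro!: continuous_intros)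
  then show ?thesis using assms(2) by (auto simp: eventually_nhds intro!: exI[of _ "(\<lambda>t::real. y + t *\<^sub>R v) -` S"])
qed

lemma partial_deriv_cong:
  assumes "open S" "\<And>x. x \<in> S \<Longrightarrow> f x = g x" "x \<in> S"
  shows "partial_deriv i f x = partial_deriv i g x"
  unfolding partial_deriv_def
proof (rule deriv_cong_ev)
  show "\<forall>\<^sub>F t in nhds 0. f (x + t *\<^sub>R axis i 1) = g (x + t *\<^sub>R axis i 1)"
    using eventually_line_in_open[OF assms(1,3)] by eventually_elim (rule assms(2))
qed simp

text \<open>Differentiation rules identify the partial derivatives of a combination only on
  \<open>S\<close>; this carries regularity across such identities.\<close>

lemma C_k_on_cong:
  assumes "open S" "\<And>x. x \<in> S \<Longrightarrow> f x = g x" "C_k_on k S f"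
  shows "C_k_on k S g"
  using assms(2,3)
proof (induction k arbitrary: f g)
  case 0
  then show ?case using continuous_on_eq by fastforce
next
  case (Suc k)
  have "g differentiable (at x)" if "x \<in> S" for x
  proof -
    have "f differentiable (at x)" using Suc.prems that by simp
    then obtain D where "(f has_derivative D) (at x)" unfolding differentiable_def by blast
    then have "(g has_derivative D) (at x)"
      by (rule has_derivative_transform_within_open[OF _ assms(1) that]) (use Suc.prems in auto)
    then show ?thesis unfolding differentiable_def by blast
  qed
  moreover have "C_k_on k S (partial_deriv i g)" for i
    by (rule Suc.IH[of "partial_deriv i f"])
       (use Suc.prems partial_deriv_cong[OF assms(1), of f g] in auto)
  moreover have "continuous_on S g"
    using Suc.prems continuous_on_eq by fastforce
  ultimately show ?case by simp
qed

lemma C_k_on_Suc_D: "C_k_on (Suc k) S f \<Longrightarrow> C_k_on k S f"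
proof (induction k arbitrary: f)
  case (Suc k)
  then show ?case by (metis C_k_on.simps(2))
qed simp

lemma C_k_on_continuous: "C_k_on k S f \<Longrightarrow> continuous_on S f"
  by (cases k) auto

lemma C_k_on_partial:
  assumes "C_k_on (Suc k) S f" "x \<in> S"
  shows "((\<lambda>t. f (x + t *\<^sub>R axis i 1)) has_real_derivative partial_deriv i f x) (at 0)"
proof -
  have "f differentiable (at x)" using assms by simp
  then obtain D where D: "(f has_derivative D) (at (x + 0 *\<^sub>R axis i 1))" unfolding differentiable_def by auto
  have "((\<lambda>t::real. x + t *\<^sub>R axis i 1) has_derivative (\<lambda>t. t *\<^sub>R axis i 1)) (at 0)"
    by (auto intro!: derivative_eq_intros)
  from has_derivative_compose[OF this D]
  have "(\<lambda>t. f (x + t *\<^sub>R axis i 1)) differentiable (at 0)"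
    unfolding differentiable_def by blast
  then show ?thesis
    unfolding partial_deriv_def
    by (metis real_differentiableE DERIV_imp_deriv)
qed

lemma C_k_on_add:
  assumes "open S" "C_k_on k S f" "C_k_on k S g"
  shows "C_k_on k S (\<lambda>x. f x + g x)"
  using assms(2,3)
proof (induction k arbitrary: f g)
  case 0
  then show ?case by (auto intro: continuous_intros)
next
  case (Suc k)
  have "C_k_on k S (partial_deriv i (\<lambda>x. f x + g x))" for i
  proof (rule C_k_on_cong[OF assms(1)])
    show "C_k_on k S (\<lambda>x. partial_deriv i f x + partial_deriv i g x)"
      by (rule Suc.IH) (use Suc.prems in auto)
    fix x assume "x \<in> S"
    have "((\<lambda>t. f (x + t *\<^sub>R axis i 1) + g (x + t *\<^sub>R axis i 1)) has_real_derivative partial_deriv i f x + partial_deriv i g x) (at 0)"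
      by (intro DERIV_add C_k_on_partial[OF _ \<open>x \<in> S\<close>]) (use Suc.prems in blast)+
    then show "partial_deriv i f x + partial_deriv i g x = partial_deriv i (\<lambda>x. f x + g x) x"
      unfolding partial_deriv_def[of i "\<lambda>x. f x + g x"] by (rule DERIV_imp_deriv[symmetric])
  qed
  moreover have "continuous_on S (\<lambda>x. f x + g x)"
    using Suc.prems by (auto intro: continuous_intros)
  moreover have "\<forall>x\<in>S. (\<lambda>x. f x + g x) differentiable (at x)"
    using Suc.prems by auto
  ultimately show ?case by simp
qed

lemma C_k_on_zero: "C_k_on k S (\<lambda>x. 0)"
proof (induction k)
  case (Suc k)
  have "partial_deriv i (\<lambda>x::real^'a. 0) = (\<lambda>x. 0)" for i
    by (simp add: partial_deriv_def fun_eq_iff)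
  with Suc show ?case by simp
qed simp

lemma C_k_on_sum:
  assumes "open S" "finite I" "\<And>i. i \<in> I \<Longrightarrow> C_k_on k S (f i)"
  shows "C_k_on k S (\<lambda>x. \<Sum>i\<in>I. f i x)"
  using assms(2,3)
proof (induction I rule: finite_induct)
  case (insert a I)
  then show ?case using C_k_on_add[OF assms(1), of k "f a" "\<lambda>x. \<Sum>i\<in>I. f i x"] by simp
qed (simp add: C_k_on_zero)

lemma C_k_on_laplacian:
  assumes "open S" "C_k_on (Suc (Suc k)) S f"
  shows "C_k_on k S (laplacian f)"
  unfolding laplacian_def[abs_def]
  by (rule C_k_on_sum[OF assms(1)]) (use assms(2) in auto)

lemma C_k_on_iter_laplacian:
  assumes "open S" "C_k_on (2 * j + k) S f"
  shows "C_k_on k S (iter_laplacian j f)"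
  using assms(2) unfolding iter_laplacian_def
proof (induction j arbitrary: k)
  case (Suc j)
  have "C_k_on (Suc (Suc k)) S ((laplacian ^^ j) f)"
    by (rule Suc.IH) (use Suc.prems in simp)
  then show ?case using C_k_on_laplacian[OF assms(1)] by simp
qed simp

section \<open>Green's identity against radial functions\<close>

lemma rlap_funpow_zero: "(rlap n ^^ k) (\<lambda>r. 0) = (\<lambda>r. 0)"
proof (induction k)
  case (Suc k)
  then show ?case by (simp add: rlap_def[abs_def])
qed simp

text \<open>At \<open>y = x\<close> the derivative is 0 because \<open>B\<close> is constant near 0,
  and the formula is 0 because of the division by 0.\<close>

lemma radial_partial_derivative:
  fixes x y :: "real^'n"
  assumes "Ck 1 B" "a > 0" "\<And>r. r < a \<Longrightarrow> B r = c"
  shows "((\<lambda>t. B (norm (y + t *\<^sub>R axis i 1 - x))) has_real_derivative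
    deriv B (norm (y - x)) * ((y - x) $ i / norm (y - x))) (at 0)"
proof (cases "y = x")
  case True
  have "eventually (\<lambda>t. t \<in> ball 0 a) (nhds (0::real))"
    using assms(2) by (intro eventually_nhds_in_open) auto
  then have "eventually (\<lambda>t. B (norm (y + t *\<^sub>R axis i 1 - x)) = c) (nhds 0)"
    by eventually_elim (use assms(3) True in \<open>simp add: norm_axis_1\<close>)
  then have "((\<lambda>t. B (norm (y + t *\<^sub>R axis i 1 - x))) has_real_derivative 0) (at 0)"
    by (rule has_real_derivative_eventually_eq) simp
  then show ?thesis using True by simp
next
  case False
  let ?z = "y - x"
  have "(norm has_derivative (\<lambda>h. h \<bullet> sgn ?z)) (at (y + 0 *\<^sub>R axis i 1 - x))"
    using has_derivative_norm[of ?z] False by simp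
  moreover have "((\<lambda>t::real. y + t *\<^sub>R axis i 1 - x) has_derivative (\<lambda>t. t *\<^sub>R axis i 1)) (at 0)"
    by (auto intro!: derivative_eq_intros)
  ultimately have "((\<lambda>t. norm (y + t *\<^sub>R axis i 1 - x)) has_derivative (\<lambda>t. (t *\<^sub>R axis i 1) \<bullet> sgn ?z)) (at 0)"
    by (rule has_derivative_compose[rotated])
  moreover have "(\<lambda>t. (t *\<^sub>R axis i 1) \<bullet> sgn ?z) = (*) (?z $ i / norm ?z)"
    by (auto simp: fun_eq_iff sgn_div_norm inner_axis' divide_inverse mult_ac)
  ultimately have n: "((\<lambda>t. norm (y + t *\<^sub>R axis i 1 - x)) has_real_derivative ?z $ i / norm ?z) (at 0)"
    by (simp add: has_field_derivative_def)
  show ?thesis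
  proof (rule DERIV_chain2[where f = B and g = "\<lambda>t. norm (y + t *\<^sub>R axis i 1 - x)"])
    show "(B has_real_derivative deriv B (norm (y - x))) (at (norm (y + 0 *\<^sub>R axis i 1 - x)))"
      using assms(1) by simp
  qed (rule n)
qed

lemma continuous_on_radial:
  fixes x :: "'a::real_normed_vector"
  assumes "Ck k B"
  shows "continuous_on A (\<lambda>y. B (norm (y - x)))"
  by (rule continuous_on_compose2[OF Ck_continuous[OF assms]]) (auto intro!: continuous_intros)

lemma C_k_on_mono: "j \<le> k \<Longrightarrow> C_k_on k S f \<Longrightarrow> C_k_on j S f"
  by (induction k rule: dec_induct) (use C_k_on_Suc_D in auto)

text \<open>The divergence theorem for \<open>w grad \<phi> - \<phi> grad w\<close>, one coordinate
  at a time. Since \<open>H\<close> vanishes near \<open>norm (y - x)\<close>, not merely at it, the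
  derivatives of \<open>\<phi>\<close> vanish off \<open>K\<close> too; products with
  \<open>w\<close>, which is controlled only on \<open>S\<close>, are then continuous
  everywhere.\<close>

lemma green_radial:
  fixes w :: "real^'n \<Rightarrow> real" and x :: "real^'n"
  assumes S: "open S" "C_k_on 2 S w" and K: "compact K" "K \<subseteq> S" and H: "rad 2 H"
    and supp: "\<And>y. y \<notin> K \<Longrightarrow> eventually (\<lambda>r. H r = 0) (nhds (norm (y - x)))"
  shows "(\<integral>y. w y * rlap CARD('n) H (norm (y - x)) \<partial>lborel) = (\<integral>y. laplacian w y * H (norm (y - x)) \<partial>lborel)"
proof -
  obtain a c where a: "Ck 2 H" "a > 0" "\<And>r. r < a \<Longrightarrow> H r = c" using H unfolding rad_def by blast
  \<comment> \<open>With \<open>B = H'/r\<close> and \<open>B2 = B'/r\<close>, the gradient of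
    \<open>\<phi>\<close> is \<open>B\<close> times \<open>y - x\<close>, and its diagonal second
    derivatives are the \<open>q i\<close> below, regular also at \<open>y = x\<close>.\<close>
  define B where "B r = deriv H r / r" for r
  define B2 where "B2 r = deriv B r / r" for r
  have dH: "Ck 1 (deriv H)" "Ck 1 H" using a(1) Ck_Suc_D[of 1 H] by (simp_all add: numeral_2_eq_2)
  have H0: "deriv H r = 0" if "r < a" for r using deriv_zero_left[OF a(3) that] .
  have B0: "B r = 0" if "r < a" for r using H0[OF that] by (simp add: B_def)
  have cB: "Ck 1 B" unfolding B_def by (rule Ck_divide_ident[OF dH(1) H0 a(2)])
  have dB0: "deriv B r = 0" if "r < a" for r using deriv_zero_left[OF B0 that] .
  have cB2: "Ck 0 B2" unfolding B2_def by (rule Ck_divide_ident[OF _ dB0 a(2)]) (use cB in simp)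
  let ?\<rho> = "\<lambda>y. norm (y - x)"
  define \<phi> where "\<phi> y = H (?\<rho> y)" for y
  define p where "p i y = B (?\<rho> y) * (y - x) $ i" for i y
  define q where "q i y = B2 (?\<rho> y) * ((y - x) $ i)\<^sup>2 + B (?\<rho> y)" for i y
  have d\<phi>: "((\<lambda>t. \<phi> (y + t *\<^sub>R axis i 1)) has_real_derivative p i y) (at 0)" for y i
    using radial_partial_derivative[OF dH(2) a(2,3), where y = y and i = i and x = x]
    by (simp add: \<phi>_def p_def B_def)
  have dp: "((\<lambda>t. p i (y + t *\<^sub>R axis i 1)) has_real_derivative q i y) (at 0)" for y i
  proof -
    have "((\<lambda>t. B (norm (y + t *\<^sub>R axis i 1 - x))) has_real_derivative
        deriv B (norm (y - x)) * ((y - x) $ i / norm (y - x))) (at 0)"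
      by (rule radial_partial_derivative[OF cB a(2) B0])
    moreover have "((\<lambda>t. (y + t *\<^sub>R axis i 1 - x) $ i) has_real_derivative 1) (at 0)"
      by (auto intro!: derivative_eq_intros simp: axis_def)
    ultimately have "((\<lambda>t. B (norm (y + t *\<^sub>R axis i 1 - x)) * (y + t *\<^sub>R axis i 1 - x) $ i) has_real_derivative
       deriv B (norm (y - x)) * ((y - x) $ i / norm (y - x)) * (y + 0 *\<^sub>R axis i 1 - x) $ i + 1 * B (norm (y + 0 *\<^sub>R axis i 1 - x))) (at 0)"
      by (rule DERIV_mult)
    then show ?thesis by (simp add: p_def q_def B2_def power2_eq_square mult.assoc)
  qed
  have c\<phi>: "continuous_on A \<phi>" for A unfolding \<phi>_def[abs_def] by (rule continuous_on_radial[OF dH(2)])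
  have cp: "continuous_on A (p i)" for A i
    unfolding p_def[abs_def] by (intro continuous_intros continuous_on_radial[OF cB])
  have cq: "continuous_on A (q i)" for A i
    unfolding q_def[abs_def] by (intro continuous_intros continuous_on_radial[OF cB] continuous_on_radial[OF cB2])
  have z: "\<phi> y = 0" "p i y = 0" "q i y = 0" if "y \<notin> K" for y i
  proof -
    have ev: "eventually (\<lambda>r. H r = 0) (nhds (?\<rho> y))" by (rule supp[OF that])
    then have ev2: "eventually (\<lambda>r. deriv H r = 0) (nhds (?\<rho> y))"
      using eventually_deriv_eq[of H "\<lambda>_. 0"] by simp
    then have ev3: "eventually (\<lambda>r. B r = 0) (nhds (?\<rho> y))"
      by eventually_elim (simp add: B_def)
    then have ev4: "eventually (\<lambda>r. deriv B r = 0) (nhds (?\<rho> y))"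
      using eventually_deriv_eq[of B "\<lambda>_. 0"] by simp
    show "\<phi> y = 0" "p i y = 0" "q i y = 0"
      using eventually_nhds_x_imp_x[OF ev] eventually_nhds_x_imp_x[OF ev3] eventually_nhds_x_imp_x[OF ev4]
      by (auto simp: \<phi>_def p_def q_def B2_def)
  qed
  let ?w1 = "\<lambda>i. partial_deriv i w" and ?w2 = "\<lambda>i. partial_deriv i (partial_deriv i w)"
  have Sw: "C_k_on (Suc (Suc 0)) S w" using S(2) by (simp add: numeral_2_eq_2)
  have Sw1: "C_k_on (Suc 0) S (?w1 i)" for i using Sw by simp
  have cw: "continuous_on S w" "continuous_on S (?w1 i)" "continuous_on S (?w2 i)" for i
    using Sw by auto
  have int0: "(\<integral>y. w y * q i y - ?w2 i y * \<phi> y \<partial>lborel) = 0" for i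
  proof (rule integral_directional_derivative_zero[OF K(1), where v = "axis i 1" and h = "\<lambda>y. w y * p i y - ?w1 i y * \<phi> y"])
    show "continuous_on UNIV (\<lambda>y. w y * p i y - ?w1 i y * \<phi> y)"
      by (rule continuous_on_extend_zero[OF S(1) K]) (auto intro!: continuous_intros cw cp c\<phi> simp: z)
    show "continuous_on UNIV (\<lambda>y. w y * q i y - ?w2 i y * \<phi> y)"
      by (rule continuous_on_extend_zero[OF S(1) K]) (auto intro!: continuous_intros cw cq c\<phi> simp: z)
    show "((\<lambda>t. w (y + t *\<^sub>R axis i 1) * p i (y + t *\<^sub>R axis i 1) - ?w1 i (y + t *\<^sub>R axis i 1) * \<phi> (y + t *\<^sub>R axis i 1))
      has_real_derivative w y * q i y - ?w2 i y * \<phi> y) (at 0)" for y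
    proof (cases "y \<in> S")
      case True
      show ?thesis
        using DERIV_diff[OF DERIV_mult[OF C_k_on_partial[OF Sw True, of i] dp[of i y]] DERIV_mult[OF C_k_on_partial[OF Sw1 True, of i i] d\<phi>[of y i]]]
        by (simp add: algebra_simps)
    next
      case False
      then have y: "y \<in> - K" using K(2) by auto
      have "eventually (\<lambda>t. y + t *\<^sub>R axis i 1 \<in> - K) (nhds 0)"
        by (rule eventually_line_in_open[OF _ y]) (use K(1) compact_imp_closed in auto)
      then have "eventually (\<lambda>t. w (y + t *\<^sub>R axis i 1) * p i (y + t *\<^sub>R axis i 1) - ?w1 i (y + t *\<^sub>R axis i 1) * \<phi> (y + t *\<^sub>R axis i 1) = 0) (nhds 0)"
        by eventually_elim (simp add: z)
      then have "((\<lambda>t. w (y + t *\<^sub>R axis i 1) * p i (y + t *\<^sub>R axis i 1) - ?w1 i (y + t *\<^sub>R axis i 1) * \<phi> (y + t *\<^sub>R axis i 1)) has_real_derivative 0) (at 0)"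
        by (rule has_real_derivative_eventually_eq) simp
      then show ?thesis using y by (simp add: z)
    qed
  qed (simp_all add: z)
  have I: "integrable lborel (\<lambda>y. w y * q i y - ?w2 i y * \<phi> y)" for i
    by (rule integrable_continuous_compact_support[OF K]) (auto intro!: continuous_intros cw cq c\<phi> simp: z)
  have sq: "(\<Sum>i\<in>UNIV. q i y) = rlap CARD('n) H (?\<rho> y)" for y
  proof (cases "y = x")
    case True
    then show ?thesis using B0[of 0] a(2) rlap_zero_left[where H = H, OF a(3) a(2)] by (simp add: q_def)
  next
    case False
    let ?r = "?\<rho> y"
    have r: "?r > 0" using False by simp
    have "(\<Sum>i\<in>UNIV. q i y) = B2 ?r * (\<Sum>i\<in>UNIV. ((y - x) $ i)\<^sup>2) + real CARD('n) * B ?r"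
      by (simp add: q_def sum.distrib sum_distrib_left)
    also have "(\<Sum>i\<in>UNIV. ((y - x) $ i)\<^sup>2) = ?r\<^sup>2"
      by (simp add: norm_vec_def L2_set_def sum_nonneg)
    also have "deriv B ?r = (deriv (deriv H) ?r * ?r - deriv H ?r * 1) / (?r * ?r)"
      unfolding B_def[abs_def]
      by (intro DERIV_imp_deriv DERIV_divide DERIV_ident) (use r dH(1) in auto)
    then have "B2 ?r * ?r\<^sup>2 = deriv (deriv H) ?r - deriv H ?r / ?r"
      using r by (simp add: B2_def power2_eq_square field_simps)
    finally show ?thesis by (simp add: rlap_def B_def left_diff_distrib diff_divide_distrib)
  qed
  have "(\<integral>y. (\<Sum>i\<in>UNIV. w y * q i y - ?w2 i y * \<phi> y) \<partial>lborel) = 0"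
    using I int0 by (subst Bochner_Integration.integral_sum) auto
  also have "(\<lambda>y. \<Sum>i\<in>UNIV. w y * q i y - ?w2 i y * \<phi> y) = (\<lambda>y. w y * rlap CARD('n) H (?\<rho> y) - laplacian w y * \<phi> y)"
    by (simp add: sum_subtractf sum_distrib_left[symmetric] sum_distrib_right[symmetric] sq laplacian_def fun_eq_iff)
  finally have "(\<integral>y. w y * rlap CARD('n) H (?\<rho> y) - laplacian w y * \<phi> y \<partial>lborel) = 0" .
  moreover have "integrable lborel (\<lambda>y. w y * rlap CARD('n) H (?\<rho> y))"
    unfolding sq[symmetric]
    by (rule integrable_continuous_compact_support[OF K]) (auto intro!: continuous_intros cw cq simp: z)
  moreover have "integrable lborel (\<lambda>y. laplacian w y * \<phi> y)"
    by (rule integrable_continuous_compact_support[OF K])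
       (auto intro!: continuous_intros cw c\<phi> simp: z laplacian_def[abs_def])
  ultimately show ?thesis by (simp add: \<phi>_def)
qed

text \<open>Each step moves the outermost \<open>rlap\<close> onto \<open>w\<close> as a Laplacian;
  the remaining iterate of \<open>H\<close> still vanishes near every radius belonging to a point
  outside \<open>K\<close>.\<close>

lemma green_radial_iter:
  fixes w :: "real^'n \<Rightarrow> real" and x :: "real^'n"
  assumes S: "open S" "C_k_on (2 * k) S w" and K: "compact K" "K \<subseteq> S" and H: "rad (2 * k) H"
    and supp: "\<And>y. y \<notin> K \<Longrightarrow> eventually (\<lambda>r. H r = 0) (nhds (norm (y - x)))"
  shows "(\<integral>y. w y * (rlap CARD('n) ^^ k) H (norm (y - x)) \<partial>lborel) = (\<integral>y. iter_laplacian k w y * H (norm (y - x)) \<partial>lborel)"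
  using S(2) H
proof (induction k arbitrary: w)
  case 0
  then show ?case by (simp add: iter_laplacian_def)
next
  case (Suc k)
  let ?G = "(rlap CARD('n) ^^ k) H"
  have G: "rad 2 ?G" by (rule rad_rlap_funpow) (use Suc.prems in \<open>simp add: add.commute\<close>)
  have sG: "eventually (\<lambda>r. ?G r = 0) (nhds (norm (y - x)))" if "y \<notin> K" for y
    using rlap_funpow_eventually_eq[OF supp[OF that], of k "CARD('n)"] by (simp add: rlap_funpow_zero)
  have "C_k_on 2 S w"
    using C_k_on_mono[of 2 "2 * Suc k" S w] Suc.prems(1) by simp
  from green_radial[OF S(1) this K G sG]
  have "(\<integral>y. w y * rlap CARD('n) ?G (norm (y - x)) \<partial>lborel) = (\<integral>y. laplacian w y * ?G (norm (y - x)) \<partial>lborel)" .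
  also have "\<dots> = (\<integral>y. iter_laplacian k (laplacian w) y * H (norm (y - x)) \<partial>lborel)"
    using Suc.prems rad_mono[of "2 * k" "2 * Suc k" H]
    by (intro Suc.IH C_k_on_laplacian[OF S(1)]) auto
  finally show ?case by (simp add: iter_laplacian_def funpow_swap1)
qed

section \<open>Bounds on annuli\<close>

lemma integrable_indicator_continuous:
  fixes f :: "'a::euclidean_space \<Rightarrow> real"
  assumes "compact A" "A \<subseteq> S" "continuous_on S f"
  shows "integrable lborel (\<lambda>y. indicator A y * f y)"
  using borel_integrable_compact[OF assms(1) continuous_on_subset[OF assms(3,2)]] by simp

lemma integral_indicator_nonneg:
  fixes f :: "'a \<Rightarrow> real"
  assumes "\<And>x. x \<in> A \<Longrightarrow> 0 \<le> f x"
  shows "0 \<le> (\<integral>x. indicator A x * f x \<partial>M)"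
  by (rule Bochner_Integration.integral_nonneg) (use assms in \<open>simp add: indicator_def\<close>)

lemma compact_annulus: "compact (cball (0::'a::euclidean_space) t - ball 0 s)"
  by (intro compact_diff compact_cball open_ball)

text \<open>For a barrier \<open>H\<close>, the integral of \<open>u\<close> times
  \<open>?L H\<close> equals minus that of \<open>f H\<close>. The former is at least
  \<open>a / e^2 I2 - C0 I0\<close>, the latter at most \<open>- a I1\<close>; so the nonnegative
  \<open>I1\<close> and \<open>I2\<close> are both controlled by \<open>I0\<close>, which does not
  involve \<open>e\<close>. The bound \<open>e^2\<close> is the volume order \<open>e^(2m)\<close>
  times the expected size \<open>e^(2-2m)\<close> of \<open>u\<close>.\<close>

lemma annulus_bounds:
  fixes u :: "real^'n \<Rightarrow> real"
  assumes m: "m \<ge> 2" "CARD('n) = 2 * m"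
    and u: "C_k_on (2 * m) (ball 0 2 - {0}) u" "\<And>x. x \<in> ball 0 2 - {0} \<Longrightarrow> u x \<ge> 0"
    and f: "\<And>x. x \<in> ball 0 2 - {0} \<Longrightarrow> iter_laplacian m u x \<le> 0"
  obtains C where "C > 0"
    "\<And>e. 0 < e \<Longrightarrow> e < 1/16 \<Longrightarrow> (\<integral>y. indicator (cball 0 (8 * e) - ball 0 (2 * e)) y * u y \<partial>lborel) \<le> C * e\<^sup>2"
    "\<And>e. 0 < e \<Longrightarrow> e < 1/16 \<Longrightarrow>
      (\<integral>y. indicator (cball 0 (1/2) - ball 0 (2 * e)) y * (norm y ^ (2 * m - 2) * - iter_laplacian m u y) \<partial>lborel) \<le> C"
proof -
  obtain a C0 :: real where a: "a > 0" "C0 > 0" and test: "\<And>e. 0 < e \<Longrightarrow> e < 1/16 \<Longrightarrow> \<exists>H. barrier m a C0 e H"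
    using barrier_exists[OF m(1)] by blast
  let ?S = "ball (0::real^'n) 2 - {0}"
  let ?L = "rlap (2 * m) ^^ m"
  let ?A = "\<lambda>s t. cball (0::real^'n) t - ball 0 s"
  define f where "f y = - iter_laplacian m u y" for y
  have S: "open ?S" by auto
  have cu: "continuous_on ?S u" using C_k_on_continuous[OF u(1)] .
  have cf: "continuous_on ?S f"
    using C_k_on_iter_laplacian[OF S, of m 0 u] u(1) unfolding f_def by (auto intro!: continuous_intros)
  have f0: "f y \<ge> 0" if "y \<in> ?S" for y using f[OF that] by (simp add: f_def)
  define I0 where "I0 = (\<integral>y. indicator (?A (1/2) 1) y * u y \<partial>lborel)"
  have I0: "I0 \<ge> 0" unfolding I0_def
  proof (rule integral_indicator_nonneg)
    show "0 \<le> u x" if "x \<in> ?A (1/2) 1" for x using that by (intro u(2)) auto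
  qed
  define I1 I2 where "I1 e = (\<integral>y. indicator (?A (2 * e) (1/2)) y * (norm y ^ (2 * m - 2) * f y) \<partial>lborel)"
    and "I2 e = (\<integral>y. indicator (?A (2 * e) (8 * e)) y * u y \<partial>lborel)" for e
  have main: "a * I1 e + a / e\<^sup>2 * I2 e \<le> C0 * I0" and pos: "I1 e \<ge> 0" "I2 e \<ge> 0"
    if e: "0 < e" "e < 1/16" for e
  proof -
    obtain H where H: "rad (2 * m) H" "\<And>r. r \<le> e \<Longrightarrow> H r = 0" "\<And>r. r \<ge> 1 \<Longrightarrow> H r = 0" "\<And>r. 0 \<le> H r"
       "\<And>r. r \<le> 1/2 \<Longrightarrow> 0 \<le> ?L H r" "\<And>r. - C0 \<le> ?L H r"
       "\<And>r. 2 * e \<le> r \<Longrightarrow> r \<le> 8 * e \<Longrightarrow> a / e\<^sup>2 \<le> ?L H r"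
       "\<And>r. 2 * e \<le> r \<Longrightarrow> r \<le> 1/2 \<Longrightarrow> a * r ^ (2 * m - 2) \<le> H r"
      using test[OF e] unfolding barrier_def by blast
    have sub: "?A e 1 \<subseteq> ?S" using e by auto
    have supp: "eventually (\<lambda>r. H r = 0) (nhds (norm (y - 0)))" if "y \<notin> ?A e 1" for y
    proof (cases "norm y < e")
      case True
      then have "eventually (\<lambda>r. r \<in> {..<e}) (nhds (norm (y - 0)))"
        by (intro eventually_nhds_in_open) auto
      then show ?thesis by eventually_elim (use H(2) in auto)
    next
      case False
      then have "eventually (\<lambda>r. r \<in> {1<..}) (nhds (norm (y - 0)))"
        using that by (intro eventually_nhds_in_open) auto
      then show ?thesis by eventually_elim (use H(3) in auto)
    qed
    have LH0: "?L H (norm y) = 0" if "y \<notin> ?A e 1" for y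
      using eventually_nhds_x_imp_x[OF rlap_funpow_eventually_eq[OF supp[OF that], of m "2 * m"]]
      by (simp add: rlap_funpow_zero)
    have cH: "continuous_on ?S (\<lambda>y. H (norm y))" "continuous_on ?S (\<lambda>y. ?L H (norm y))"
      using continuous_on_radial[of "2 * m" H ?S 0] continuous_on_radial[of 0 "?L H" ?S 0]
        rad_Ck[OF H(1)] rad_Ck[OF rad_rlap_funpow[of m 0 H "2 * m"], of 0] H(1) by auto
    have i1: "integrable lborel (\<lambda>y. u y * ?L H (norm y))"
      by (rule integrable_continuous_compact_support[OF compact_annulus sub])
         (use LH0 in \<open>auto intro!: continuous_intros cu cH\<close>)
    have i2: "integrable lborel (\<lambda>y. f y * H (norm y))"
      by (rule integrable_continuous_compact_support[OF compact_annulus sub])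
         (use supp eventually_nhds_x_imp_x in \<open>force intro!: continuous_intros cf cH\<close>)+
    have "(\<integral>y. u y * ?L H (norm (y - 0)) \<partial>lborel) = (\<integral>y. iter_laplacian m u y * H (norm (y - 0)) \<partial>lborel)"
      using green_radial_iter[OF S u(1) compact_annulus sub H(1) supp] m(2) by simp
    then have gr: "(\<integral>y. u y * ?L H (norm y) \<partial>lborel) = - (\<integral>y. f y * H (norm y) \<partial>lborel)"
      by (simp add: f_def)
    have A1: "?A (2 * e) (1/2) \<subseteq> ?S" "?A (2 * e) (8 * e) \<subseteq> ?S" "?A (1/2) 1 \<subseteq> ?S"
      using e by auto
    have j1: "integrable lborel (\<lambda>y. indicator (?A (2 * e) (1/2)) y * (norm y ^ (2 * m - 2) * f y))"
      by (rule integrable_indicator_continuous[OF compact_annulus A1(1)]) (intro continuous_intros cf)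
    have j2: "integrable lborel (\<lambda>y. indicator (?A (2 * e) (8 * e)) y * u y)"
      by (rule integrable_indicator_continuous[OF compact_annulus A1(2) cu])
    have j3: "integrable lborel (\<lambda>y. indicator (?A (1/2) 1) y * u y)"
      by (rule integrable_indicator_continuous[OF compact_annulus A1(3) cu])
    have "a * I1 e = (\<integral>y. a * (indicator (?A (2 * e) (1/2)) y * (norm y ^ (2 * m - 2) * f y)) \<partial>lborel)"
      by (simp add: I1_def)
    also have "\<dots> \<le> (\<integral>y. f y * H (norm y) \<partial>lborel)"
    proof (rule integral_mono[OF integrable_mult_right[OF j1] i2])
      fix y :: "real^'n"
      show "a * (indicator (?A (2 * e) (1/2)) y * (norm y ^ (2 * m - 2) * f y)) \<le> f y * H (norm y)"
      proof (cases "y \<in> ?A (2 * e) (1/2)")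
        case True
        then have "a * norm y ^ (2 * m - 2) * f y \<le> H (norm y) * f y"
          using e by (intro mult_right_mono H(8) f0) auto
        then show ?thesis using True by (simp add: mult_ac)
      next
        case False
        have "0 \<le> f y * H (norm y)"
        proof (cases "y \<in> ?A e 1")
          case True
          then have "y \<in> ?S" using sub by blast
          then show ?thesis using f0 H(4) by simp
        next
          case False
          then show ?thesis using eventually_nhds_x_imp_x[OF supp[OF False]] by simp
        qed
        then show ?thesis using False by simp
      qed
    qed
    finally have 1: "a * I1 e \<le> - (\<integral>y. u y * ?L H (norm y) \<partial>lborel)" using gr by simp
    have "a / e\<^sup>2 * I2 e - C0 * I0 = (\<integral>y. a / e\<^sup>2 * (indicator (?A (2 * e) (8 * e)) y * u y) - C0 * (indicator (?A (1/2) 1) y * u y) \<partial>lborel)"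
      unfolding I0_def I2_def using j2 j3 by (subst Bochner_Integration.integral_diff) auto
    also have "\<dots> \<le> (\<integral>y. u y * ?L H (norm y) \<partial>lborel)"
    proof (rule integral_mono[OF Bochner_Integration.integrable_diff[OF integrable_mult_right[OF j2] integrable_mult_right[OF j3]] i1])
      fix y :: "real^'n"
      show "a / e\<^sup>2 * (indicator (?A (2 * e) (8 * e)) y * u y) - C0 * (indicator (?A (1/2) 1) y * u y) \<le> u y * ?L H (norm y)"
      proof (cases "y \<in> ?A e 1")
        case False
        then have "y \<notin> ?A (2 * e) (8 * e)" "y \<notin> ?A (1/2) 1" using e by auto
        then show ?thesis using LH0[OF False] by simp
      next
        case True
        then have uy: "u y \<ge> 0" using sub u(2) by blast
        consider "y \<in> ?A (2 * e) (8 * e)" | "y \<notin> ?A (2 * e) (8 * e)" "norm y < 1/2" | "norm y \<ge> 1/2" by fastforce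
        then show ?thesis
        proof cases
          case 1
          then have "y \<notin> ?A (1/2) 1" using e by auto
          moreover have "a / e\<^sup>2 * u y \<le> ?L H (norm y) * u y"
            using 1 uy by (intro mult_right_mono H(7)) auto
          ultimately show ?thesis using 1 by (simp add: mult_ac)
        next
          case 2
          then have "y \<notin> ?A (1/2) 1" by auto
          then show ?thesis using 2 uy H(5)[of "norm y"] by simp
        next
          case 3
          then have "y \<notin> ?A (2 * e) (8 * e)" "y \<in> ?A (1/2) 1" using e True by auto
          moreover have "- C0 * u y \<le> ?L H (norm y) * u y"
            using uy by (intro mult_right_mono H(6)) auto
          ultimately show ?thesis by (simp add: mult_ac)
        qed
      qed
    qed
    finally show "a * I1 e + a / e\<^sup>2 * I2 e \<le> C0 * I0" using 1 by simp
    show "I1 e \<ge> 0" unfolding I1_def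
      using A1(1) f0 by (intro integral_indicator_nonneg mult_nonneg_nonneg zero_le_power norm_ge_zero) blast
    show "I2 e \<ge> 0" unfolding I2_def
      using A1(2) u(2) by (intro integral_indicator_nonneg) blast
  qed
  show ?thesis
  \<comment> \<open>The summand 1 keeps the constant positive when \<open>I0 = 0\<close>.\<close>
  proof (rule that[of "C0 * I0 / a + 1"])
    show "C0 * I0 / a + 1 > 0" using I0 a by (simp add: add_nonneg_pos)
    fix e :: real assume e: "0 < e" "e < 1/16"
    have "a * I1 e \<le> C0 * I0" "a / e\<^sup>2 * I2 e \<le> C0 * I0"
    proof -
      have "0 \<le> a * I1 e" "0 \<le> a / e\<^sup>2 * I2 e" using pos[OF e] a by auto
      then show "a * I1 e \<le> C0 * I0" "a / e\<^sup>2 * I2 e \<le> C0 * I0" using main[OF e] by linarith+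
    qed
    then have "I1 e \<le> C0 * I0 / a" "I2 e \<le> C0 * I0 / a * e\<^sup>2"
      using a e by (auto simp: field_simps)
    moreover have "C0 * I0 / a * e\<^sup>2 \<le> (C0 * I0 / a + 1) * e\<^sup>2" by (intro mult_right_mono) auto
    ultimately show "(\<integral>y. indicator (?A (2 * e) (1/2)) y * (norm y ^ (2 * m - 2) * - iter_laplacian m u y) \<partial>lborel) \<le> C0 * I0 / a + 1"
      "(\<integral>y. indicator (?A (2 * e) (8 * e)) y * u y \<partial>lborel) \<le> (C0 * I0 / a + 1) * e\<^sup>2"
      by (simp_all add: I1_def I2_def f_def)
  qed
qed

section \<open>The logarithmic kernel\<close>

lemma integral_pos_continuous:
  fixes f :: "'a::euclidean_space \<Rightarrow> real"
  assumes "integrable lborel f" "isCont f p" "\<And>x. f x \<ge> 0" "f p > 0"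
  shows "(\<integral>x. f x \<partial>lborel) > 0"
proof -
  obtain \<delta> where \<delta>: "\<delta> > 0" "\<And>x. dist x p < \<delta> \<Longrightarrow> dist (f x) (f p) < f p / 2"
    using assms(2,4) unfolding continuous_at_eps_delta by (metis half_gt_zero)
  have "0 < f p / 2 * measure lborel (ball p \<delta>)"
    using assms(4) \<delta>(1) content_ball_pos[OF \<delta>(1), of p] by simp
  also have "\<dots> = (\<integral>x. f p / 2 * indicator (ball p \<delta>) x \<partial>lborel)"
    by simp
  also have "\<dots> \<le> (\<integral>x. f x \<partial>lborel)"
  proof (rule integral_mono[OF _ assms(1)])
    show "integrable lborel (\<lambda>x. f p / 2 * indicator (ball p \<delta>) x)"
      using emeasure_bounded_finite[of "ball p \<delta>"] by (intro integrable_mult_right) auto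
    fix x
    show "f p / 2 * indicator (ball p \<delta>) x \<le> f x"
    proof (cases "x \<in> ball p \<delta>")
      case True
      then have "\<bar>f x - f p\<bar> < f p / 2" using \<delta>(2)[of x] by (metis dist_commute dist_real_def mem_ball)
      then show ?thesis using True by (simp add: abs_if split: if_splits)
    qed (use assms(3) in simp)
  qed
  finally show ?thesis .
qed

lemma deriv_eqI:
  assumes "\<And>x. (f has_real_derivative f' x) (at x)"
  shows "deriv f = f'"
  using assms DERIV_imp_deriv by blast

lemma euler_const: "euler b [:q:] = [:b * q:]"
  by (simp add: euler_def)

text \<open>The profile solves \<open>P' = (1 - \<zeta>) r\<^bsup>1-n\<^esup>\<close> for a cutoff \<open>\<zeta>\<close>, so its radial Laplacian is \<open>- \<zeta>' r\<^bsup>1-n\<^esup> \<ge> 0\<close>.\<close>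

lemma comparison_profile_exists:
  assumes m: "m \<ge> 2" "CARD('n) = 2 * m"
  obtains P :: "real \<Rightarrow> real" where "rad 2 P"
    "\<And>r. r \<ge> 1 \<Longrightarrow> P r = r powi (2 - 2 * int m) / (2 - 2 * real m)"
    "\<And>r. r > 1 \<Longrightarrow> rlap (2 * m) P r = 0"
    "(\<integral>y. rlap (2 * m) P (norm (y :: real^'n)) \<partial>lborel) > 0"
proof -
  obtain \<zeta> :: "real \<Rightarrow> real" where \<zeta>: "Ck (Suc 1) \<zeta>" "\<And>r. r \<le> 3/5 \<Longrightarrow> \<zeta> r = 1" "\<And>r. r \<ge> 1 \<Longrightarrow> \<zeta> r = 0"
    "\<And>r. deriv \<zeta> r \<le> 0" "deriv \<zeta> (4/5) < 0"
    using cutoff_exists[of 1] by metis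
  define \<beta> where "\<beta> r = (1 - \<zeta> r) / r ^ (2 * m - 1)" for r
  have \<zeta>1: "Ck 1 \<zeta>" using \<zeta>(1) Ck_Suc_D by blast
  have \<beta>: "Ck 1 \<beta>"
    unfolding \<beta>_def by (rule Ck_divide_power[where a = "3/5"]) (use \<zeta>(2) Ck_diff[OF Ck_const \<zeta>1, of 1] in auto)
  have \<beta>0: "\<beta> r = 0" if "r < 3/5" for r using that \<zeta>(2) by (simp add: \<beta>_def)
  obtain P1 where P1: "Ck (Suc 1) P1" "\<And>x. (P1 has_real_derivative \<beta> x) (at x)"
    using Ck_antiderivative[OF \<beta>] by blast
  \<comment> \<open>The additive constant gives \<open>P 1\<close> the value at 1 of the power that
    \<open>P\<close> has to equal from there on.\<close>
  define P where "P r = P1 r + (1 / (2 - 2 * real m) - P1 1)" for r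
  have dP: "(P has_real_derivative \<beta> x) (at x)" for x
    unfolding P_def using P1(2)[of x] by (auto intro!: derivative_eq_intros)
  have dP': "deriv P = \<beta>" by (rule deriv_eqI[OF dP])
  have cP: "Ck 2 P" unfolding P_def numeral_2_eq_2 using P1(1) by (intro Ck_add) auto
  have Pl: "P r = P (3/5)" if "r < 3/5" for r
  proof -
    have "P (3/5) = P r"
      by (rule DERIV_isconst_end[OF that])
         (use dP \<beta>0 in \<open>auto intro!: continuous_on_subset[OF Ck_continuous[OF cP]] intro: DERIV_cong\<close>)
    then show ?thesis by simp
  qed
  have radP: "rad 2 P" by (rule radI[OF cP, of "3/5"]) (use Pl in auto)
  have Pu: "P r = r powi (2 - 2 * int m) / (2 - 2 * real m)" if "r \<ge> 1" for r
  proof (cases "r = 1")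
    case True
    then show ?thesis by (simp add: P_def)
  next
    case False
    then have r: "1 < r" using that by simp
    let ?g = "\<lambda>r. P r - r powi (2 - 2 * int m) / (2 - 2 * real m)"
    have dg: "(?g has_real_derivative 0) (at x)" if "x \<ge> 1" for x
    proof -
      have "((\<lambda>r. r powi (2 - 2 * int m)) has_real_derivative (2 - 2 * real m) * x powi (1 - 2 * int m)) (at x)"
        using deriv_powi_poly[of x "2 - 2 * int m" "[:1:]" 0] that by (simp add: euler_const mult.commute)
      then have "((\<lambda>r. r powi (2 - 2 * int m) / (2 - 2 * real m)) has_real_derivative (2 - 2 * real m) * x powi (1 - 2 * int m) / (2 - 2 * real m)) (at x)"
        by (rule DERIV_cdivide)
      moreover have "\<beta> x = x powi (1 - 2 * int m)"
      proof -
        have "x powi (1 - 2 * int m) = inverse (x powi (int (2 * m - 1)))"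
          using m by (simp add: power_int_minus[symmetric] of_nat_diff)
        then show ?thesis using that \<zeta>(3)[of x] by (simp add: \<beta>_def divide_inverse)
      qed
      moreover have "(2 - 2 * real m) * x powi (1 - 2 * int m) / (2 - 2 * real m) = x powi (1 - 2 * int m)"
        using m by simp
      ultimately show ?thesis using DERIV_diff[OF dP[of x]] by fastforce
    qed
    have "?g r = ?g 1"
    proof (rule DERIV_isconst_end[OF r])
      show "continuous_on {1..r} ?g"
        by (rule DERIV_continuous_on[where D = "\<lambda>_. 0"]) (use dg in \<open>auto intro: has_field_derivative_at_within\<close>)
    qed (use dg in auto)
    then show ?thesis by (simp add: P_def)
  qed
  have ddP: "rlap (2 * m) P r = - deriv \<zeta> r / r ^ (2 * m - 1)" if "r > 0" for r
  proof -
    have dz: "(\<zeta> has_real_derivative deriv \<zeta> r) (at r)" using \<zeta>(1) by simp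
    have pw: "((\<lambda>r. r ^ (2 * m - 1)) has_real_derivative real (2 * m - 1) * r ^ (2 * m - 2)) (at r)"
      using DERIV_pow[of "2 * m - 1" r] by (simp add: numeral_2_eq_2)
    have "(\<beta> has_real_derivative ((0 - deriv \<zeta> r) * r ^ (2 * m - 1) - (1 - \<zeta> r) * (real (2 * m - 1) * r ^ (2 * m - 2))) / (r ^ (2 * m - 1) * r ^ (2 * m - 1))) (at r)"
      unfolding \<beta>_def[abs_def]
      by (intro DERIV_divide DERIV_diff DERIV_const dz pw) (use that in simp)
    then have d: "deriv \<beta> r = ((0 - deriv \<zeta> r) * r ^ (2 * m - 1) - (1 - \<zeta> r) * (real (2 * m - 1) * r ^ (2 * m - 2))) / (r ^ (2 * m - 1) * r ^ (2 * m - 1))"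
      by (rule DERIV_imp_deriv)
    define A where "A = r ^ (2 * m - 2)"
    have A: "A > 0" using that by (simp add: A_def)
    have rA: "r ^ (2 * m - 1) = r * A"
      unfolding A_def power_Suc[symmetric] using m by (intro arg_cong[where f = "\<lambda>k. r ^ k"]) simp
    have "deriv \<beta> r = - deriv \<zeta> r / (r * A) - (1 - \<zeta> r) * real (2 * m - 1) / (r * r * A)"
      unfolding d rA A_def[symmetric] using that A by (simp add: field_simps)
    moreover have br: "\<beta> r = (1 - \<zeta> r) / (r * A)" unfolding \<beta>_def rA ..
    ultimately have "rlap (2 * m) P r = - deriv \<zeta> r / (r * A) - (1 - \<zeta> r) * real (2 * m - 1) / (r * r * A)
        + (real (2 * m) - 1) / r * ((1 - \<zeta> r) / (r * A))"
      by (simp add: rlap_def dP' br)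
    also have "(real (2 * m) - 1) / r * ((1 - \<zeta> r) / (r * A)) = (1 - \<zeta> r) * real (2 * m - 1) / (r * r * A)"
      using m by (simp add: of_nat_diff mult_ac)
    finally show ?thesis unfolding rA by simp
  qed
  have Lneg: "rlap (2 * m) P r = 0" if "r < 3/5" for r using rlap_zero_left[OF Pl that] .
  have L0: "rlap (2 * m) P r \<ge> 0" for r
    using Lneg[of r] ddP[of r] \<zeta>(4)[of r] by (cases "r < 3/5") (auto intro!: divide_nonpos_nonneg)
  have L1: "rlap (2 * m) P r = 0" if "r > 1" for r
  proof -
    have "eventually (\<lambda>y. \<zeta> y = 0) (nhds r)"
      using that \<zeta>(3) by (auto simp: eventually_nhds intro!: exI[of _ "{1<..}"])
    then have "deriv \<zeta> r = deriv (\<lambda>_. 0) r" by (rule deriv_cong_ev) simp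
    then show ?thesis using ddP[of r] that by simp
  qed
  have c: "continuous_on UNIV (\<lambda>y::real^'n. rlap (2 * m) P (norm y))"
    using continuous_on_radial[of 0 "rlap (2 * m) P" UNIV 0] rad_Ck[OF rad_rlap[of 0 P], of 0] radP
    by (simp add: numeral_2_eq_2)
  \<comment> \<open>The integrand is nonnegative, and positive where the norm is \<open>4/5\<close>,
    since \<open>deriv \<zeta>\<close> is negative there.\<close>
  have "(\<integral>y. rlap (2 * m) P (norm (y :: real^'n)) \<partial>lborel) > 0"
  proof (rule integral_pos_continuous[where p = "(4/5) *\<^sub>R axis undefined 1"])
    show "integrable lborel (\<lambda>y::real^'n. rlap (2 * m) P (norm y))"
      by (rule integrable_continuous_compact_support[OF compact_cball[of 0 1] _ c]) (auto simp: L1)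
    show "isCont (\<lambda>y::real^'n. rlap (2 * m) P (norm y)) ((4/5) *\<^sub>R axis undefined 1)"
      using c by (simp add: continuous_on_eq_continuous_at)
    show "0 < rlap (2 * m) P (norm ((4/5) *\<^sub>R axis undefined 1 :: real^'n))"
      using ddP[of "4/5"] \<zeta>(5) by (simp add: norm_axis_1 divide_neg_pos)
  qed (rule L0)
  with radP Pu L1 that show ?thesis by blast
qed

section \<open>Iterated Laplacians of the logarithm and of its smoothed version\<close>

lemma C_k_on_const: "C_k_on k S (\<lambda>x. c)"
proof (cases k)
  case (Suc j)
  have "partial_deriv i (\<lambda>x::real^'a. c) = (\<lambda>x. 0)" for i
    by (simp add: partial_deriv_def fun_eq_iff)
  with Suc C_k_on_zero show ?thesis by simp
qed simp

lemma laplacian_const: "laplacian (\<lambda>x. c) = (\<lambda>x. 0)"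
proof -
  have "partial_deriv i (\<lambda>x::real^'a. d) = (\<lambda>x. 0)" for i d
    by (simp add: partial_deriv_def fun_eq_iff)
  then show ?thesis by (simp add: laplacian_def[abs_def])
qed

text \<open>The first Laplacian of \<open>ln r\<close> is \<open>(2m-2) r^(-2)\<close>; each further
  one multiplies \<open>r^b\<close> by \<open>b (b + 2m - 2)\<close> and lowers \<open>b\<close> by
  2. That factor first vanishes at \<open>b = 2 - 2m\<close>, which is the exponent reached at
  \<open>j = m - 2\<close>, so \<open>q\<close> is still nonzero there.\<close>

lemma rlap_funpow_log:
  assumes m: "m \<ge> 2" and E: "\<And>r. r > 1 \<Longrightarrow> E r = ln r"
  shows "\<exists>q. (j \<le> m - 2 \<longrightarrow> q \<noteq> 0) \<and> (\<forall>r>1. (rlap (2 * m) ^^ Suc j) E r = r powi (- 2 - 2 * int j) * q)"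
proof (induction j)
  case 0
  have op: "eventually (\<lambda>s::real. s > 1) (nhds r)" if "r > 1" for r
    using that by (auto simp: eventually_nhds intro!: exI[of _ "{1<..}"])
  have d: "deriv E r = 1 / r" if "r > 1" for r
  proof (rule DERIV_imp_deriv, rule has_real_derivative_eventually_eq)
    show "eventually (\<lambda>s. E s = ln s) (nhds r)"
      using op[OF that] by eventually_elim (rule E)
    show "(ln has_real_derivative 1 / r) (at r)" using that by (auto intro!: derivative_eq_intros)
  qed
  have dd: "deriv (deriv E) r = - 1 / r\<^sup>2" if "r > 1" for r
  proof (rule DERIV_imp_deriv, rule has_real_derivative_eventually_eq)
    show "eventually (\<lambda>s. deriv E s = 1 / s) (nhds r)"
      using op[OF that] by eventually_elim (rule d)
    show "((\<lambda>s. 1 / s) has_real_derivative - 1 / r\<^sup>2) (at r)"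
      using that by (auto intro!: derivative_eq_intros simp: power2_eq_square)
  qed
  have "rlap (2 * m) E r = r powi (- 2 - 2 * int 0) * (2 * real m - 2)" if "r > 1" for r
    using that by (simp add: rlap_def d dd power_int_minus field_simps power2_eq_square)
  then show ?case using m by (intro exI[of _ "2 * real m - 2"]) auto
next
  case (Suc j)
  then obtain q where q: "j \<le> m - 2 \<longrightarrow> q \<noteq> 0"
    "\<forall>r>1. (rlap (2 * m) ^^ Suc j) E r = r powi (- 2 - 2 * int j) * q" by blast
  let ?b = "- 2 - 2 * int j"
  let ?q = "real_of_int ?b * ((real_of_int ?b + real (2 * m) - 2) * q)"
  have "(rlap (2 * m) ^^ Suc (Suc j)) E r = r powi (- 2 - 2 * int (Suc j)) * ?q" if "r > 1" for r
  proof -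
    have "rlap (2 * m) ((rlap (2 * m) ^^ Suc j) E) r =
      r powi (?b - 2) * poly (euler (real_of_int ?b) (euler (real_of_int ?b + real (2 * m) - 2) [:q:])) (0 / r)"
      by (rule rlap_powi_poly[of "{1<..}"]) (use q that in auto)
    also have "?b - 2 = - 2 - 2 * int (Suc j)" by simp
    also have "poly (euler (real_of_int ?b) (euler (real_of_int ?b + real (2 * m) - 2) [:q:])) (0 / r) = ?q"
      unfolding euler_const by simp
    finally show ?thesis by simp
  qed
  moreover have "?q \<noteq> 0" if "Suc j \<le> m - 2"
  proof -
    have "real j + 3 \<le> real m" using that m by simp
    then show ?thesis using q(1) that by auto
  qed
  ultimately show ?case by blast
qed

text \<open>The \<open>(m-1)\<close>-st iterate is a multiple of \<open>r^(2-2m)\<close>, the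
  harmonic power in dimension \<open>2m\<close>.\<close>

lemma rlap_funpow_log_eq_0:
  assumes m: "m \<ge> 2" and E: "\<And>r. r > 1 \<Longrightarrow> E r = ln r" and "r > 1"
  shows "(rlap (2 * m) ^^ m) E r = 0"
proof -
  obtain q where q: "\<forall>r>1. (rlap (2 * m) ^^ Suc (m - 2)) E r = r powi (- 2 - 2 * int (m - 2)) * q"
    using rlap_funpow_log[OF m E, of "m - 2"] by blast
  let ?b = "- 2 - 2 * int (m - 2)"
  have "rlap (2 * m) ((rlap (2 * m) ^^ Suc (m - 2)) E) r =
      r powi (?b - 2) * poly (euler (real_of_int ?b) (euler (real_of_int ?b + real (2 * m) - 2) [:q:])) (0 / r)"
    by (rule rlap_powi_poly[of "{1<..}"]) (use q assms(3) in auto)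
  also have "real_of_int ?b + real (2 * m) - 2 = 0" using m by (simp add: of_nat_diff)
  finally have "rlap (2 * m) ((rlap (2 * m) ^^ Suc (m - 2)) E) r = 0"
    unfolding euler_const by simp
  then have "(rlap (2 * m) ^^ Suc (Suc (m - 2))) E r = 0" by simp
  moreover have "Suc (Suc (m - 2)) = m" using m by simp
  ultimately show ?thesis by (simp only:)
qed

text \<open>A logarithm flattened below scale 1. When
  \<open>ln (d / \<sigma>) - E (r / \<sigma>)\<close> stands in for \<open>ln (d / r)\<close>, the
  bound \<open>ln r <= E r\<close> keeps it below \<open>ln (d / r)\<close>, monotonicity keeps it
  nonnegative for \<open>r <= d\<close>, and \<open>- 1 <= E r\<close> keeps it bounded.\<close>

definition log_kernel :: "nat \<Rightarrow> (real \<Rightarrow> real) \<Rightarrow> bool" where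
  "log_kernel m E \<longleftrightarrow> Ck (2 * m) E \<and> mono E \<and> (\<forall>r<3/5. E r = E 0) \<and> (\<forall>r\<ge>1. E r = ln r) \<and>
     (\<forall>r>0. ln r \<le> E r) \<and> (\<forall>r. - 1 \<le> E r)"

text \<open>Taking \<open>E' = (1 - \<zeta>) / r\<close> makes \<open>E - ln\<close> nonincreasing
  with value 0 at 1, so \<open>E\<close> lies above \<open>ln\<close>. The bound \<open>- 1\<close>
  follows from \<open>ln (1/2) >= - 1\<close>, as \<open>E\<close> is constant below
  \<open>3/5\<close> and nondecreasing.\<close>

lemma log_kernel_exists: "\<exists>E. log_kernel m E"
proof -
  obtain \<zeta> :: "real \<Rightarrow> real" where \<zeta>: "Ck (Suc (2 * m)) \<zeta>" "\<And>r. r \<le> 3/5 \<Longrightarrow> \<zeta> r = 1" "\<And>r. r \<ge> 1 \<Longrightarrow> \<zeta> r = 0"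
    "\<And>r. 0 \<le> \<zeta> r" "\<And>r. \<zeta> r \<le> 1"
    using cutoff_exists[of "2 * m"] by metis
  define \<beta> where "\<beta> r = (1 - \<zeta> r) / r" for r
  have \<beta>: "Ck (2 * m) \<beta>"
    unfolding \<beta>_def by (rule Ck_divide_ident[where a = "3/5"])
      (use \<zeta>(2) Ck_diff[OF Ck_const Ck_Suc_D[OF \<zeta>(1)], of 1] in auto)
  have \<beta>0: "\<beta> r = 0" if "r \<le> 3/5" for r using that \<zeta>(2) by (simp add: \<beta>_def)
  have \<beta>p: "\<beta> r \<ge> 0" for r
    using \<zeta>(5)[of r] \<beta>0[of r] by (cases "r \<le> 3/5") (auto simp: \<beta>_def)
  obtain F where F: "Ck (Suc (2 * m)) F" "\<And>x. (F has_real_derivative \<beta> x) (at x)"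
    using Ck_antiderivative[OF \<beta>] by blast
  define E where "E r = F r - F 1" for r
  have dE: "(E has_real_derivative \<beta> x) (at x)" for x
    unfolding E_def using F(2)[of x] by (auto intro!: derivative_eq_intros)
  have cE: "Ck (2 * m) E" unfolding E_def using Ck_Suc_D[OF F(1)] by (intro Ck_diff) auto
  have mono: "E x \<le> E y" if "x \<le> y" for x y
    by (rule DERIV_nonneg_imp_nondecreasing[OF that]) (use dE \<beta>p in blast)
  have const: "E r = E 0" if "r < 3/5" for r
  proof -
    have c: "E x = E y" if "x < y" "y < 3/5" for x y
    proof -
      have "E y = E x"
      proof (rule DERIV_isconst_end[OF that(1)])
        show "continuous_on {x..y} E" by (rule continuous_on_subset[OF Ck_continuous[OF cE]]) simp
        show "(E has_real_derivative 0) (at z)" if "x < z" "z < y" for z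
          using dE[of z] \<beta>0[of z] that \<open>y < 3/5\<close> by simp
      qed
      then show ?thesis by simp
    qed
    show ?thesis
    proof (cases r "0::real" rule: linorder_cases)
      case less
      then show ?thesis by (rule c) simp
    next
      case greater
      then show ?thesis using c[of 0 r] that by (rule_tac sym) blast
    qed (simp only:)
  qed
  have dl: "((\<lambda>r. E r - ln r) has_real_derivative - \<zeta> x / x) (at x)" if "x > 0" for x
    using DERIV_diff[OF dE[of x] DERIV_ln_divide[OF that]] by (simp add: \<beta>_def diff_divide_distrib)
  have cl: "continuous_on {a..b} (\<lambda>r. E r - ln r)" if "a > 0" for a b
    by (rule DERIV_continuous_on[where D = "\<lambda>x. - \<zeta> x / x"])
       (use dl that in \<open>auto intro: has_field_derivative_at_within\<close>)
  have E1: "E 1 = 0" by (simp add: E_def)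
  have ln: "E r = ln r" if "r \<ge> 1" for r
  proof (cases "r = 1")
    case False
    then have r: "1 < r" using that by simp
    have "E r - ln r = E 1 - ln 1"
    proof (rule DERIV_isconst_end[OF r cl])
      show "((\<lambda>r. E r - ln r) has_real_derivative 0) (at x)" if "1 < x" "x < r" for x
        using dl[of x] \<zeta>(3)[of x] that by simp
    qed simp
    then show ?thesis by (simp add: E1)
  qed (simp add: E1)
  have lnle: "ln r \<le> E r" if "r > 0" for r
  proof (cases "r \<le> 1")
    case True
    have "E 1 - ln 1 \<le> E r - ln r"
    proof (rule DERIV_nonpos_imp_nonincreasing[OF True])
      fix x assume x: "r \<le> x" "x \<le> 1"
      then have "- \<zeta> x / x \<le> 0" using \<zeta>(4)[of x] that by (simp add: field_simps)
      with dl[of x] x that show "\<exists>y. ((\<lambda>r. E r - ln r) has_real_derivative y) (at x) \<and> y \<le> 0" by auto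
    qed
    then show ?thesis by (simp add: E1)
  next
    case False
    then show ?thesis using ln[of r] by simp
  qed
  have lower: "- 1 \<le> E r" for r
  proof -
    have "ln (1 / (1/2)) \<le> 1 / (1/2) - (1::real)" by (rule ln_le_minus_one) simp
    then have "- 1 \<le> ln (1/2::real)" by (simp add: ln_div)
    also have "\<dots> \<le> E (1/2)" by (rule lnle) simp
    finally have h: "- 1 \<le> E (1/2)" .
    show ?thesis
      using h const[of r] const[of "1/2"] mono[of "1/2" r] by (cases "r \<le> 1/2") auto
  qed
  show ?thesis unfolding log_kernel_def monotone_def
    using cE mono const ln lnle lower by blast
qed

lemma log_kernel_rad: "log_kernel m E \<Longrightarrow> rad (2 * m) E"
  unfolding log_kernel_def by (rule radI[of _ _ "3/5" "E 0"]) (blast | simp)+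

text \<open>The nonzero constant \<^term>\<open>c0\<close> is the mass of the \<^term>\<open>m\<close>-th Laplacian of the logarithm at its
  singularity.\<close>

lemma log_kernel_mass:
  assumes m: "m \<ge> 2" "CARD('n) = 2 * m" and E: "log_kernel m E"
  obtains c0 where "c0 \<noteq> 0"
    "\<And>(x :: real^'n) \<sigma>. \<sigma> > 0 \<Longrightarrow> (\<integral>y. (rlap (2 * m) ^^ m) (\<lambda>r. E (r / \<sigma>)) (norm (y - x)) \<partial>lborel) = c0"
proof -
  have Eln: "E r = ln r" if "r > 1" for r using E that by (simp add: log_kernel_def)
  obtain q where q: "q \<noteq> 0" "\<And>r. r > 1 \<Longrightarrow> (rlap (2 * m) ^^ Suc (m - 2)) E r = r powi (- 2 - 2 * int (m - 2)) * q"
    using rlap_funpow_log[OF m(1) Eln, of "m - 2"] by blast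
  have m1: "Suc (m - 2) = m - 1" "- 2 - 2 * int (m - 2) = 2 - 2 * int m" using m by auto
  obtain P where P: "rad 2 P" "\<And>r. r \<ge> 1 \<Longrightarrow> P r = r powi (2 - 2 * int m) / (2 - 2 * real m)"
    "\<And>r. r > 1 \<Longrightarrow> rlap (2 * m) P r = 0"
    and J: "(\<integral>y. rlap (2 * m) P (norm (y :: real^'n)) \<partial>lborel) > 0"
    using comparison_profile_exists[OF m] by blast
  define J where "J = (\<integral>y. rlap (2 * m) P (norm (y :: real^'n)) \<partial>lborel)"
  let ?s = "2 - 2 * real m"
  show ?thesis
  proof (rule that[of "q * ?s * J"])
    show "q * ?s * J \<noteq> 0" using q(1) J m by (simp add: J_def)
    fix x :: "real^'n" and \<sigma> :: real assume \<sigma>: "\<sigma> > 0"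
    define V where "V = (rlap (2 * m) ^^ (m - 1)) (\<lambda>r. E (r / \<sigma>))"
    have radE: "rad (2 * m) (\<lambda>r. E (r / \<sigma>))" using rad_scale[OF log_kernel_rad[OF E] \<sigma>] .
    have mm: "2 * (m - 1) + 2 = 2 * m" using m by simp
    have radV: "rad 2 V" unfolding V_def
      by (rule rad_rlap_funpow) (use radE mm in simp)
    have V: "V r = q * r powi (2 - 2 * int m)" if "r > \<sigma>" for r
    proof -
      have "V r = inverse (\<sigma> ^ (2 * (m - 1))) * (rlap (2 * m) ^^ (m - 1)) E (r / \<sigma>)"
        unfolding V_def using rlap_funpow_scale[of "m - 1" E \<sigma> "2 * m"] \<sigma>
          rad_mono[OF _ log_kernel_rad[OF E], of "2 * (m - 1)"] by simp
      also have "(rlap (2 * m) ^^ (m - 1)) E (r / \<sigma>) = (r / \<sigma>) powi (2 - 2 * int m) * q"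
        using q(2)[of "r / \<sigma>"] that \<sigma> unfolding m1 by simp
      also have "(r / \<sigma>) powi (2 - 2 * int m) = r powi (2 - 2 * int m) * \<sigma> ^ (2 * (m - 1))"
      proof -
        have "\<sigma> powi (2 - 2 * int m) = inverse (\<sigma> powi (int (2 * (m - 1))))"
          using m by (simp add: power_int_minus[symmetric] of_nat_diff algebra_simps)
        then show ?thesis unfolding power_int_divide_distrib by (simp only: power_int_of_nat divide_inverse inverse_inverse_eq)
      qed
      finally show ?thesis using \<sigma> by simp
    qed
    \<comment> \<open>Beyond both scales \<open>V\<close> is \<open>q r^(2-2m)\<close>, which is
      \<open>q * ?s\<close> times \<open>P\<close>. So \<open>D\<close> has bounded support, and
      Green's identity with the function 1 shows that the Laplacians of \<open>V\<close> and of
      \<open>q * ?s * P\<close> have equal integrals.\<close>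
    define D where "D r = V r - (q * ?s) * P r" for r
    have radD: "rad 2 D" unfolding D_def by (rule rad_diff[OF radV rad_cmult[OF P(1)]])
    have D0: "D r = 0" if "r > max \<sigma> 1" for r
      using that V[of r] P(2)[of r] m by (simp add: D_def)
    let ?K = "cball x (max \<sigma> 1)"
    have "(\<integral>y. 1 * rlap CARD('n) D (norm (y - x)) \<partial>lborel) = (\<integral>y. laplacian (\<lambda>_. 1) y * D (norm (y - x)) \<partial>lborel)"
    proof (rule green_radial[where S = UNIV and K = ?K])
      show "eventually (\<lambda>r. D r = 0) (nhds (norm (y - x)))" if "y \<notin> ?K" for y
      proof -
        have "eventually (\<lambda>r. r \<in> {max \<sigma> 1<..}) (nhds (norm (y - x)))"
          using that by (intro eventually_nhds_in_open) (auto simp: dist_norm norm_minus_commute)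
        then show ?thesis by eventually_elim (use D0 in auto)
      qed
    qed (use radD C_k_on_const in auto)
    then have "(\<integral>y. rlap (2 * m) D (norm (y - x)) \<partial>lborel) = 0"
      by (simp add: laplacian_const m(2))
    moreover have "rlap (2 * m) D r = rlap (2 * m) V r - (q * ?s) * rlap (2 * m) P r" for r
      using rlap_funpow_diff[of 1 V "\<lambda>r. (q * ?s) * P r" "2 * m"] rlap_funpow_cmult[of 1 P "2 * m" "q * ?s"] radV P(1) rad_cmult[OF P(1)]
      unfolding D_def[abs_def] by (simp add: numeral_2_eq_2)
    moreover have int: "integrable lborel (\<lambda>y. rlap (2 * m) G (norm (y - x)))"
      if "rad 2 G" "\<And>r. r > max \<sigma> 1 \<Longrightarrow> rlap (2 * m) G r = 0" for G
    proof (rule integrable_continuous_compact_support[of ?K UNIV])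
      show "continuous_on UNIV (\<lambda>y. rlap (2 * m) G (norm (y - x)))"
        using rad_Ck[OF rad_rlap[of 0 G], of 0] that(1) by (intro continuous_on_radial[of 0]) (simp add: numeral_2_eq_2)
      show "rlap (2 * m) G (norm (y - x)) = 0" if "y \<notin> ?K" for y
      proof (rule \<open>\<And>r. r > max \<sigma> 1 \<Longrightarrow> rlap (2 * m) G r = 0\<close>)
        show "norm (y - x) > max \<sigma> 1" using that by (simp add: dist_norm norm_minus_commute not_le)
      qed
    qed auto
    moreover have LV: "rlap (2 * m) V = (rlap (2 * m) ^^ m) (\<lambda>r. E (r / \<sigma>))"
    proof -
      have "rlap (2 * m) V = (rlap (2 * m) ^^ Suc (m - 1)) (\<lambda>r. E (r / \<sigma>))" by (simp add: V_def)
      moreover have "Suc (m - 1) = m" using m by simp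
      ultimately show ?thesis by (simp only:)
    qed
    moreover have "rlap (2 * m) V r = 0" if "r > max \<sigma> 1" for r
    proof -
      have "rlap (2 * m) V r = inverse (\<sigma> ^ (2 * m)) * (rlap (2 * m) ^^ m) E (r / \<sigma>)"
        unfolding LV using rlap_funpow_scale[of m E \<sigma> "2 * m"] \<sigma> log_kernel_rad[OF E] by simp
      then show ?thesis using rlap_funpow_log_eq_0[OF m(1) Eln, of "r / \<sigma>"] that \<sigma> by simp
    qed
    ultimately have "(\<integral>y. (rlap (2 * m) ^^ m) (\<lambda>r. E (r / \<sigma>)) (norm (y - x)) \<partial>lborel) = (q * ?s) * (\<integral>y. rlap (2 * m) P (norm (y - x)) \<partial>lborel)"
      using int[OF radV] int[OF P(1)] P(3) by simp
    also have "(\<integral>y. rlap (2 * m) P (norm (y - x)) \<partial>lborel) = J"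
    proof -
      have "continuous_on UNIV (\<lambda>y::real^'n. rlap (2 * m) P (norm (y - x)))"
        using rad_Ck[OF rad_rlap[of 0 P], of 0] P(1) by (intro continuous_on_radial[of 0]) (simp add: numeral_2_eq_2)
      then have "(\<lambda>y::real^'n. rlap (2 * m) P (norm (y - x))) \<in> borel_measurable borel"
        by (rule borel_measurable_continuous_onI)
      from integral_lborel_translate[OF this, of x] show ?thesis by (simp add: J_def)
    qed
    finally show "(\<integral>y. (rlap (2 * m) ^^ m) (\<lambda>r. E (r / \<sigma>)) (norm (y - x)) \<partial>lborel) = q * ?s * J" .
  qed
qed

section \<open>Logarithmic potentials and the local bound\<close>

lemma min_le_count: "min L (real N) \<le> (\<Sum>k<N. if real k \<le> L then 1 else 0)"
proof (induction N)
  case (Suc N)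
  then show ?case by (cases "real N \<le> L") auto
next
  case 0
  then show ?case by simp
qed

text \<open>The radius is at most 1, so its power \<open>DIM('a)\<close> is at most the radius
  itself, hence at most \<open>exp (- s - k)\<close>; and \<open>exp (- 1) <= 1/2\<close>.\<close>

lemma content_cball_le:
  fixes x :: "'a::euclidean_space"
  assumes "0 < d" "d \<le> 1" "s \<ge> 0"
  shows "exp s * measure lborel (cball x (d * exp (- s - real k))) \<le> unit_ball_vol DIM('a) * (1/2) ^ k"
proof -
  let ?r = "d * exp (- s - real k)"
  have "d * exp (- s - real k) \<le> 1 * exp (- s - real k)" using assms by (intro mult_right_mono) auto
  moreover from this have "?r \<le> 1" using order_trans[of ?r "exp (- s - real k)" 1] assms(3) by simp
  ultimately have r: "0 \<le> ?r" "?r \<le> 1" "?r \<le> exp (- s - real k)" using assms(1) by auto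
  have "?r ^ DIM('a) \<le> ?r ^ 1" using r by (intro power_decreasing) auto
  then have "?r ^ DIM('a) \<le> exp (- s - real k)"
    unfolding power_one_right using r(3) by (rule order_trans)
  then have "exp s * ?r ^ DIM('a) \<le> exp s * exp (- s - real k)" by (intro mult_left_mono) auto
  also have "\<dots> = exp (- real k)" by (simp add: exp_add[symmetric])
  also have "\<dots> = exp (- 1) ^ k" by (simp add: exp_of_nat_mult[symmetric])
  also have "\<dots> \<le> (1/2) ^ k"
  proof (rule power_mono)
    have "2 \<le> exp (1::real)" using exp_ge_add_one_self[of 1] by simp
    then show "exp (- 1::real) \<le> 1/2" by (simp add: exp_minus field_simps)
  qed simp
  finally have "exp s * ?r ^ DIM('a) \<le> (1/2) ^ k" .
  then have "unit_ball_vol DIM('a) * (exp s * ?r ^ DIM('a)) \<le> unit_ball_vol DIM('a) * (1/2) ^ k"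
    by (intro mult_left_mono) auto
  then show ?thesis using r(1) by (simp add: content_cball mult_ac)
qed

text \<open>Splitting the logarithm at the level \<^term>\<open>s\<close> trades the bound \<^term>\<open>f \<le> exp s\<close> against
  the mass of \<^term>\<open>f\<close>; above that level \<^term>\<open>ln (d / r)\<close> is summed over dyadic-type balls.\<close>

lemma log_potential_bound:
  fixes x :: "'a::euclidean_space"
  assumes d: "0 < d" "d \<le> 1" and s: "s \<ge> 0"
    and f: "continuous_on (cball x d) f" "\<And>y. y \<in> cball x d \<Longrightarrow> 0 \<le> f y \<and> f y \<le> exp s"
    and mass: "(\<integral>y. indicator (cball x d) y * f y \<partial>lborel) \<le> \<mu>"
    and h: "continuous_on UNIV h" "\<And>y. y \<notin> cball x d \<Longrightarrow> h y = 0" "\<And>y. h y \<le> real N"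
      "\<And>y. y \<noteq> x \<Longrightarrow> y \<in> cball x d \<Longrightarrow> h y \<le> ln (d / norm (y - x))"
  shows "(\<integral>y. f y * h y \<partial>lborel) \<le> s * \<mu> + 2 * unit_ball_vol DIM('a)"
proof -
  let ?B = "\<lambda>k. cball x (d * exp (- s - real k))"
  let ?g = "\<lambda>y. s * (indicator (cball x d) y * f y) + exp s * (\<Sum>k<N. indicator (?B k) y)"
  have i1: "integrable lborel (\<lambda>y. indicator (cball x d) y * f y)"
    by (rule integrable_indicator_continuous[OF compact_cball _ f(1)]) simp
  have i2: "integrable lborel (\<lambda>y. indicat_real (?B k) y)" for k
    using emeasure_compact_finite[of "?B k"] by (simp add: integrable_indicator_iff)
  have sub: "?B k \<subseteq> cball x d" for k
  proof -
    have "d * exp (- s - real k) \<le> d * 1" using d s by (intro mult_left_mono) auto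
    then show ?thesis by auto
  qed
  have i3: "integrable lborel (\<lambda>y. f y * h y)"
  proof -
    have "integrable lborel (\<lambda>y. indicator (cball x d) y * (f y * h y))"
      by (rule integrable_indicator_continuous[OF compact_cball order_refl])
         (intro continuous_intros f(1) continuous_on_subset[OF h(1)], auto)
    also have "(\<lambda>y. indicator (cball x d) y * (f y * h y)) = (\<lambda>y. f y * h y)"
      using h(2) by (force simp: indicator_def fun_eq_iff)
    finally show ?thesis .
  qed
  have "(\<integral>y. f y * h y \<partial>lborel) \<le> (\<integral>y. ?g y \<partial>lborel)"
  proof (rule integral_mono[OF i3])
    show "integrable lborel ?g" using i1 i2 by auto
    fix y
    show "f y * h y \<le> ?g y"
    proof (cases "y \<in> cball x d")
      case False
      then have "y \<notin> ?B k" for k using sub[of k] by blast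
      then show ?thesis using h(2)[OF False] False by simp
    next
      case True
      have fy: "0 \<le> f y" "f y \<le> exp s" using f(2)[OF True] by auto
      have "h y \<le> s + (\<Sum>k<N. indicator (?B k) y)"
      proof (cases "y = x")
        case True
        then have "(\<Sum>k<N. indicat_real (?B k) y) = real N" using d by (simp add: less_imp_le)
        then show ?thesis using h(3)[of y] s by linarith
      next
        case False
        let ?r = "norm (y - x)"
        let ?L = "ln (d / ?r) - s"
        have r: "?r > 0" using False by simp
        have "h y \<le> s + min ?L (real N)"
          using h(3)[of y] h(4)[OF False True] s by (auto simp: min_def)
        also have "min ?L (real N) \<le> (\<Sum>k<N. if real k \<le> ?L then 1 else 0)" by (rule min_le_count)
        also have "\<dots> = (\<Sum>k<N. indicator (?B k) y)"
        proof (rule sum.cong[OF refl])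
          fix k
          have "real k \<le> ?L \<longleftrightarrow> s + real k \<le> ln (d / ?r)" by linarith
          also have "\<dots> \<longleftrightarrow> exp (s + real k) \<le> d / ?r"
            using r d by (subst ln_ge_iff) auto
          also have "\<dots> \<longleftrightarrow> ?r \<le> d / exp (s + real k)"
            using r by (simp add: field_simps)
          also have "d / exp (s + real k) = d * exp (- s - real k)"
            by (simp add: exp_diff exp_minus exp_add field_simps)
          finally show "(if real k \<le> ?L then 1 else 0) = indicat_real (?B k) y"
            by (auto simp: indicator_def dist_norm norm_minus_commute)
        qed
        finally show ?thesis by simp
      qed
      then have "f y * h y \<le> f y * (s + (\<Sum>k<N. indicator (?B k) y))"
        using fy by (intro mult_left_mono) auto
      also have "\<dots> \<le> s * f y + exp s * (\<Sum>k<N. indicator (?B k) y)"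
        unfolding distrib_left using fy by (intro add_mono mult_right_mono sum_nonneg) auto
      finally show ?thesis using True by simp
    qed
  qed
  also have "\<dots> = s * (\<integral>y. indicator (cball x d) y * f y \<partial>lborel) + (\<Sum>k<N. exp s * measure lborel (?B k))"
  proof -
    have i4: "integrable lborel (\<lambda>y. \<Sum>k<N. indicat_real (?B k) y)"
      by (rule Bochner_Integration.integrable_sum) (rule i2)
    have "(\<integral>y. (\<Sum>k<N. indicat_real (?B k) y) \<partial>lborel) = (\<Sum>k<N. measure lborel (?B k))"
      by (subst Bochner_Integration.integral_sum[OF i2]) simp
    then show ?thesis
      using i1 i4 by (subst Bochner_Integration.integral_add) (simp_all only: integrable_mult_right integral_mult_right_zero sum_distrib_left[symmetric])
  qed
  also have "\<dots> \<le> s * \<mu> + (\<Sum>k<N. unit_ball_vol DIM('a) * (1/2) ^ k)"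
    by (intro add_mono mult_left_mono sum_mono content_cball_le mass d s)
  also have "(\<Sum>k<N. unit_ball_vol DIM('a) * (1/2) ^ k) \<le> unit_ball_vol DIM('a) * 2"
  proof -
    have "(\<Sum>k<N. (1/2::real) ^ k) = 2 - 2 * (1/2) ^ N" by (induction N) simp_all
    then have "(\<Sum>k<N. (1/2::real) ^ k) \<le> 2" by simp
    then show ?thesis unfolding sum_distrib_left[symmetric] by (intro mult_left_mono) auto
  qed
  finally show ?thesis by simp
qed

text \<open>Green's identity with a truncated logarithm \<open>H\<close>. Its \<open>m\<close>-th
  Laplacian is \<open>- ?T\<close> plus a cutoff error of size \<open>d^(-2m)\<close>, where
  \<open>?T\<close> has mass \<open>c0\<close> and lives in \<open>|y - x| <= \<sigma>\<close>, so
  that it nearly reproduces \<open>c0 * w x\<close>. The scale \<open>\<sigma>\<close> is chosen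
  after \<open>w\<close> and \<open>x\<close>, and \<open>C\<close> does not depend on it.\<close>

lemma local_estimate:
  assumes m: "m \<ge> 2" "CARD('n) = 2 * m"
  obtains C where "C > 0"
    "\<And>S w (x :: real^'n) d s \<mu>. open S \<Longrightarrow> C_k_on (2 * m) S w \<Longrightarrow> cball x d \<subseteq> S \<Longrightarrow> 0 < d \<Longrightarrow> d \<le> 1 \<Longrightarrow> 0 \<le> s \<Longrightarrow>
      (\<And>y. y \<in> cball x d \<Longrightarrow> 0 \<le> w y) \<Longrightarrow>
      (\<And>y. y \<in> cball x d \<Longrightarrow> 0 \<le> - iter_laplacian m w y \<and> - iter_laplacian m w y \<le> exp s) \<Longrightarrow>
      (\<integral>y. indicator (cball x d) y * - iter_laplacian m w y \<partial>lborel) \<le> \<mu> \<Longrightarrow>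
      w x \<le> C * ((\<integral>y. indicator (cball x d) y * w y \<partial>lborel) / d ^ (2 * m) + s * \<mu> + 1)"
proof -
  let ?L = "rlap (2 * m) ^^ m"
  obtain E where E: "log_kernel m E" using log_kernel_exists by blast
  have EC: "Ck (2 * m) E" "mono E" and E0: "\<And>r. r < 3/5 \<Longrightarrow> E r = E 0" and Eln: "\<And>r. r \<ge> 1 \<Longrightarrow> E r = ln r"
    and Ege: "\<And>r. r > 0 \<Longrightarrow> ln r \<le> E r" "\<And>r. - 1 \<le> E r"
    using E unfolding log_kernel_def by blast+
  have radE: "rad (2 * m) E" by (rule log_kernel_rad[OF E])
  obtain c0 where c0: "c0 \<noteq> 0"
    "\<And>(x :: real^'n) \<sigma>. \<sigma> > 0 \<Longrightarrow> (\<integral>y. ?L (\<lambda>r. E (r / \<sigma>)) (norm (y - x)) \<partial>lborel) = c0"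
    by (rule log_kernel_mass[OF m E]) blast
  \<comment> \<open>\<open>Ck_bounded\<close> asks for vanishing on the negative axis; there the
    profiles are constant, and at least one Laplacian is applied.\<close>
  have Lneg: "?L G r = 0" if "r < 0" "\<And>r. r < 0 \<Longrightarrow> G r = c" "rad (2 * m) G" for G r and c :: real
  proof -
    have "?L G r = ?L (\<lambda>_. c) r"
      by (rule rlap_funpow_cong[of "{..<0}"]) (use that in auto)
    also have "\<dots> = 0"
    proof -
      obtain k where k: "m = Suc k" using m by (cases m) auto
      have "rlap (2 * m) (\<lambda>_. c) = (\<lambda>_. 0)" by (simp add: rlap_def[abs_def])
      then show ?thesis by (simp add: k funpow_Suc_right rlap_funpow_zero del: funpow.simps)
    qed
    finally show ?thesis .
  qed
  have cL: "Ck 0 (?L G)" if "rad (2 * m) G" for G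
    using rad_Ck[OF rad_rlap_funpow[of m 0 G "2 * m"], of 0] that by simp
  have LE0: "?L E r = 0" if "r > 1" for r
    using rlap_funpow_log_eq_0[OF m(1) _ that] Eln by simp
  have Eneg: "E r = E 0" if "r < 0" for r by (rule E0) (use that in simp)
  obtain B where B: "B > 0" "\<And>r. \<bar>?L E r\<bar> \<le> B"
    using Ck_bounded[OF cL[OF radE] Lneg[OF _ Eneg radE] LE0] by blast
  obtain \<zeta> :: "real \<Rightarrow> real" where \<zeta>: "Ck (Suc (2 * m)) \<zeta>" "\<And>r. r \<le> 3/5 \<Longrightarrow> \<zeta> r = 1" "\<And>r. r \<ge> 1 \<Longrightarrow> \<zeta> r = 0"
    "\<And>r. 0 \<le> \<zeta> r" "\<And>r. \<zeta> r \<le> 1"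
    using cutoff_exists[of "2 * m"] by metis
  have c\<zeta>: "Ck (2 * m) \<zeta>" using \<zeta>(1) Ck_Suc_D by blast
  \<comment> \<open>The cutoff region at unit scale: for \<open>r > d/2\<close>,
    \<open>H r = F (r / d)\<close>, because
    \<open>ln (d / \<sigma>) - ln (r / \<sigma>) = ln 2 - ln (2 r / d)\<close>. This eliminates
    \<open>\<sigma>\<close> and makes \<open>B'\<close> uniform; \<open>E (2 * r)\<close> replaces
    the logarithm to keep \<open>F\<close> regular at 0.\<close>
  define F where "F r = \<zeta> r * (ln 2 - E (2 * r))" for r
  have radF: "rad (2 * m) F"
  proof (rule radI[where a = "3/10"])
    show "Ck (2 * m) F" unfolding F_def
      using Ck_affine[OF EC(1), of 2 0] by (intro Ck_mult Ck_diff c\<zeta>) auto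
    show "F r = ln 2 - E 0" if "r < 3/10" for r
      using that \<zeta>(2)[of r] E0[of "2 * r"] by (simp add: F_def)
  qed simp
  have LF0: "?L F r = 0" if "r > 1" for r
  proof -
    have "?L F r = ?L (\<lambda>_. 0) r"
      by (rule rlap_funpow_cong[of "{1<..}"]) (use that \<zeta>(3) in \<open>auto simp: F_def\<close>)
    then show ?thesis by (simp add: rlap_funpow_zero)
  qed
  have F0: "F r = ln 2 - E 0" if "r < 0" for r
    using that \<zeta>(2)[of r] E0[of "2 * r"] by (simp add: F_def)
  obtain B' where B': "B' > 0" "\<And>r. \<bar>?L F r\<bar> \<le> B'"
    using Ck_bounded[OF cL[OF radF] Lneg[OF _ F0 radF] LF0] by blast
  define V where "V = unit_ball_vol (real (2 * m))"
  have V: "V > 0" unfolding V_def by simp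
  \<comment> \<open>One number dominating the coefficients \<open>B'\<close>, 1 and
    \<open>1 + 2 * V\<close> of the three terms of the final estimate.\<close>
  define C where "C = (B' + 2 + 2 * V) / \<bar>c0\<bar>"
  show ?thesis
  proof (rule that[of C])
    show "C > 0" using B' V c0(1) by (simp add: C_def add_pos_pos)
    fix S w and x :: "real^'n" and d s \<mu>
    assume S: "open S" "C_k_on (2 * m) S w" "cball x d \<subseteq> S" and d: "0 < d" "d \<le> 1" and s: "0 \<le> s"
      and w0: "\<And>y. y \<in> cball x d \<Longrightarrow> 0 \<le> w y"
      and f0: "\<And>y. y \<in> cball x d \<Longrightarrow> 0 \<le> - iter_laplacian m w y \<and> - iter_laplacian m w y \<le> exp s"
      and mu: "(\<integral>y. indicator (cball x d) y * - iter_laplacian m w y \<partial>lborel) \<le> \<mu>"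
    have cw: "continuous_on S w" by (rule C_k_on_continuous[OF S(2)])
    have cf: "continuous_on S (\<lambda>y. - iter_laplacian m w y)"
      using C_k_on_iter_laplacian[OF S(1), of m 0 w] S(2) by (auto intro!: continuous_intros)
    \<comment> \<open>Replacing \<open>w y\<close> by \<open>w x\<close> against \<open>?T\<close>
      then costs at most \<open>\<eta> B \<sigma>^(-2m)\<close> times the volume
      \<open>V \<sigma>^(2m)\<close>, which is 1.\<close>
    define \<eta> where "\<eta> = 1 / (B * V)"
    have \<eta>: "\<eta> > 0" using B V by (simp add: \<eta>_def)
    have "x \<in> S" using S(3) d by auto
    then have "isCont w x" using cw S(1) by (simp add: continuous_on_eq_continuous_at)
    then obtain \<delta> where \<delta>: "\<delta> > 0" "\<And>y. dist y x < \<delta> \<Longrightarrow> dist (w y) (w x) < \<eta>"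
      using \<eta> unfolding continuous_at_eps_delta by blast
    \<comment> \<open>\<open>d / 3\<close> makes \<open>E (r / \<sigma>)\<close> an exact logarithm
      for \<open>r > d/2\<close>, where the cutoff may act; \<open>\<delta> / 2\<close> keeps the
      support of \<open>?T\<close> within the range of continuity.\<close>
    define \<sigma> where "\<sigma> = min (d / 3) (\<delta> / 2)"
    have \<sigma>: "\<sigma> > 0" "\<sigma> < d / 2" "\<sigma> < \<delta>" using d \<delta>(1) by (auto simp: \<sigma>_def min_def)
    define H where "H r = \<zeta> (r / d) * (ln (d / \<sigma>) - E (r / \<sigma>))" for r
    have radEs: "rad (2 * m) (\<lambda>r. E (r / \<sigma>))" by (rule rad_scale[OF radE \<sigma>(1)])
    have radH: "rad (2 * m) H"
    proof (rule radI[where a = "3/5 * \<sigma>"])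
      show "Ck (2 * m) H" unfolding H_def
        using Ck_affine[OF EC(1), of "1 / \<sigma>" 0] Ck_affine[OF c\<zeta>, of "1 / d" 0] by (intro Ck_mult Ck_diff) auto
      show "H r = ln (d / \<sigma>) - E 0" if "r < 3/5 * \<sigma>" for r
      proof -
        have "r / \<sigma> < 3/5" "r / d \<le> 3/5" using that \<sigma> d by (auto simp: field_simps)
        then show ?thesis using \<zeta>(2)[of "r / d"] E0[of "r / \<sigma>"] by (simp add: H_def)
      qed
    qed (use \<sigma> in simp)
    have H0: "H r = 0" if "r \<ge> d" for r using that d \<zeta>(3)[of "r / d"] by (simp add: H_def)
    let ?T = "\<lambda>r. inverse (\<sigma> ^ (2 * m)) * ?L E (r / \<sigma>)"
    have T: "?L (\<lambda>r. E (r / \<sigma>)) = ?T" using rlap_funpow_scale[OF radE] \<sigma> by simp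
    have T0: "?T r = 0" if "r > \<sigma>" for r using LE0[of "r / \<sigma>"] that \<sigma> by simp
    have LH0: "?L H r = 0" if "r > d" for r
    proof -
      have "?L H r = ?L (\<lambda>_. 0) r"
        by (rule rlap_funpow_cong[of "{d<..}"]) (use that H0 in auto)
      then show ?thesis by (simp add: rlap_funpow_zero)
    qed
    \<comment> \<open>Below \<open>3/5 * d\<close> the cutoff is 1 and the sum is exactly 0; beyond
      \<open>d/2\<close> the term \<open>?T\<close> is 0 and \<open>H\<close> is a rescaled
      \<open>F\<close>.\<close>
    have LH: "\<bar>?L H r + ?T r\<bar> \<le> B' / d ^ (2 * m)" for r
    proof (cases "r < 3/5 * d")
      case True
      have "?L H r = ?L (\<lambda>r. ln (d / \<sigma>) - E (r / \<sigma>)) r"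
      proof (rule rlap_funpow_cong[of "{..<3/5 * d}"])
        show "H y = ln (d / \<sigma>) - E (y / \<sigma>)" if "y \<in> {..<3/5 * d}" for y
          using that d \<zeta>(2)[of "y / d"] by (simp add: H_def field_simps)
      qed (use True in auto)
      also have "\<dots> = ?L (\<lambda>_. ln (d / \<sigma>)) r - ?T r"
        using rlap_funpow_diff[OF rad_const radEs, of "2 * m" "ln (d / \<sigma>)"] T by simp
      also have "?L (\<lambda>_. ln (d / \<sigma>)) r = 0"
      proof -
        obtain k where k: "m = Suc k" using m by (cases m) auto
        have "rlap (2 * m) (\<lambda>_. ln (d / \<sigma>)) = (\<lambda>_. 0)" by (simp add: rlap_def[abs_def])
        then show ?thesis by (simp add: k funpow_Suc_right rlap_funpow_zero del: funpow.simps)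
      qed
      finally show ?thesis using B' d by simp
    next
      case False
      then have r: "r > d / 2" using d by simp
      have "?L H r = ?L (\<lambda>r. F (r / d)) r"
      proof (rule rlap_funpow_cong[of "{d / 2<..}"])
        show "H y = F (y / d)" if "y \<in> {d / 2<..}" for y
        proof -
          have y: "y > d / 2" "y > 0" using that d by auto
          have "E (2 * (y / d)) = ln (2 * (y / d))" "E (y / \<sigma>) = ln (y / \<sigma>)"
            using y \<sigma> d by (auto intro!: Eln simp: field_simps)
          moreover have "ln (2 * (y / d)) = ln 2 + (ln y - ln d)" "ln (y / \<sigma>) = ln y - ln \<sigma>" "ln (d / \<sigma>) = ln d - ln \<sigma>"
            using y d \<sigma> by (simp_all add: ln_mult ln_div)
          ultimately show ?thesis by (simp add: H_def F_def)
        qed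
      qed (use r in auto)
      also have "\<dots> = inverse (d ^ (2 * m)) * ?L F (r / d)"
        using rlap_funpow_scale[OF radF, of d "2 * m"] d by simp
      finally have "?L H r + ?T r = inverse (d ^ (2 * m)) * ?L F (r / d)"
        using T0[of r] r \<sigma> by simp
      also have "\<bar>\<dots>\<bar> \<le> inverse (d ^ (2 * m)) * B'"
        using B'(2)[of "r / d"] d by (simp add: abs_mult mult_left_mono)
      finally show ?thesis by (simp add: divide_inverse mult.commute)
    qed
    let ?K = "cball x d"
    have nK: "norm (y - x) > d" if "y \<notin> ?K" for y using that by (simp add: dist_norm norm_minus_commute)
    have supp: "eventually (\<lambda>r. H r = 0) (nhds (norm (y - x)))" if "y \<notin> ?K" for y
    proof -
      have "eventually (\<lambda>r. r \<in> {d<..}) (nhds (norm (y - x)))"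
        using nK[OF that] by (intro eventually_nhds_in_open) auto
      then show ?thesis by eventually_elim (use H0 in auto)
    qed
    have gr: "(\<integral>y. w y * ?L H (norm (y - x)) \<partial>lborel) = (\<integral>y. iter_laplacian m w y * H (norm (y - x)) \<partial>lborel)"
      using green_radial_iter[OF S(1,2) compact_cball S(3) radH supp] m(2) by simp
    have cLH: "continuous_on UNIV (\<lambda>y. ?L H (norm (y - x)))" by (rule continuous_on_radial[OF cL[OF radH]])
    have cT: "continuous_on UNIV (\<lambda>y. ?T (norm (y - x)))"
      using continuous_on_radial[OF cL[OF radEs]] unfolding T .
    have cH: "continuous_on UNIV (\<lambda>y. H (norm (y - x)))"
      using continuous_on_radial[OF rad_Ck[OF radH order_refl]] .
    have T0K: "?T (norm (y - x)) = 0" if "y \<notin> ?K" for y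
      by (rule T0) (use nK[OF that] \<sigma> d in linarith)
    have i1: "integrable lborel (\<lambda>y. w y * ?L H (norm (y - x)))"
      by (rule integrable_continuous_compact_support[OF compact_cball S(3)])
         (intro continuous_intros cw continuous_on_subset[OF cLH], auto simp: LH0 nK)
    have i2: "integrable lborel (\<lambda>y. w y * ?T (norm (y - x)))"
      by (rule integrable_continuous_compact_support[OF compact_cball S(3)])
         (intro continuous_on_mult cw continuous_on_subset[OF cT], use T0K in auto)
    have i3: "integrable lborel (\<lambda>y. ?T (norm (y - x)))"
      by (rule integrable_continuous_compact_support[OF compact_cball _ cT]) (use T0K in auto)
    have i4: "integrable lborel (\<lambda>y. indicator ?K y * w y)"
      by (rule integrable_indicator_continuous[OF compact_cball S(3) cw])
    define I where "I = (\<integral>y. indicator ?K y * w y \<partial>lborel)"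
    have 1: "\<bar>\<integral>y. w y * ?L H (norm (y - x)) + w y * ?T (norm (y - x)) \<partial>lborel\<bar> \<le> B' / d ^ (2 * m) * I"
    proof -
      have "\<bar>\<integral>y. w y * ?L H (norm (y - x)) + w y * ?T (norm (y - x)) \<partial>lborel\<bar>
         \<le> (\<integral>y. \<bar>w y * ?L H (norm (y - x)) + w y * ?T (norm (y - x))\<bar> \<partial>lborel)"
        using integral_norm_bound[of lborel "\<lambda>y. w y * ?L H (norm (y - x)) + w y * ?T (norm (y - x))"] by simp
      also have "\<dots> \<le> (\<integral>y. B' / d ^ (2 * m) * (indicator ?K y * w y) \<partial>lborel)"
      proof (rule integral_mono)
        show "integrable lborel (\<lambda>y. \<bar>w y * ?L H (norm (y - x)) + w y * ?T (norm (y - x))\<bar>)"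
          using i1 i2 by (intro integrable_abs Bochner_Integration.integrable_add)
        show "integrable lborel (\<lambda>y. B' / d ^ (2 * m) * (indicator ?K y * w y))"
          using i4 by (rule integrable_mult_right)
        fix y
        show "\<bar>w y * ?L H (norm (y - x)) + w y * ?T (norm (y - x))\<bar> \<le> B' / d ^ (2 * m) * (indicator ?K y * w y)"
        proof (cases "y \<in> ?K")
          case True
          have "\<bar>w y * ?L H (norm (y - x)) + w y * ?T (norm (y - x))\<bar> = w y * \<bar>?L H (norm (y - x)) + ?T (norm (y - x))\<bar>"
            using w0[OF True] by (simp only: distrib_left[symmetric] abs_mult abs_of_nonneg)
          also have "\<dots> \<le> w y * (B' / d ^ (2 * m))" using w0[OF True] LH by (intro mult_left_mono)
          finally show ?thesis using True by (simp add: mult.commute)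
        next
          case False
          then show ?thesis using T0K[OF False] LH0[OF nK[OF False]] by simp
        qed
      qed
      finally show ?thesis by (simp add: I_def)
    qed
    have 2: "\<bar>\<integral>y. w y * ?T (norm (y - x)) - w x * ?T (norm (y - x)) \<partial>lborel\<bar> \<le> 1"
    proof -
      let ?c = "\<eta> * (inverse (\<sigma> ^ (2 * m)) * B)"
      have "\<bar>\<integral>y. w y * ?T (norm (y - x)) - w x * ?T (norm (y - x)) \<partial>lborel\<bar>
         \<le> (\<integral>y. \<bar>w y * ?T (norm (y - x)) - w x * ?T (norm (y - x))\<bar> \<partial>lborel)"
        using integral_norm_bound[of lborel "\<lambda>y. w y * ?T (norm (y - x)) - w x * ?T (norm (y - x))"] by simp
      also have "\<dots> \<le> (\<integral>y. ?c * indicator (cball x \<sigma>) y \<partial>lborel)"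
      proof (rule integral_mono)
        show "integrable lborel (\<lambda>y. \<bar>w y * ?T (norm (y - x)) - w x * ?T (norm (y - x))\<bar>)"
          using i2 integrable_mult_right[OF i3] by (intro integrable_abs Bochner_Integration.integrable_diff)
        show "integrable lborel (\<lambda>y. ?c * indicator (cball x \<sigma>) y)"
          using emeasure_compact_finite[of "cball x \<sigma>"] by (intro integrable_mult_right) (simp add: integrable_indicator_iff)
        fix y
        show "\<bar>w y * ?T (norm (y - x)) - w x * ?T (norm (y - x))\<bar> \<le> ?c * indicator (cball x \<sigma>) y"
        proof (cases "y \<in> cball x \<sigma>")
          case True
          then have "dist y x < \<delta>" using \<sigma> by (simp add: dist_commute)
          then have "\<bar>w y - w x\<bar> \<le> \<eta>" using \<delta>(2)[of y] by (simp add: dist_real_def)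
          moreover have "\<bar>?T (norm (y - x))\<bar> \<le> inverse (\<sigma> ^ (2 * m)) * B"
            using B(2) \<sigma> by (simp add: abs_mult mult_left_mono)
          ultimately have "\<bar>w y - w x\<bar> * \<bar>?T (norm (y - x))\<bar> \<le> ?c"
            using \<eta> by (intro mult_mono) auto
          then show ?thesis using True by (simp only: left_diff_distrib[symmetric] abs_mult[symmetric] indicator_simps mult_1_right)
        next
          case False
          then have "?T (norm (y - x)) = 0" by (intro T0) (simp add: dist_norm norm_minus_commute)
          then show ?thesis using False by simp
        qed
      qed
      also have "\<dots> = ?c * (V * \<sigma> ^ (2 * m))"
        using \<sigma>(1) m(2) by (simp add: content_cball V_def)
      also have "\<dots> = 1" using \<sigma>(1) B V by (simp add: \<eta>_def field_simps)
      finally show ?thesis .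
    qed
    have 3: "(\<integral>y. - iter_laplacian m w y * H (norm (y - x)) \<partial>lborel) \<le> s * \<mu> + 2 * V"
    proof -
      \<comment> \<open>The 1 comes from \<open>- 1 <= E\<close>. \<open>N\<close> depends on
        \<open>\<sigma>\<close> but does not enter the conclusion of
        \<open>log_potential_bound\<close>.\<close>
      obtain N where N: "ln (d / \<sigma>) + 1 \<le> real N" using real_arch_simple by blast
      have hN: "H r \<le> real N" for r
      proof -
        have "H r \<le> \<zeta> (r / d) * real N"
          unfolding H_def using \<zeta>(4) Ege(2)[of "r / \<sigma>"] N by (intro mult_left_mono) auto
        also have "\<dots> \<le> 1 * real N" using \<zeta>(5) by (intro mult_right_mono) auto
        finally show ?thesis by simp
      qed
      have hL: "H r \<le> ln (d / r)" if "0 < r" "r \<le> d" for r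
      proof -
        have "H r \<le> \<zeta> (r / d) * ln (d / r)"
          unfolding H_def
        proof (rule mult_left_mono[OF _ \<zeta>(4)])
          have "ln (r / \<sigma>) \<le> E (r / \<sigma>)" using that \<sigma> by (intro Ege) auto
          then show "ln (d / \<sigma>) - E (r / \<sigma>) \<le> ln (d / r)"
            using that \<sigma> d by (simp add: ln_div)
        qed
        also have "\<dots> \<le> 1 * ln (d / r)"
          using that \<zeta>(5) by (intro mult_right_mono) auto
        finally show ?thesis by simp
      qed
      have "(\<integral>y. - iter_laplacian m w y * H (norm (y - x)) \<partial>lborel) \<le> s * \<mu> + 2 * unit_ball_vol DIM(real^'n)"
      proof (rule log_potential_bound[OF d s _ f0 mu cH])
        show "continuous_on (cball x d) (\<lambda>y. - iter_laplacian m w y)"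
          using cf S(3) by (rule continuous_on_subset)
        show "H (norm (y - x)) = 0" if "y \<notin> cball x d" for y using H0[of "norm (y - x)"] nK[OF that] by simp
        show "H (norm (y - x)) \<le> real N" for y by (rule hN)
        show "H (norm (y - x)) \<le> ln (d / norm (y - x))" if "y \<noteq> x" "y \<in> cball x d" for y
          using that by (intro hL) (auto simp: dist_norm norm_minus_commute)
      qed
      then show ?thesis by (simp add: V_def m(2))
    qed
    have H_nonneg: "0 \<le> H r" for r
    proof (cases "r < d")
      case True
      have "E (r / \<sigma>) \<le> E (d / \<sigma>)" using True \<sigma> by (intro monoD[OF EC(2)] divide_right_mono) auto
      also have "\<dots> = ln (d / \<sigma>)" using \<sigma> d by (intro Eln) (simp add: field_simps)
      finally show ?thesis using \<zeta>(4) by (simp add: H_def)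
    qed (use H0 in simp)
    have 4: "0 \<le> (\<integral>y. - iter_laplacian m w y * H (norm (y - x)) \<partial>lborel)"
    proof (rule Bochner_Integration.integral_nonneg)
      show "0 \<le> - iter_laplacian m w y * H (norm (y - x))" for y
      proof (cases "y \<in> ?K")
        case True
        then show ?thesis using f0 H_nonneg by (intro mult_nonneg_nonneg) auto
      next
        case False
        then show ?thesis using H0[of "norm (y - x)"] nK[OF False] by simp
      qed
    qed
    define J where "J = (\<integral>y. - iter_laplacian m w y * H (norm (y - x)) \<partial>lborel)"
    define Q where "Q = (\<integral>y. w y * ?T (norm (y - x)) \<partial>lborel)"
    have "(\<integral>y. w y * ?L H (norm (y - x)) + w y * ?T (norm (y - x)) \<partial>lborel) = - J + Q"
      using i1 i2 by (subst Bochner_Integration.integral_add) (auto simp: gr J_def Q_def)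
    then have q1: "\<bar>- J + Q\<bar> \<le> B' / d ^ (2 * m) * I" using 1 by simp
    have "(\<integral>y. w y * ?T (norm (y - x)) - w x * ?T (norm (y - x)) \<partial>lborel) = Q - w x * c0"
      using i2 i3 c0(2)[OF \<sigma>(1), of x] unfolding T
      by (subst Bochner_Integration.integral_diff) (auto simp: Q_def)
    then have q2: "\<bar>Q - w x * c0\<bar> \<le> 1" using 2 by simp
    have q3: "0 \<le> J" "J \<le> s * \<mu> + 2 * V" using 3 4 by (simp_all add: J_def)
    have "0 \<le> (\<integral>y. indicator ?K y * - iter_laplacian m w y \<partial>lborel)"
      using f0 by (intro integral_indicator_nonneg) blast
    then have mu0: "0 \<le> \<mu>" using mu by linarith
    have I0: "0 \<le> I" unfolding I_def using w0 by (rule integral_indicator_nonneg)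
    \<comment> \<open>\<open>w x * c0\<close> is within 1 of \<open>Q\<close>, and \<open>Q\<close>
      is within the cutoff error of \<open>J\<close>. As \<open>J\<close> is bounded on both sides,
      the absolute value can be estimated, whatever the sign of \<open>c0\<close>.\<close>
    have "\<bar>w x * c0\<bar> \<le> B' * (I / d ^ (2 * m)) + s * \<mu> + (1 + 2 * V)"
      using q1 q2 q3 by (simp add: abs_le_iff)
    also have "\<dots> \<le> (B' + 2 + 2 * V) * (I / d ^ (2 * m)) + (B' + 2 + 2 * V) * (s * \<mu>) + (B' + 2 + 2 * V) * 1"
    proof (intro add_mono mult_right_mono)
      have "1 * (s * \<mu>) \<le> (B' + 2 + 2 * V) * (s * \<mu>)"
        using B' V s mu0 by (intro mult_right_mono) auto
      then show "s * \<mu> \<le> (B' + 2 + 2 * V) * (s * \<mu>)" by simp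
    qed (use B' V I0 d in auto)
    also have "\<dots> = (C * \<bar>c0\<bar>) * (I / d ^ (2 * m) + s * \<mu> + 1)"
      using c0(1) by (simp add: C_def distrib_left)
    finally have "\<bar>c0\<bar> * w x \<le> \<bar>c0\<bar> * (C * (I / d ^ (2 * m) + s * \<mu> + 1))"
      using w0[of x] d by (simp add: abs_mult mult_ac)
    then show "w x \<le> C * ((\<integral>y. indicator ?K y * w y \<partial>lborel) / d ^ (2 * m) + s * \<mu> + 1)"
      using c0(1) by (simp add: I_def)
  qed
qed

section \<open>The singularity estimate\<close>

text \<open>Either \<open>2a <= U^(1-l)\<close> and the product is at most \<open>U / 2\<close>, or
  \<open>U\<close> is below \<open>(2a)^(1/(1-l))\<close> and inserting this gives the second term.
  It absorbs the sublinear power of \<open>U\<close> in the final inequality.\<close>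

lemma powr_absorb:
  fixes a U l :: real
  assumes "a > 0" "U > 0" "0 < l" "l < 1"
  shows "a * U powr l \<le> U / 2 + (2 * a) powr (1 / (1 - l))"
proof (cases "2 * a \<le> U powr (1 - l)")
  case True
  have "2 * a * U powr l \<le> U powr (1 - l) * U powr l"
    using True by (intro mult_right_mono) auto
  also have "\<dots> = U" using assms(2) by (simp add: powr_add[symmetric])
  finally show ?thesis using powr_ge_zero[of "2 * a" "1 / (1 - l)"] by linarith
next
  case False
  have "U = (U powr (1 - l)) powr (1 / (1 - l))" using assms by (simp add: powr_powr)
  also have "\<dots> \<le> (2 * a) powr (1 / (1 - l))" using False assms by (intro powr_mono2) auto
  finally have "U powr l \<le> ((2 * a) powr (1 / (1 - l))) powr l" using assms by (intro powr_mono2) auto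
  also have "\<dots> = (2 * a) powr (l / (1 - l))" by (simp add: powr_powr)
  finally have "a * U powr l \<le> (2 * a) * (2 * a) powr (l / (1 - l))"
    using assms by (intro mult_mono) auto
  also have "\<dots> = (2 * a) powr (1 + l / (1 - l))" using assms by (simp add: powr_add)
  also have "1 + l / (1 - l) = 1 / (1 - l)" using assms by (simp add: field_simps)
  finally show ?thesis using assms by simp
qed

text \<open>The integrals over annuli with inner radius \<open>2e\<close> are bounded, so some
  \<open>e0\<close> comes within \<open>\<epsilon>\<close> of their supremum. For \<open>x\<close>
  near 0 the ball lies inside \<open>|y| < 2 e0\<close>, disjoint from that annulus, so it carries
  at most the remainder.\<close>

lemma small_mass_near_zero:
  fixes F :: "'a::euclidean_space \<Rightarrow> real"
  assumes F: "continuous_on (ball 0 2 - {0}) F" "\<And>y. y \<in> ball 0 2 - {0} \<Longrightarrow> 0 \<le> F y"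
    and bd: "\<And>e. 0 < e \<Longrightarrow> e < 1/16 \<Longrightarrow> (\<integral>y. indicator (cball 0 (1/2) - ball 0 (2 * e)) y * F y \<partial>lborel) \<le> C"
    and "0 < \<epsilon>"
  obtains \<delta> where "0 < \<delta>" "\<And>x. x \<noteq> 0 \<Longrightarrow> norm x < \<delta> \<Longrightarrow> (\<integral>y. indicator (cball x (norm x / 2)) y * F y \<partial>lborel) \<le> \<epsilon>"
proof -
  let ?A = "\<lambda>e. cball (0::'a) (1/2) - ball 0 (2 * e)"
  define I where "I e = (\<integral>y. indicator (?A e) y * F y \<partial>lborel)" for e
  have bdd: "bdd_above (I ` {0<..<1/16})" using bd by (auto simp: I_def intro!: bdd_aboveI2)
  define M where "M = Sup (I ` {0<..<1/16})"
  have le: "I e \<le> M" if "0 < e" "e < 1/16" for e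
    unfolding M_def using that bdd by (intro cSup_upper) auto
  have "\<exists>z\<in>I ` {0<..<1/16}. M - \<epsilon> < z"
    unfolding M_def using assms(4) bdd by (intro less_cSupD) auto
  then obtain e0 where e0: "0 < e0" "e0 < 1/16" "M - \<epsilon> < I e0" by auto
  show ?thesis
  proof (rule that[of "min e0 (1/16)"])
    fix x :: 'a assume x: "x \<noteq> 0" "norm x < min e0 (1/16)"
    let ?B = "cball x (norm x / 2)"
    have nB: "norm x / 2 \<le> norm y" "norm y \<le> 3/2 * norm x" if "y \<in> ?B" for y
    proof -
      have "norm (x - y) \<le> norm x / 2" using that by (simp add: dist_norm)
      then show "norm x / 2 \<le> norm y" "norm y \<le> 3/2 * norm x"
        using norm_triangle_ineq2[of x y] norm_triangle_ineq2[of y x] by (simp_all add: norm_minus_commute)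
    qed
    have sub: "?B \<subseteq> ball 0 2 - {0}" "?A e \<subseteq> ball 0 2 - {0}" if "e > 0" for e
      using nB x that by fastforce+
    have i: "integrable lborel (\<lambda>y. indicator ?B y * F y)" "integrable lborel (\<lambda>y. indicator (?A e) y * F y)" if "e > 0" for e
      using integrable_indicator_continuous[OF compact_cball sub(1)[OF that] F(1)]
        integrable_indicator_continuous[OF compact_annulus sub(2)[OF that] F(1)] by auto
    \<comment> \<open>Inner radius \<open>2 * ?e = |x| / 2\<close>: this annulus contains both the
      ball and the annulus belonging to \<open>e0\<close>.\<close>
    let ?e = "norm x / 4"
    have e: "0 < ?e" "?e < 1/16" using x by auto
    have "(\<integral>y. indicator ?B y * F y \<partial>lborel) + I e0 = (\<integral>y. indicator ?B y * F y + indicator (?A e0) y * F y \<partial>lborel)"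
      unfolding I_def using i e0 by simp
    also have "\<dots> \<le> I ?e" unfolding I_def
    proof (rule integral_mono)
      fix y
      show "indicator ?B y * F y + indicator (?A e0) y * F y \<le> indicator (?A ?e) y * F y"
      proof (cases "y \<in> ?A ?e")
        case True
        then have "0 \<le> F y" using sub(2)[OF e(1)] F(2) by blast
        moreover have "\<not> (y \<in> ?B \<and> y \<in> ?A e0)"
          using nB(2)[of y] x e0(1) by auto
        ultimately show ?thesis using True by (auto simp: indicator_def)
      next
        case False
        have "y \<notin> ?B" using False nB[of y] x by auto
        moreover have "y \<notin> ?A e0" using False x e0(1) by auto
        ultimately show ?thesis using False by simp
      qed
      show "integrable lborel (\<lambda>y. indicator ?B y * F y + indicator (?A e0) y * F y)"
        by (rule Bochner_Integration.integrable_add[OF i[OF e0(1)]])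
      show "integrable lborel (\<lambda>y. indicator (?A ?e) y * F y)" by (rule i(2)[OF e(1)])
    qed
    also have "\<dots> \<le> M" by (rule le[OF e])
    finally show "(\<integral>y. indicator ?B y * F y \<partial>lborel) \<le> \<epsilon>" using e0(3) by linarith
  qed (use e0 in auto)
qed

text \<open>\<open>C\<close> is fixed before \<open>\<epsilon>\<close>, which turns the bounds into
  little-o. With \<open>K = |x|^(2-n)\<close> and \<open>W = |x|^(-\<alpha>)\<close>, smallness
  enters three times: the mass of \<open>f\<close> on the ball is at most
  \<open>\<epsilon> K\<close>, \<open>g\<close> is at most \<open>\<epsilon> W\<close>, and
  \<open>K <= \<epsilon> W\<close>.\<close>

lemma pointwise_bound:
  fixes u g :: "real^'n \<Rightarrow> real"
  assumes m: "m \<ge> 2" "CARD('n) = 2 * m" and lam: "0 < lam" "lam < 1"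
    and g0: "\<And>x. x \<in> ball 0 2 - {0} \<Longrightarrow> 0 \<le> g x"
    and go: "g \<in> o[at 0](\<lambda>x. norm x powr - ((2 * real m - 2) / (1 - lam)))"
    and u: "C_k_on (2 * m) (ball 0 2 - {0}) u" "\<And>x. x \<in> ball 0 2 - {0} \<Longrightarrow> 0 \<le> u x"
    and f: "\<And>x. x \<in> ball 0 2 - {0} \<Longrightarrow> 0 \<le> - iter_laplacian m u x \<and>
       - iter_laplacian m u x \<le> exp (u x powr lam + g x powr lam)"
  obtains C where "C > 0" "\<And>\<epsilon>. 0 < \<epsilon> \<Longrightarrow> \<epsilon> \<le> 1 \<Longrightarrow>
    eventually (\<lambda>x. u x \<le> C * \<epsilon> * norm x powr - ((2 * real m - 2) / (1 - lam))) (at 0)"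
proof -
  let ?S = "ball (0::real^'n) 2 - {0}"
  let ?n = "2 * m"
  define f where "f = (\<lambda>y. - iter_laplacian m u y)"
  define p where "p = 2 * real m - 2"
  define \<alpha> where "\<alpha> = p / (1 - lam)"
  have p: "p > 0" using m by (simp add: p_def)
  have \<alpha>: "\<alpha> > p" "\<alpha> > 0" using p lam by (simp_all add: \<alpha>_def field_simps)
  have S: "open ?S" by auto
  have cu: "continuous_on ?S u" by (rule C_k_on_continuous[OF u(1)])
  have cf: "continuous_on ?S f"
    using C_k_on_iter_laplacian[OF S, of m 0 u] u(1) unfolding f_def by (auto intro!: continuous_intros)
  have f0: "0 \<le> f y" "f y \<le> exp (u y powr lam + g y powr lam)" if "y \<in> ?S" for y
    using f[OF that] by (simp_all add: f_def)
  have fneg: "iter_laplacian m u y \<le> 0" if "y \<in> ?S" for y using f[OF that] by simp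
  obtain C1 where C1: "C1 > 0"
    "\<And>e. 0 < e \<Longrightarrow> e < 1/16 \<Longrightarrow> (\<integral>y. indicator (cball 0 (8 * e) - ball 0 (2 * e)) y * u y \<partial>lborel) \<le> C1 * e\<^sup>2"
    "\<And>e. 0 < e \<Longrightarrow> e < 1/16 \<Longrightarrow>
      (\<integral>y. indicator (cball 0 (1/2) - ball 0 (2 * e)) y * (norm y ^ (2 * m - 2) * - iter_laplacian m u y) \<partial>lborel) \<le> C1"

  proof (rule annulus_bounds[OF m u(1)], goal_cases)
    case (1 x)
    from 1(2) show ?case by (rule u(2))
  next
    case (2 x)
    from 2(2) show ?case by (rule fneg)
  next
    case 3
    from 3(2-) show ?case by (rule 3(1))
  qed
  obtain C2 where C2: "C2 > 0"
    "\<And>S w (x :: real^'n) d s \<mu>. open S \<Longrightarrow> C_k_on (2 * m) S w \<Longrightarrow> cball x d \<subseteq> S \<Longrightarrow> 0 < d \<Longrightarrow> d \<le> 1 \<Longrightarrow> 0 \<le> s \<Longrightarrow>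
      (\<And>y. y \<in> cball x d \<Longrightarrow> 0 \<le> w y) \<Longrightarrow>
      (\<And>y. y \<in> cball x d \<Longrightarrow> 0 \<le> - iter_laplacian m w y \<and> - iter_laplacian m w y \<le> exp s) \<Longrightarrow>
      (\<integral>y. indicator (cball x d) y * - iter_laplacian m w y \<partial>lborel) \<le> \<mu> \<Longrightarrow>
      w x \<le> C2 * ((\<integral>y. indicator (cball x d) y * w y \<partial>lborel) / d ^ (2 * m) + s * \<mu> + 1)"
  proof (rule local_estimate[OF m], goal_cases)
    case 1
    from 1(2-) show ?case by (rule 1(1))
  qed
  \<comment> \<open>\<open>G\<close> accounts for points of the ball whose norm is only
    \<open>|x| / 2\<close>; \<open>C4\<close> is what \<open>powr_absorb\<close> leaves once the
    power of \<open>\<epsilon> * K\<close> is factored out.\<close>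
  define G where "G = ((1/2) powr - \<alpha>) powr lam"
  define C4 where "C4 = (2 * (C2 * (2 ^ ?n) powr lam)) powr (1 / (1 - lam))"
  define C5 where "C5 = 2 * 2 ^ ?n * (C2 * C1 * 2 ^ ?n + C4 + C2 * G + C2)"
  have C5: "C5 > 0" unfolding C5_def C4_def G_def using C1(1) C2(1)
    by (intro mult_pos_pos add_nonneg_pos add_nonneg_nonneg) auto
  show ?thesis
  proof (rule that[OF C5])
    fix \<epsilon> :: real assume \<epsilon>: "0 < \<epsilon>" "\<epsilon> \<le> 1"
    have ev1: "eventually (\<lambda>x. norm (g x) \<le> \<epsilon> * norm (norm x powr - \<alpha>)) (at 0)"
      using landau_o.smallD[OF go \<epsilon>(1)] by (simp add: \<alpha>_def p_def)
    then obtain \<delta>1 where \<delta>1: "\<delta>1 > 0" "\<And>x. x \<noteq> 0 \<Longrightarrow> norm x < \<delta>1 \<Longrightarrow> g x \<le> \<epsilon> * norm x powr - \<alpha>"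
      unfolding eventually_at by (auto simp: abs_le_iff)
    \<comment> \<open>The factor \<open>(1/2)^(2m-2)\<close> compensates for
      \<open>|y| >= |x| / 2\<close> when the weight is removed, leaving exactly
      \<open>\<epsilon> * K\<close> as bound for the mass.\<close>
    obtain \<delta>2 where \<delta>2: "\<delta>2 > 0" "\<And>x. x \<noteq> 0 \<Longrightarrow> norm x < \<delta>2 \<Longrightarrow>
        (\<integral>y. indicator (cball x (norm x / 2)) y * (norm y ^ (2 * m - 2) * f y) \<partial>lborel) \<le> \<epsilon> * (1/2) ^ (2 * m - 2)"
    proof (rule small_mass_near_zero[of "\<lambda>y::real^'n. norm y ^ (2 * m - 2) * f y" C1 "\<epsilon> * (1/2) ^ (2 * m - 2)"])
      show "continuous_on ?S (\<lambda>y. norm y ^ (2 * m - 2) * f y)" by (intro continuous_intros cf)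
      show "0 \<le> norm y ^ (2 * m - 2) * f y" if "y \<in> ?S" for y using f0(1)[OF that] by simp
    qed (use C1(3) \<epsilon> in \<open>auto simp: f_def\<close>)
    have tn: "filterlim norm (at_right 0) (at (0::real^'n))"
      unfolding filterlim_at using tendsto_norm_zero[OF tendsto_ident_at[of 0 "UNIV :: (real^'n) set"]]
      by (auto simp: eventually_at_filter)
    have ev2: "eventually (\<lambda>x::real^'n. norm x powr - p \<le> \<epsilon> * norm x powr - \<alpha>) (at 0)"
    proof -
      have "((\<lambda>r::real. r powr (\<alpha> - p)) \<longlongrightarrow> 0) (at_right 0)"
      proof (rule tendsto_zero_powrI[OF tendsto_ident_at tendsto_const])
        show "eventually (\<lambda>r::real. 0 \<le> r) (at_right 0)" by (simp add: eventually_at_filter)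
      qed (use \<alpha> in simp)
      then have "eventually (\<lambda>r::real. r powr (\<alpha> - p) < \<epsilon>) (at_right 0)"
        using \<epsilon>(1) by (rule order_tendstoD)
      then have "eventually (\<lambda>x::real^'n. norm x powr (\<alpha> - p) < \<epsilon>) (at 0)"
        using tn unfolding filterlim_iff by blast
      then show ?thesis
      proof eventually_elim
        case (elim x)
        have "norm x powr - p = norm x powr (\<alpha> - p) * norm x powr - \<alpha>" by (simp add: powr_add[symmetric])
        then show ?case using elim by (simp add: mult_right_mono)
      qed
    qed
    have ev3: "eventually (\<lambda>x::real^'n. x \<noteq> 0 \<and> norm x < min (1/32) (min (\<delta>1 / 2) \<delta>2)) (at 0)"
      unfolding eventually_at using \<delta>1(1) \<delta>2(1) by (intro exI[of _ "min (1/32) (min (\<delta>1 / 2) \<delta>2)"]) auto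
    show "eventually (\<lambda>x. u x \<le> C5 * \<epsilon> * norm x powr - ((2 * real m - 2) / (1 - lam))) (at 0)"
      unfolding p_def[symmetric] \<alpha>_def[symmetric] using ev2 ev3
    proof eventually_elim
      case (elim x)
      define \<rho> where "\<rho> = norm x"
      define K where "K = \<rho> powr - p"
      define W where "W = \<rho> powr - \<alpha>"
      define r where "r = \<rho> / 2"
      have x: "x \<noteq> 0" "\<rho> > 0" "\<rho> < 1/32" "\<rho> < \<delta>1 / 2" "\<rho> < \<delta>2" using elim by (auto simp: \<rho>_def)
      have KW: "K \<le> \<epsilon> * W" using elim by (simp add: K_def W_def \<rho>_def)
      have K1: "K \<ge> 1"
        unfolding K_def using x p by (simp add: powr_minus field_simps powr_le1)
      have W0: "W > 0" using x by (simp add: W_def)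
      have Keq: "K = inverse (\<rho> ^ (2 * m - 2))"
      proof -
        have "p = real (2 * m - 2)" using m by (simp add: p_def of_nat_diff)
        then show ?thesis using x by (simp add: K_def powr_minus powr_realpow)
      qed
      \<comment> \<open>Criticality of the exponent:
        \<open>p + \<alpha> * lam = \<alpha>\<close>.\<close>
      have KWl: "K * W powr lam = W"
      proof -
        have "K * W powr lam = \<rho> powr (- p + - \<alpha> * lam)" by (simp add: K_def W_def powr_powr powr_add[symmetric])
        also have "- p + - \<alpha> * lam = - \<alpha>" using lam by (simp add: \<alpha>_def field_simps)
        finally show ?thesis by (simp add: W_def)
      qed
      let ?B = "cball x r"
      have nB: "\<rho> / 2 \<le> norm y" "norm y \<le> 3/2 * \<rho>" if "y \<in> ?B" for y
      proof -
        have "norm (x - y) \<le> \<rho> / 2" using that by (simp add: dist_norm r_def)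
        then show "\<rho> / 2 \<le> norm y" "norm y \<le> 3/2 * \<rho>"
          using norm_triangle_ineq2[of x y] norm_triangle_ineq2[of y x] by (simp_all add: norm_minus_commute \<rho>_def)
      qed
      have BS: "?B \<subseteq> ?S" using nB x by fastforce
      have uB: "integrable lborel (\<lambda>y. indicator ?B y * u y)" and fB: "integrable lborel (\<lambda>y. indicator ?B y * f y)"
        by (rule integrable_indicator_continuous[OF compact_cball BS cu], rule integrable_indicator_continuous[OF compact_cball BS cf])
      have mass: "(\<integral>y. indicator ?B y * f y \<partial>lborel) \<le> \<epsilon> * K"
      proof -
        let ?q = "(\<rho> / 2) ^ (2 * m - 2)"
        have "?q * (\<integral>y. indicator ?B y * f y \<partial>lborel) = (\<integral>y. ?q * (indicator ?B y * f y) \<partial>lborel)" by simp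
        also have "\<dots> \<le> (\<integral>y. indicator ?B y * (norm y ^ (2 * m - 2) * f y) \<partial>lborel)"
        proof (rule integral_mono[OF integrable_mult_right[OF fB]])
          show "integrable lborel (\<lambda>y. indicator ?B y * (norm y ^ (2 * m - 2) * f y))"
            by (rule integrable_indicator_continuous[OF compact_cball BS]) (intro continuous_intros cf)
          fix y
          show "?q * (indicator ?B y * f y) \<le> indicator ?B y * (norm y ^ (2 * m - 2) * f y)"
          proof (cases "y \<in> ?B")
            case True
            then have "0 \<le> f y" using BS f0(1) by blast
            then have "?q * f y \<le> norm y ^ (2 * m - 2) * f y"
              using nB[OF True] x by (intro mult_right_mono power_mono) auto
            then show ?thesis using True by simp
          qed simp
        qed
        also have "\<dots> \<le> \<epsilon> * (1/2) ^ (2 * m - 2)"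
          using \<delta>2(2)[of x] x by (simp add: r_def \<rho>_def)
        finally show ?thesis using x by (simp add: Keq power_divide field_simps)
      qed
      have avg: "(\<integral>y. indicator ?B y * u y \<partial>lborel) \<le> C1 * \<rho>\<^sup>2"
      proof -
        \<comment> \<open>The annulus of \<open>C1(2)\<close> for \<open>e = \<rho> / 4\<close>,
          that is \<open>\<rho> / 2 <= |y| <= 2 \<rho>\<close>, which contains the ball.\<close>
        let ?A = "cball (0::real^'n) (8 * (\<rho> / 4)) - ball 0 (2 * (\<rho> / 4))"
        have AS: "?A \<subseteq> ?S" using x by auto
        have BA: "?B \<subseteq> ?A" using nB x by fastforce
        have "(\<integral>y. indicator ?B y * u y \<partial>lborel) \<le> (\<integral>y. indicator ?A y * u y \<partial>lborel)"
        proof (rule integral_mono[OF uB integrable_indicator_continuous[OF compact_annulus AS cu]])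
          show "indicator ?B y * u y \<le> indicator ?A y * u y" for y
          proof (cases "y \<in> ?A")
            case True
            then have "0 \<le> u y" using AS u(2) by blast
            then show ?thesis using True by (simp add: indicator_def)
          next
            case False
            then have "y \<notin> ?B" using BA by blast
            then show ?thesis using False by simp
          qed
        qed
        also have "\<dots> \<le> C1 * (\<rho> / 4)\<^sup>2" using x by (intro C1(2)) auto
        also have "\<dots> \<le> C1 * \<rho>\<^sup>2" using C1(1) x by (intro mult_left_mono power_mono) auto
        finally show ?thesis .
      qed
      have r0: "r > 0" using x by (simp add: r_def)
      show "u x \<le> C5 * \<epsilon> * norm x powr - \<alpha>"
      proof (cases "u x = 0")
        case True
        then show ?thesis using C5 \<epsilon> by simp
      next
        case False
        have "x \<in> ?S" using x by (auto simp: \<rho>_def)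
        then have ux: "u x > 0" using u(2)[of x] False by simp
        \<comment> \<open>The weight vanishes on the boundary while \<open>\<Phi> x > 0\<close>, so
          a maximum point is interior. Within half its distance to the boundary the weight drops at
          most by the factor \<open>2^n\<close>, hence \<open>u <= 2^n U\<close> there.\<close>
        define \<Phi> where "\<Phi> y = u y * (r - dist x y) ^ ?n" for y
        have "\<exists>y1\<in>?B. \<forall>y\<in>?B. \<Phi> y \<le> \<Phi> y1"
          unfolding \<Phi>_def using r0
          by (intro continuous_attains_sup) (auto intro!: continuous_intros continuous_on_subset[OF cu BS])
        then obtain y1 where y1: "y1 \<in> ?B" "\<And>y. y \<in> ?B \<Longrightarrow> \<Phi> y \<le> \<Phi> y1" by blast
        define U where "U = u y1"
        define d where "d = (r - dist x y1) / 2"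
        have d2: "2 * d = r - dist x y1" by (simp add: d_def)
        have Px: "u x * r ^ ?n \<le> U * (2 * d) ^ ?n"
          using y1(2)[of x] r0 by (simp add: \<Phi>_def U_def d2)
        have "0 < u x * r ^ ?n" using ux r0 by simp
        then have "0 < U * (2 * d) ^ ?n" using Px by linarith
        moreover have "d \<ge> 0" using y1(1) d2 by simp
        moreover have "U \<ge> 0" unfolding U_def using y1(1) BS u(2) by blast
        ultimately have d: "d > 0" and U: "U > 0"
          using m by (auto simp: zero_less_mult_iff order_less_le power_0_left)
        have dr: "d \<le> r" using d d2 zero_le_dist[of x y1] by linarith
        have sub: "cball y1 d \<subseteq> ?B"
        proof
          fix y assume "y \<in> cball y1 d"
          then have "dist x y \<le> dist x y1 + d" using dist_triangle[of x y y1] by simp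
          then show "y \<in> ?B" using d d2 by simp
        qed
        have uU: "u y \<le> 2 ^ ?n * U" if "y \<in> cball y1 d" for y
        proof -
          have "dist x y \<le> dist x y1 + d" using that dist_triangle[of x y y1] by simp
          then have "d \<le> r - dist x y" using d2 by linarith
          then have "d ^ ?n \<le> (r - dist x y) ^ ?n" using d by (intro power_mono) auto
          moreover have "0 \<le> u y" using that sub BS u(2) by blast
          ultimately have "u y * d ^ ?n \<le> \<Phi> y"
            unfolding \<Phi>_def by (intro mult_left_mono)
          also have "\<dots> \<le> \<Phi> y1" using y1(2) that sub by blast
          also have "\<dots> = 2 ^ ?n * U * d ^ ?n" by (simp add: \<Phi>_def U_def d2[symmetric] power_mult_distrib)
          finally show ?thesis using d by simp
        qed
        \<comment> \<open>\<open>exp s\<close> dominates \<open>f\<close> on the ball about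
          \<open>y1\<close>: the first summand controls \<open>u\<close>, the second controls
          \<open>g\<close>.\<close>
        define s where "s = (2 ^ ?n * U) powr lam + \<epsilon> powr lam * (G * W powr lam)"
        have s0: "s \<ge> 0" unfolding s_def G_def by (intro add_nonneg_nonneg mult_nonneg_nonneg) auto
        have fs: "f y \<le> exp s" if "y \<in> cball y1 d" for y
        proof -
          have yB: "y \<in> ?B" and yS: "y \<in> ?S" using that sub BS by blast+
          have "u y powr lam \<le> (2 ^ ?n * U) powr lam"
            using uU[OF that] u(2)[OF yS] lam by (intro powr_mono2) auto
          moreover have "g y powr lam \<le> \<epsilon> powr lam * (G * W powr lam)"
          proof -
            have "norm y < \<delta>1" using nB(2)[OF yB] x(4) \<delta>1(1) by linarith
            moreover have "y \<noteq> 0" using yS by blast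
            ultimately have "g y \<le> \<epsilon> * norm y powr - \<alpha>" by (intro \<delta>1(2))
            also have "\<dots> \<le> \<epsilon> * (1/2 * \<rho>) powr - \<alpha>"
              using nB[OF yB] x \<epsilon> \<alpha> by (intro mult_left_mono powr_mono2') auto
            also have "(1/2 * \<rho>) powr - \<alpha> = (1/2) powr - \<alpha> * W"
              unfolding W_def by (rule powr_mult)
            finally have "g y powr lam \<le> (\<epsilon> * ((1/2) powr - \<alpha> * W)) powr lam"
              using g0[OF yS] lam by (intro powr_mono2) auto
            also have "\<dots> = \<epsilon> powr lam * (G * W powr lam)"
              using \<epsilon> W0 by (simp add: powr_mult G_def)
            finally show ?thesis .
          qed
          ultimately have "exp (u y powr lam + g y powr lam) \<le> exp s" by (simp add: s_def)
          with f0(2)[OF yS] show ?thesis by linarith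
        qed
        have subS: "cball y1 d \<subseteq> ?S" using sub BS by blast
        have "(\<integral>y. indicator (cball y1 d) y * f y \<partial>lborel) \<le> (\<integral>y. indicator ?B y * f y \<partial>lborel)"
        proof (rule integral_mono[OF integrable_indicator_continuous[OF compact_cball subS cf] fB])
          show "indicator (cball y1 d) y * f y \<le> indicator ?B y * f y" for y
          proof (cases "y \<in> ?B")
            case True
            then have "0 \<le> f y" using BS f0(1) by blast
            then show ?thesis using True by (simp add: indicator_def)
          next
            case False
            then have "y \<notin> cball y1 d" using sub by blast
            then show ?thesis using False by simp
          qed
        qed
        then have mass': "(\<integral>y. indicator (cball y1 d) y * - iter_laplacian m u y \<partial>lborel) \<le> \<epsilon> * K"
          using mass by (simp add: f_def)
        have "(\<integral>y. indicator (cball y1 d) y * u y \<partial>lborel) \<le> (\<integral>y. indicator ?B y * u y \<partial>lborel)"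
        proof (rule integral_mono[OF integrable_indicator_continuous[OF compact_cball subS cu] uB])
          show "indicator (cball y1 d) y * u y \<le> indicator ?B y * u y" for y
          proof (cases "y \<in> ?B")
            case True
            then have "0 \<le> u y" using BS u(2) by blast
            then show ?thesis using True by (simp add: indicator_def)
          next
            case False
            then have "y \<notin> cball y1 d" using sub by blast
            then show ?thesis using False by simp
          qed
        qed
        then have avg': "(\<integral>y. indicator (cball y1 d) y * u y \<partial>lborel) \<le> C1 * \<rho>\<^sup>2"
          using avg by linarith
        have "U \<le> C2 * ((\<integral>y. indicator (cball y1 d) y * u y \<partial>lborel) / d ^ ?n + s * (\<epsilon> * K) + 1)"
          unfolding U_def
        proof (rule C2(2)[OF S u(1) subS d _ s0 _ _ mass'])
          show "d \<le> 1" using dr x by (simp add: r_def)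
          show "0 \<le> u y" if "y \<in> cball y1 d" for y using that subS u(2) by blast
          show "0 \<le> - iter_laplacian m u y \<and> - iter_laplacian m u y \<le> exp s" if "y \<in> cball y1 d" for y
          proof -
            have "0 \<le> f y" using that subS f0(1) by blast
            then show ?thesis using fs[OF that] by (simp add: f_def)
          qed
        qed
        also have "\<dots> \<le> C2 * (C1 * \<rho>\<^sup>2 / d ^ ?n + s * (\<epsilon> * K) + 1)"
          using avg' C2(1) d by (intro mult_left_mono add_right_mono divide_right_mono) auto
        finally have U1: "U \<le> C2 * C1 * \<rho>\<^sup>2 / d ^ ?n + C2 * s * \<epsilon> * K + C2"
          by (simp add: algebra_simps)
        have "C2 * s * \<epsilon> * K = (C2 * (2 ^ ?n) powr lam) * (\<epsilon> * K) * U powr lam + C2 * G * (\<epsilon> * \<epsilon> powr lam) * (K * W powr lam)"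
          using U by (simp add: s_def powr_mult algebra_simps)
        also have "\<dots> \<le> (U / 2 + C4 * (\<epsilon> * W)) + C2 * G * \<epsilon> * W"
        proof (rule add_mono)
          let ?a = "(C2 * (2 ^ ?n) powr lam) * (\<epsilon> * K)"
          have "?a * U powr lam \<le> U / 2 + (2 * ?a) powr (1 / (1 - lam))"
            using C2(1) \<epsilon> K1 U lam by (intro powr_absorb) auto
          also have "(2 * ?a) powr (1 / (1 - lam)) = C4 * (\<epsilon> powr (1 / (1 - lam)) * W)"
          proof -
            have "(2 * ?a) powr (1 / (1 - lam)) = C4 * (\<epsilon> powr (1 / (1 - lam)) * K powr (1 / (1 - lam)))"
              using C2(1) \<epsilon> K1 by (simp add: C4_def powr_mult mult.assoc[symmetric])
            also have "K powr (1 / (1 - lam)) = W" by (simp add: K_def W_def \<alpha>_def powr_powr)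
            finally show ?thesis .
          qed
          also have "\<dots> \<le> C4 * (\<epsilon> * W)"
          proof -
            \<comment> \<open>The exponent exceeds 1 and \<open>\<epsilon> <= 1\<close>.\<close>
            have "\<epsilon> powr (1 / (1 - lam)) \<le> \<epsilon> powr 1" using \<epsilon> lam by (intro powr_mono') auto
            then show ?thesis using \<epsilon> W0 by (intro mult_left_mono mult_right_mono) (auto simp: C4_def)
          qed
          finally show "?a * U powr lam \<le> U / 2 + C4 * (\<epsilon> * W)" by simp
          have "\<epsilon> powr lam \<le> 1" using \<epsilon> lam by (simp add: powr_le1)
          then have "\<epsilon> * \<epsilon> powr lam \<le> \<epsilon> * 1" using \<epsilon> by (intro mult_left_mono) auto
          then show "C2 * G * (\<epsilon> * \<epsilon> powr lam) * (K * W powr lam) \<le> C2 * G * \<epsilon> * W"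
            unfolding KWl using C2(1) W0 by (intro mult_right_mono mult_left_mono) (auto simp: G_def)
        qed
        finally have "C2 * s * \<epsilon> * K \<le> (U / 2 + C4 * (\<epsilon> * W)) + C2 * G * \<epsilon> * W" .
        moreover have "(C4 + C2 * G) * (\<epsilon> * W) = C4 * (\<epsilon> * W) + C2 * G * \<epsilon> * W"
          by (simp add: distrib_right mult.assoc)
        moreover have "a \<le> 2 * (z + q + c)" if "y \<le> (a / 2 + b) + b'" "q = b + b'" "a \<le> z + y + c"
          for a b b' c q y z :: real using that by simp
        ultimately have U2: "U \<le> 2 * (C2 * C1 * \<rho>\<^sup>2 / d ^ ?n + (C4 + C2 * G) * (\<epsilon> * W) + C2)"
          using U1 by blast
        \<comment> \<open>Return to \<open>x\<close>: the factor \<open>(2d)^n\<close> cancels the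
          uncontrolled \<open>d^n\<close> below the average of \<open>u\<close>, and in the other
          terms \<open>d <= r\<close>. Then \<open>\<rho>^2 = 2^n K r^n\<close>, due to
          \<open>r = \<rho> / 2\<close>, restores a common factor \<open>r^n\<close>.\<close>
        have "u x * r ^ ?n \<le> U * (2 * d) ^ ?n" by (rule Px)
        also have "\<dots> \<le> 2 * (C2 * C1 * \<rho>\<^sup>2 / d ^ ?n + (C4 + C2 * G) * (\<epsilon> * W) + C2) * (2 * d) ^ ?n"
          using U2 d by (intro mult_right_mono) auto
        also have "\<dots> = 2 * 2 ^ ?n * (C2 * C1 * \<rho>\<^sup>2 + ((C4 + C2 * G) * (\<epsilon> * W) + C2) * d ^ ?n)"
          using d by (simp add: power_mult_distrib field_simps)
        also have "\<dots> \<le> 2 * 2 ^ ?n * (C2 * C1 * \<rho>\<^sup>2 + ((C4 + C2 * G) * (\<epsilon> * W) + C2) * r ^ ?n)"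
          using d dr C2(1) \<epsilon> W0
          by (intro mult_left_mono add_left_mono power_mono) (auto simp: C4_def G_def)
        also have "C2 * C1 * \<rho>\<^sup>2 = C2 * C1 * 2 ^ ?n * K * r ^ ?n"
        proof -
          have "2 * m - 2 + 2 = ?n" using m by simp
          then have "\<rho> ^ ?n = \<rho> ^ (2 * m - 2) * \<rho>\<^sup>2" by (simp only: power_add[symmetric])
          then show ?thesis using x by (simp add: r_def power_divide Keq)
        qed
        also have "2 * 2 ^ ?n * (C2 * C1 * 2 ^ ?n * K * r ^ ?n + ((C4 + C2 * G) * (\<epsilon> * W) + C2) * r ^ ?n)
          = 2 * 2 ^ ?n * (C2 * C1 * 2 ^ ?n * K + (C4 + C2 * G) * (\<epsilon> * W) + C2) * r ^ ?n"
          by (simp add: algebra_simps)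
        finally have "u x \<le> 2 * 2 ^ ?n * (C2 * C1 * 2 ^ ?n * K + (C4 + C2 * G) * (\<epsilon> * W) + C2)"
          using r0 by simp
        also have "\<dots> \<le> 2 * 2 ^ ?n * (C2 * C1 * 2 ^ ?n * (\<epsilon> * W) + (C4 + C2 * G) * (\<epsilon> * W) + C2 * (\<epsilon> * W))"
        proof -
          \<comment> \<open>Constants are absorbed through
            \<open>1 <= K <= \<epsilon> * W\<close>.\<close>
          have "C2 * 1 \<le> C2 * (\<epsilon> * W)" using K1 KW C2(1) by (intro mult_left_mono) auto
          moreover have "C2 * C1 * 2 ^ ?n * K \<le> C2 * C1 * 2 ^ ?n * (\<epsilon> * W)"
            using KW C1(1) C2(1) by (intro mult_left_mono) auto
          ultimately have "C2 * C1 * 2 ^ ?n * K + (C4 + C2 * G) * (\<epsilon> * W) + C2 * 1 \<le>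
              C2 * C1 * 2 ^ ?n * (\<epsilon> * W) + (C4 + C2 * G) * (\<epsilon> * W) + C2 * (\<epsilon> * W)"
            by (rule add_mono[OF add_right_mono, rotated])
          then show ?thesis by (intro mult_left_mono[of _ _ "2 * 2 ^ ?n"]) auto
        qed
        also have "\<dots> = C5 * \<epsilon> * W" by (simp add: C5_def algebra_simps)
        finally show ?thesis by (simp add: W_def \<rho>_def)
      qed
    qed
  qed
qed

theorem theorem3p3:
  fixes m n :: nat and lam :: real
    and g u :: "real^'n \<Rightarrow> real"
  assumes "m \<ge> 2" and "n \<ge> 2" and "odd m" and "2 * m = n"
    and "CARD('n) = n"
    and "0 < lam" and "lam < 1"
    and "continuous_on (ball 0 2 - {0}) g"
    and "\<forall>x\<in>ball 0 2 - {0}. g x \<ge> 0"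
    and "g \<in> o[at 0](\<lambda>x. norm x powr (- (real n - 2) / (1 - lam)))"
    and "C_k_on (2 * m) (ball 0 2 - {0}) u"
    and "\<forall>x\<in>ball 0 2 - {0}. u x \<ge> 0"
    and "\<forall>x\<in>ball 0 2 - {0}. 0 \<le> - iter_laplacian m u x
            \<and> - iter_laplacian m u x \<le> exp (u x powr lam + g x powr lam)"
  shows "u \<in> o[at 0](\<lambda>x. norm x powr (- (real n - 2) / (1 - lam)))"
proof (rule landau_o.smallI)
  have ex: "- (real n - 2) / (1 - lam) = - ((2 * real m - 2) / (1 - lam))"
  proof -
    have "real n - 2 = 2 * real m - 2" using assms(4) by auto
    then show ?thesis by (simp only: minus_divide_left)
  qed
  have go: "g \<in> o[at 0](\<lambda>x. norm x powr - ((2 * real m - 2) / (1 - lam)))"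
    using assms(10) unfolding ex .
  have card: "CARD('n) = 2 * m" using assms(4,5) by simp
  fix c :: real assume c: "c > 0"
  obtain C where C: "C > 0" "\<And>\<epsilon>. 0 < \<epsilon> \<Longrightarrow> \<epsilon> \<le> 1 \<Longrightarrow>
    eventually (\<lambda>x. u x \<le> C * \<epsilon> * norm x powr - ((2 * real m - 2) / (1 - lam))) (at 0)"
    by (rule pointwise_bound[OF assms(1) card assms(6,7) _ go assms(11), of thesis]) (use assms(9,12,13) in blast)+
  define \<epsilon> where "\<epsilon> = min 1 (c / C)"
  have \<epsilon>: "0 < \<epsilon>" "\<epsilon> \<le> 1" "C * \<epsilon> \<le> c" using C(1) c by (auto simp: \<epsilon>_def min_def field_simps)
  have "eventually (\<lambda>x::real^'n. x \<in> ball 0 2 - {0}) (at 0)"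
    unfolding eventually_at by (intro exI[of _ 2]) auto
  with C(2)[OF \<epsilon>(1,2)]
  show "eventually (\<lambda>x. norm (u x) \<le> c * norm (norm x powr (- (real n - 2) / (1 - lam)))) (at 0)"
    unfolding ex
  proof eventually_elim
    case (elim x)
    have "C * \<epsilon> * norm x powr - ((2 * real m - 2) / (1 - lam)) \<le> c * norm x powr - ((2 * real m - 2) / (1 - lam))"
      using \<epsilon>(3) by (intro mult_right_mono) auto
    moreover have "0 \<le> u x" using assms(12) elim(2) by blast
    ultimately show ?case using elim(1) by simp
  qed
qed

end
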